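(* Let $r\ge 1$ and let $\mathbf{k}=(k_1,\ldots,k_r)$ be any finite sequence of positive integers. Then, in $\mathbb{R}[T]$, $$\sum_{\sigma\in S_r}\zeta^{\star}_{\mathrm{sh}}(k_{\sigma(1)},\ldots,k_{\sigma(r)};T)=\sum_{\Pi\in\mathcal{P}_r}c^{\star}(\Pi)\,H_{\mathrm{sh}}(\mathbf{k},\Pi;T),$$ where $S_r$ is the symmetric group of degree $r$ and $\mathcal{P}_r$ is the set of partitions of the set $\{1,\ldots,r\}$.
   Context: An index is a finite sequence $\mathbf{k}=(k_1,\ldots,k_r)$ of positive integers. For $k_r>1$ the multiple zeta value is $\zeta(k_1,\ldots,k_r)=\sum_{0<m_1<\cdots<m_r}\frac{1}{m_1^{k_1}\cdots m_r^{k_r}}$ and the multiple zeta-star value is $\zeta^{\star}(k_1,\ldots,k_r)=\sum_{0<m_1\le\cdots\le m_r}\frac{1}{m_1^{k_1}\cdots m_r^{k_r}}$. Shuffle-regularized polynomials $\zeta^{\star}_{\mathrm{sh}}(\mathbf{k};T)\in\mathbb{R}[T]$ (Kaneko–Yamamoto). Let $\mathbb{Q}\langle e_0,e_1\rangle$ be the noncommutative polynomial algebra equipped with the shuffle product, and let $\mathfrak{h}^1=\mathbb{Q}+e_1\mathbb{Q}\langle e_0,e_1\rangle\supset\mathfrak{h}^0=\mathbb{Q}+e_1\mathbb{Q}\langle e_0,e_1\rangle e_0$, which are shuffle subalgebras; $\mathfrak{h}^1$ is a polynomial algebra in $e_1$ over $\mathfrak{h}^0$ for the shuffle product. The $\mathbb{Q}$-linear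 map $Z:\mathfrak{h}^0\to\mathbb{R}$ with $Z(1)=1$ and $Z(e_1e_0^{k_1-1}\cdots e_1e_0^{k_r-1})=\zeta(k_1,\ldots,k_r)$ (for $k_r>1$) is a shuffle homomorphism (by the iterated integral expression with $e_1\leftrightarrow dt/(1-t)$, $e_0\leftrightarrow dt/t$, letters read from the smallest to the largest variable). Let $Z_{\mathrm{sh}}:\mathfrak{h}^1\to\mathbb{R}[T]$ be the unique shuffle homomorphism extending $Z$ with $Z_{\mathrm{sh}}(e_1)=T$. For an index $\mathbf{k}=(k_1,\ldots,k_r)$ let $X_{\mathbf{k}}$ be the finite poset with elements $x_{i,j}$ ($1\le i\le r$, $1\le j\le k_i$) whose order is generated by $x_{i,1}<x_{i,2}<\cdots<x_{i,k_i}$ for each $i$, and $x_{i,1}<x_{i+1,k_{i+1}}$ for $1\le i<r$; label $x_{i,1}$ by $e_1$ and $x_{i,j}$ ($j\ge2$) by $e_0$. Let $w_{\mathbf{k}}\in\mathfrak{h}^1$ be the sum over all linear extensions of $X_{\mathbf{k}}$ of the word obtained by reading the labels from the smallest to the largest element. Then $\zeta^{\star}_{\mathrm{sh}}(\mathbf{k};T):=Z_{\mathrm{sh}}(w_{\mathbf{k}})$. It equals $\zeta^{\star}(\mathbf{k})$ when $k_r>1$. Right-hand side. For $\Pi=\{P_1,\ldots,P_g\}\in\mathcal{P}_r$ (the $P_i$ being the blocks of $\Pi$), $c^{\star}(\Pi)=\prod_{i=1}^{g}(|P_i|-1)!$. For a positive integer $k$, $\eta(k;T)=\zeta(k)$ if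 $k>1$ and $\eta(1;T)=T$. Let $\chi_{\mathrm{sh}}(\mathbf{k},P_i)=0$ if $|P_i|>1$ and $k_p=1$ for all $p\in P_i$, and $\chi_{\mathrm{sh}}(\mathbf{k},P_i)=1$ otherwise. Define $$H_{\mathrm{sh}}(\mathbf{k},\Pi;T)=\prod_{i=1}^{g}\chi_{\mathrm{sh}}(\mathbf{k},P_i)\,\eta\Big(\sum_{p\in P_i}k_p;T\Big).$$ *)

theory Defs
  imports "HOL-Analysis.Analysis" "HOL-Library.Poly_Mapping" "HOL-Library.Multiset"
    "HOL-Library.FuncSet" "HOL-Library.Disjoint_Sets"
    "HOL-Computational_Algebra.Polynomial" "HOL-Combinatorics.Permutations"
begin

section \<open>Indices and multiple zeta values\<close>

definition is_index :: "nat list \<Rightarrow> bool" where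
  "is_index k \<longleftrightarrow> (\<forall>x\<in>set k. 1 \<le> x)"

text \<open>Only meaningful for the empty index and for indices whose last entry exceeds 1;
  otherwise the family is not summable and \<^term>\<open>infsum\<close> returns 0.\<close>
definition mzv :: "nat list \<Rightarrow> real" where
  "mzv k = (\<Sum>\<^sub>\<infinity>m\<in>{m :: nat list. length m = length k \<and> sorted_wrt (<) m \<and> (\<forall>x\<in>set m. 0 < x)}.
              \<Prod>i<length k. 1 / real (m ! i) ^ (k ! i))"

section \<open>The shuffle algebra\<close>

datatype letter = E0 | E1

type_synonym word = "letter list"

text \<open>Finitely supported functions from words to the rationals: the underlying vector space
  of the noncommutative polynomial algebra in \<^term>\<open>E0\<close> and \<^term>\<open>E1\<close>.\<close>
type_synonym ncpoly = "word \<Rightarrow>\<^sub>0 rat"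

definition scale :: "rat \<Rightarrow> ncpoly \<Rightarrow> ncpoly" where
  "scale c f = Poly_Mapping.map (\<lambda>x. c * x) f"

text \<open>Shuffles with multiplicity, unlike \<^const>\<open>shuffles\<close>, which yields a set.\<close>
fun shuffle_words :: "'a list \<Rightarrow> 'a list \<Rightarrow> 'a list multiset" where
  "shuffle_words [] v = {#v#}"
| "shuffle_words u [] = {#u#}"
| "shuffle_words (a # u) (b # v) =
     image_mset ((#) a) (shuffle_words u (b # v)) + image_mset ((#) b) (shuffle_words (a # u) v)"

definition shuffle :: "ncpoly \<Rightarrow> ncpoly \<Rightarrow> ncpoly" where
  "shuffle f g =
     (\<Sum>u\<in>Poly_Mapping.keys f. \<Sum>v\<in>Poly_Mapping.keys g. \<Sum>w\<in>#shuffle_words u v.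
        Poly_Mapping.single w (Poly_Mapping.lookup f u * Poly_Mapping.lookup g v))"

definition h1 :: "ncpoly set" where
  "h1 = {f. \<forall>w\<in>Poly_Mapping.keys f. w = [] \<or> hd w = E1}"

definition h0 :: "ncpoly set" where
  "h0 = {f. \<forall>w\<in>Poly_Mapping.keys f. w = [] \<or> (hd w = E1 \<and> last w = E0)}"

section \<open>The shuffle regularization\<close>

definition word_of_index :: "nat list \<Rightarrow> word" where
  "word_of_index k = concat (map (\<lambda>x. E1 # replicate (x - 1) E0) k)"

text \<open>The linear map sending the word of an admissible index to its multiple zeta value; the
  word map is injective on indices.  Only the values on \<^const>\<open>h0\<close> are relevant.\<close>
definition Z :: "ncpoly \<Rightarrow> real" where
  "Z f = (\<Sum>w\<in>Poly_Mapping.keys f. of_rat (Poly_Mapping.lookup f w) *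
            mzv (the_inv_into {k. is_index k} word_of_index w))"

definition shuffle_hom :: "(ncpoly \<Rightarrow> real poly) \<Rightarrow> bool" where
  "shuffle_hom \<phi> \<longleftrightarrow>
     (\<forall>f\<in>h1. \<forall>g\<in>h1. \<phi> (f + g) = \<phi> f + \<phi> g) \<and>
     (\<forall>c. \<forall>f\<in>h1. \<phi> (scale c f) = smult (of_rat c) (\<phi> f)) \<and>
     \<phi> (Poly_Mapping.single [] 1) = 1 \<and>
     (\<forall>f\<in>h1. \<forall>g\<in>h1. \<phi> (shuffle f g) = \<phi> f * \<phi> g)"

text \<open>Functions on \<^const>\<open>h1\<close> are total functions with the fixed value \<^term>\<open>undefined\<close> elsewhere.\<close>
definition Z_sh :: "ncpoly \<Rightarrow> real poly" where
  "Z_sh = (THE \<phi>. \<phi> \<in> extensional h1 \<and> shuffle_hom \<phi> \<and>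
             (\<forall>f\<in>h0. \<phi> f = [:Z f:]) \<and> \<phi> (Poly_Mapping.single [E1] 1) = [:0, 1:])"

section \<open>Shuffle-regularized zeta-star polynomials\<close>

text \<open>The pair \<open>(i, j)\<close> stands for the element \<open>x\<close> with indices \<open>i + 1\<close> and \<open>j\<close>:
  lists count from 0, whereas \<open>j\<close> counts from 1.\<close>
definition X_elems :: "nat list \<Rightarrow> (nat \<times> nat) set" where
  "X_elems k = {(i, j). i < length k \<and> 1 \<le> j \<and> j \<le> k ! i}"

definition X_less :: "nat list \<Rightarrow> ((nat \<times> nat) \<times> (nat \<times> nat)) set" where
  "X_less k =
     ({((i, j), (i, j + 1)) | i j. i < length k \<and> 1 \<le> j \<and> j < k ! i} \<union>
      {((i, 1), (i + 1, k ! (i + 1))) | i. i + 1 < length k})\<^sup>+"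

fun X_label :: "nat \<times> nat \<Rightarrow> letter" where
  "X_label (i, j) = (if j = 1 then E1 else E0)"

text \<open>A linear extension is given as the list of all elements in increasing order.\<close>
definition linear_extensions :: "nat list \<Rightarrow> (nat \<times> nat) list set" where
  "linear_extensions k =
     {xs. distinct xs \<and> set xs = X_elems k \<and>
          (\<forall>a<length xs. \<forall>b<length xs. (xs ! a, xs ! b) \<in> X_less k \<longrightarrow> a < b)}"

definition w_index :: "nat list \<Rightarrow> ncpoly" where
  "w_index k = (\<Sum>xs\<in>linear_extensions k. Poly_Mapping.single (map X_label xs) 1)"

definition zeta_star_sh :: "nat list \<Rightarrow> real poly" where
  "zeta_star_sh k = Z_sh (w_index k)"

section \<open>The partition side\<close>

definition c_star :: "nat set set \<Rightarrow> nat" where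
  "c_star Q = (\<Prod>P\<in>Q. fact (card P - 1))"

definition eta :: "nat \<Rightarrow> real poly" where
  "eta n = (if n > 1 then [:mzv [n]:] else [:0, 1:])"

definition chi_sh :: "(nat \<Rightarrow> nat) \<Rightarrow> nat set \<Rightarrow> real poly" where
  "chi_sh k P = (if card P > 1 \<and> (\<forall>p\<in>P. k p = 1) then 0 else 1)"

definition H_sh :: "(nat \<Rightarrow> nat) \<Rightarrow> nat set set \<Rightarrow> real poly" where
  "H_sh k Q = (\<Prod>P\<in>Q. chi_sh k P * eta (\<Sum>p\<in>P. k p))"

end

theory Submission
  imports Defs "HOL-Real_Asymp.Real_Asymp" "HOL-Combinatorics.Multiset_Permutations"
begin

text \<open>
  The regularization is realized analytically. A word \<open>w\<close> that does not start with \<open>E0\<close> has a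
  multiple polylogarithm \<open>polylog w z = (\<Sum>n. polylog_coeff w n * z ^ n)\<close>, the iterated integral of
  \<open>dt/t\<close> and \<open>dt/(1-t)\<close> along \<open>w\<close>. Shuffle products of words become products of functions, because
  both sides satisfy the same differential equation (\<open>polylog_fps_shuffle\<close>). As \<open>z\<close> tends to 1 from
  below, \<open>polylog w z\<close> agrees with a polynomial in \<open>- ln (1 - z)\<close> up to an error that decays
  faster than every negative power of the logarithm. These polynomials are unique and multiplicative;
  they are the zeta values on admissible words and the variable \<open>T\<close> on \<open>E1\<close>. Every element of \<^const>\<open>h1\<close> is a shuffle
  polynomial in \<open>E1\<close> over \<^const>\<open>h0\<close> (\<open>h1_generated\<close>), so this assignment exists on all of
  \<^const>\<open>h1\<close> and is the only possible regularization: it is \<^const>\<open>Z_sh\<close> (\<open>Z_sh_eq_reg\<close>).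

  For a finite set \<open>B\<close> of positions let \<open>sym_mzv k B\<close> be the sum of the regularized non-star values
  over all orderings of \<open>B\<close>. Its truncation at \<open>N\<close> is the sum of \<open>\<Prod>b\<in>B. 1 / m b ^ k b\<close> over all
  injective maps \<open>m\<close> from \<open>B\<close> to \<open>{1..N}\<close>, and the polylogarithms are Abel means of these truncations.
  Choosing \<open>m b\<close> freely and subtracting the coincidences \<open>m b = m c\<close> gives a recursion that merges the
  entry \<open>k b\<close> into the others (\<open>sym_trunc_insert\<close>). If \<open>k b \<ge> 2\<close>, the truncated \<open>\<zeta>(k b)\<close> may be replaced
  by its limit, and the recursion passes to the regularized values (\<open>sym_mzv_insert\<close>). It reduces
  everything to the case that all entries are 1, where the value is \<open>T ^ card B\<close>: this is the origin of
  \<^const>\<open>chi_sh\<close>. The outcome is a sum over set partitions in which a block \<open>P\<close> has the weight of the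
  theorem multiplied by \<open>(-1) ^ (card P - 1)\<close> (\<open>sym_mzv_eq_partition_sum\<close>).

  The passage to star values is an antipode relation. Cut the index after position \<open>i\<close>, turn the first
  part into one chain in reversed order, and shuffle it with the poset of the second part. Comparing the
  two elements at the cut splits the linear extensions into two kinds, and the alternating sum over \<open>i\<close>
  telescopes to zero (\<open>zeta_star_antipode\<close>). Summed over all orderings it says that the family of
  signed symmetric sums \<open>(-1) ^ card B * sym_mzv k B\<close> is the convolution inverse, over subsets, of the
  family of symmetric star sums. The former is the partition sum for the block weights negated, hence its
  convolution inverse is the partition sum for the block weights themselves
  (\<open>partition_sum_convolution\<close>), which is the right-hand side of the theorem.
\<close>

section \<open>Shuffles of words\<close>

abbreviation word_poly :: "word \<Rightarrow> ncpoly" where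
  "word_poly w \<equiv> Poly_Mapping.single w 1"

definition h1_word :: "word \<Rightarrow> bool" where
  "h1_word w \<longleftrightarrow> w = [] \<or> hd w = E1"

lemma h1_word_Nil [simp]: "h1_word []"
  by (simp add: h1_word_def)

lemma h1_word_butlast: "h1_word (w @ [a]) \<Longrightarrow> h1_word w"
  by (cases w) (auto simp: h1_word_def)

lemma shuffle_words_Nil2 [simp]: "shuffle_words u [] = {#u#}"
  by (cases u) auto

text \<open>A shuffle starts with the first letter of one of its factors; this keeps \<^const>\<open>h1\<close> closed.\<close>
lemma hd_shuffle_words:
  assumes "w \<in># shuffle_words u v"
  shows "w = [] \<and> u = [] \<and> v = [] \<or> (w \<noteq> [] \<and> (u \<noteq> [] \<and> hd w = hd u \<or> v \<noteq> [] \<and> hd w = hd v))"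
  using assms by (cases "(u, v)" rule: shuffle_words.cases) auto

lemma h1_word_shuffle:
  assumes "w \<in># shuffle_words u v" "h1_word u" "h1_word v"
  shows "h1_word w"
  using hd_shuffle_words[OF assms(1)] assms(2,3) by (auto simp: h1_word_def)

lemma shuffle_words_snoc_singleton:
  "shuffle_words [a] (v @ [b]) = add_mset (v @ [b, a]) (image_mset (\<lambda>x. x @ [b]) (shuffle_words [a] v))"
  by (induction v) (auto simp: image_mset.compositionality comp_def)

lemma shuffle_words_snoc_singleton2:
  "shuffle_words (v @ [b]) [a] = add_mset (v @ [b, a]) (image_mset (\<lambda>x. x @ [b]) (shuffle_words v [a]))"
  by (induction v) (auto simp: image_mset.compositionality comp_def)

text \<open>The shuffle product is defined by removing first letters, but polylogarithms are differentiated with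
  respect to the outermost, that is the last, letter. Hence the recursion is also needed at the other end.\<close>
lemma shuffle_words_snoc:
  "shuffle_words (u @ [a]) (v @ [b]) =
     image_mset (\<lambda>x. x @ [a]) (shuffle_words u (v @ [b])) +
     image_mset (\<lambda>x. x @ [b]) (shuffle_words (u @ [a]) v)"
proof (induction u v rule: shuffle_words.induct)
  case (1 v)
  then show ?case by (simp add: shuffle_words_snoc_singleton)
next
  case (2 c u)
  then show ?case using shuffle_words_snoc_singleton2[of "c # u" a b] by simp
next
  case (3 c u d v)
  then show ?case
    by (simp add: image_mset.compositionality comp_def)
qed

text \<open>A single letter is inserted either to the left or to the right of a marked letter \<open>b\<close>.\<close>
lemma shuffle_words_letter_append:
  "shuffle_words [a] (u @ b # v) =
     image_mset (\<lambda>x. x @ b # v) (shuffle_words [a] u) +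
     image_mset (\<lambda>x. u @ b # x) (shuffle_words [a] v)"
  by (induction u) (auto simp: image_mset.compositionality comp_def)

lemma shuffle_words_letter_replicate:
  "shuffle_words [a] (replicate m a) = replicate_mset (Suc m) (replicate (Suc m) a)"
  by (induction m) auto


section \<open>Linear functionals on noncommutative polynomials\<close>

definition linear_ext :: "(word \<Rightarrow> real) \<Rightarrow> ncpoly \<Rightarrow> real" where
  "linear_ext c f = (\<Sum>w\<in>Poly_Mapping.keys f. of_rat (Poly_Mapping.lookup f w) * c w)"

lemma linear_ext_superset:
  assumes "finite K" "Poly_Mapping.keys f \<subseteq> K"
  shows "linear_ext c f = (\<Sum>w\<in>K. of_rat (Poly_Mapping.lookup f w) * c w)"
  unfolding linear_ext_def
  by (rule sum.mono_neutral_left) (use assms in \<open>auto simp: in_keys_iff\<close>)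

lemma linear_ext_add: "linear_ext c (f + g) = linear_ext c f + linear_ext c g"
proof -
  let ?K = "Poly_Mapping.keys f \<union> Poly_Mapping.keys g"
  have "linear_ext c (f + g) = (\<Sum>w\<in>?K. of_rat (Poly_Mapping.lookup (f + g) w) * c w)"
    by (rule linear_ext_superset) (simp_all add: Poly_Mapping.keys_add)
  also have "\<dots> = (\<Sum>w\<in>?K. of_rat (Poly_Mapping.lookup f w) * c w) +
                   (\<Sum>w\<in>?K. of_rat (Poly_Mapping.lookup g w) * c w)"
    by (simp add: lookup_add of_rat_add algebra_simps sum.distrib)
  finally show ?thesis
    by (simp flip: linear_ext_superset)
qed

lemma linear_ext_0 [simp]: "linear_ext c 0 = 0"
  by (simp add: linear_ext_def)

lemma linear_ext_sum: "linear_ext c (\<Sum>x\<in>A. f x) = (\<Sum>x\<in>A. linear_ext c (f x))"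
  by (induction A rule: infinite_finite_induct) (auto simp: linear_ext_add)

lemma linear_ext_sum_mset: "linear_ext c (\<Sum>x\<in>#A. f x) = (\<Sum>x\<in>#A. linear_ext c (f x))"
  by (induction A) (auto simp: linear_ext_add)

lemma linear_ext_single: "linear_ext c (Poly_Mapping.single w a) = of_rat a * c w"
  by (simp add: linear_ext_def)

lemma lookup_scale [simp]: "Poly_Mapping.lookup (scale a f) w = a * Poly_Mapping.lookup f w"
  unfolding scale_def by transfer (auto simp: when_def)

lemma keys_scale: "Poly_Mapping.keys (scale a f) \<subseteq> Poly_Mapping.keys f"
  by (auto simp: in_keys_iff)

lemma linear_ext_scale: "linear_ext c (scale a f) = of_rat a * linear_ext c f"
proof -
  have "linear_ext c (scale a f) =
          (\<Sum>w\<in>Poly_Mapping.keys f. of_rat (Poly_Mapping.lookup (scale a f) w) * c w)"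
    by (rule linear_ext_superset) (auto intro: keys_scale[THEN subsetD])
  then show ?thesis
    by (simp add: linear_ext_def sum_distrib_left of_rat_mult mult.assoc)
qed

text \<open>For a functional to be multiplicative it suffices to test words, and only those that occur in
  elements of \<^const>\<open>h1\<close>.\<close>
lemma linear_ext_shuffle:
  assumes "f \<in> h1" "g \<in> h1"
    and mult: "\<And>u v. h1_word u \<Longrightarrow> h1_word v \<Longrightarrow> (\<Sum>w\<in>#shuffle_words u v. c w) = c u * c v"
  shows "linear_ext c (shuffle f g) = linear_ext c f * linear_ext c g"
proof -
  have "linear_ext c (shuffle f g) =
     (\<Sum>u\<in>Poly_Mapping.keys f. \<Sum>v\<in>Poly_Mapping.keys g.
        of_rat (Poly_Mapping.lookup f u * Poly_Mapping.lookup g v) * (\<Sum>w\<in>#shuffle_words u v. c w))"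
    unfolding shuffle_def
    by (simp add: linear_ext_sum linear_ext_sum_mset linear_ext_single sum_mset_distrib_left)
  also have "\<dots> = (\<Sum>u\<in>Poly_Mapping.keys f. \<Sum>v\<in>Poly_Mapping.keys g.
        (of_rat (Poly_Mapping.lookup f u) * c u) * (of_rat (Poly_Mapping.lookup g v) * c v))"
  proof (intro sum.cong refl, goal_cases)
    case (1 u v)
    then have "h1_word u" "h1_word v"
      using assms(1,2) by (auto simp: h1_def h1_word_def)
    from mult[OF this] show ?case by (simp add: of_rat_mult)
  qed
  also have "\<dots> = linear_ext c f * linear_ext c g"
    unfolding linear_ext_def by (simp add: sum_product)
  finally show ?thesis .
qed


section \<open>The shuffle algebra is generated by the admissible words and one letter\<close>

lemma h1_iff: "f \<in> h1 \<longleftrightarrow> (\<forall>w\<in>Poly_Mapping.keys f. h1_word w)"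
  by (simp add: h1_def h1_word_def)

lemma h0_subset_h1: "h0 \<subseteq> h1"
  by (auto simp: h0_def h1_def)

lemma h1_add: "f \<in> h1 \<Longrightarrow> g \<in> h1 \<Longrightarrow> f + g \<in> h1"
  by (auto simp: h1_iff dest!: Poly_Mapping.keys_add[THEN subsetD])

lemma h1_0 [simp]: "0 \<in> h1"
  by (simp add: h1_iff)

lemma h1_sum: "(\<And>x. x \<in> A \<Longrightarrow> f x \<in> h1) \<Longrightarrow> (\<Sum>x\<in>A. f x) \<in> h1"
  by (induction A rule: infinite_finite_induct) (auto intro: h1_add)

lemma h1_sum_mset: "(\<And>x. x \<in># A \<Longrightarrow> f x \<in> h1) \<Longrightarrow> (\<Sum>x\<in>#A. f x) \<in> h1"
  by (induction A) (auto intro: h1_add)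

lemma h1_scale: "f \<in> h1 \<Longrightarrow> scale c f \<in> h1"
  by (auto simp: h1_iff dest!: keys_scale[THEN subsetD])

lemma h1_single: "h1_word w \<Longrightarrow> Poly_Mapping.single w c \<in> h1"
  by (auto simp: h1_iff split: if_splits)

lemma h1_shuffle: "f \<in> h1 \<Longrightarrow> g \<in> h1 \<Longrightarrow> shuffle f g \<in> h1"
  unfolding shuffle_def
  by (intro h1_sum h1_sum_mset h1_single) (auto simp: h1_iff intro: h1_word_shuffle)

lemma shuffle_word_poly: "shuffle (word_poly u) (word_poly v) = (\<Sum>w\<in>#shuffle_words u v. word_poly w)"
  by (simp add: shuffle_def)

lemma ncpoly_expand: "f = (\<Sum>w\<in>Poly_Mapping.keys f. scale (Poly_Mapping.lookup f w) (word_poly w))"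
proof (rule poly_mapping_eqI)
  fix v
  have "Poly_Mapping.lookup (\<Sum>w\<in>Poly_Mapping.keys f. scale (Poly_Mapping.lookup f w) (word_poly w)) v =
        (\<Sum>w\<in>Poly_Mapping.keys f. if w = v then Poly_Mapping.lookup f w else 0)"
    unfolding lookup_sum by (intro sum.cong refl) (simp add: lookup_single)
  also have "\<dots> = Poly_Mapping.lookup f v"
    by (cases "v \<in> Poly_Mapping.keys f") (auto simp: not_in_keys_iff_lookup_eq_zero)
  finally show "Poly_Mapping.lookup f v = Poly_Mapping.lookup
      (\<Sum>w\<in>Poly_Mapping.keys f. scale (Poly_Mapping.lookup f w) (word_poly w)) v" ..
qed

lemma sum_replicate_word:
  "(\<Sum>x\<in>#replicate_mset n w. word_poly x) = scale (of_nat n) (word_poly w)"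
  by (induction n) (auto intro!: poly_mapping_eqI simp: lookup_add algebra_simps)

text \<open>Write a word as \<open>u @ replicate m E1\<close> with \<open>u\<close> empty or ending in \<open>E0\<close>. Shuffling \<open>E1\<close> with
  \<open>u @ replicate m E1\<close> yields \<open>m + 1\<close> copies of \<open>u @ replicate (m + 1) E1\<close> together with words that
  have only \<open>m\<close> trailing letters \<open>E1\<close>, because in them the new letter sits to the left of the final
  \<open>E0\<close> of \<open>u\<close>. Over the rationals one can divide by \<open>m + 1\<close> and induct on \<open>m\<close>. Stated as an induction
  rule, this gives both the existence and the uniqueness of the regularization.\<close>
lemma h1_generated [consumes 1, case_names h0 E1 add scale shuffle]:
  assumes f: "f \<in> h1"
    and h0: "\<And>f. f \<in> h0 \<Longrightarrow> P f"
    and E1: "P (word_poly [E1])"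
    and add: "\<And>f g. f \<in> h1 \<Longrightarrow> g \<in> h1 \<Longrightarrow> P f \<Longrightarrow> P g \<Longrightarrow> P (f + g)"
    and scale: "\<And>c f. f \<in> h1 \<Longrightarrow> P f \<Longrightarrow> P (scale c f)"
    and shuffle: "\<And>f g. f \<in> h1 \<Longrightarrow> g \<in> h1 \<Longrightarrow> P f \<Longrightarrow> P g \<Longrightarrow> P (shuffle f g)"
  shows "P f"
proof -
  have P0: "P 0" by (rule h0) (simp add: h0_def)
  have P_sum: "P (\<Sum>x\<in>A. g x)" if "\<And>x. x \<in> A \<Longrightarrow> g x \<in> h1 \<and> P (g x)" for A and g :: "word \<Rightarrow> ncpoly"
    using that by (induction A rule: infinite_finite_induct) (auto intro!: add P0 h1_sum)
  have P_sum_mset: "P (\<Sum>x\<in>#A. g x)" if "\<And>x. x \<in># A \<Longrightarrow> g x \<in> h1 \<and> P (g x)"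
    for A and g :: "word \<Rightarrow> ncpoly"
    using that by (induction A) (auto intro!: add P0 h1_sum_mset)
  \<comment> \<open>A shuffle identity in which \<open>w\<close> has a nonzero coefficient is solved for \<open>w\<close>.\<close>
  have step: "P (word_poly w)"
    if sh: "shuffle (word_poly u) (word_poly v) = scale c (word_poly w) + R"
      and uv: "h1_word u" "h1_word v" "P (word_poly u)" "P (word_poly v)" "h1_word w"
      and R: "R \<in> h1" "P R" and c: "c \<noteq> 0" for u v w c R
  proof -
    have "word_poly w = scale (1/c) (shuffle (word_poly u) (word_poly v) + scale (-1) R)"
      using c by (intro poly_mapping_eqI) (simp add: sh lookup_add)
    moreover have "P \<dots>"
      using uv R by (intro scale add shuffle h1_add h1_scale h1_shuffle h1_single)
    ultimately show ?thesis by simp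
  qed
  have P_word: "P (word_poly (u @ replicate m E1))"
    if "u = [] \<or> hd u = E1 \<and> last u = E0" for u m
    using that
  proof (induction m arbitrary: u)
    case 0
    then show ?case by (auto intro!: h0 simp: h0_def)
  next
    case (Suc m)
    have h1u: "h1_word (u @ replicate n E1)" for n
      using Suc.prems by (cases u; cases n) (auto simp: h1_word_def)
    show ?case
    proof (cases "u = []")
      case True
      have "shuffle (word_poly [E1]) (word_poly (replicate m E1)) =
              scale (of_nat (Suc m)) (word_poly (replicate (Suc m) E1)) + 0"
        by (simp only: shuffle_word_poly shuffle_words_letter_replicate sum_replicate_word add_0_right)
      from step[OF this] show ?thesis
        using True E1 Suc.IH[of "[]"] h1u P0 by (simp add: h1_word_def)
    next
      case False
      then obtain u0 where u: "u = u0 @ [E0]"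
        using Suc.prems by (metis append_butlast_last_id)
      have u0: "u0 \<noteq> []" "hd u0 = E1"
        using Suc.prems u by (cases u0; force)+
      \<comment> \<open>the words in which the new letter stands to the left of the final \<open>E0\<close> of \<open>u\<close>\<close>
      define R where "R = (\<Sum>x\<in>#shuffle_words [E1] u0. word_poly (x @ E0 # replicate m E1))"
      have hdx: "x \<noteq> [] \<and> hd x = E1" if "x \<in># shuffle_words [E1] u0" for x
        using hd_shuffle_words[OF that] u0 by auto
      have "R \<in> h1" unfolding R_def
        using hdx by (intro h1_sum_mset h1_single) (auto simp: h1_word_def)
      moreover have "P R" unfolding R_def
      proof (rule P_sum_mset)
        fix x assume x: "x \<in># shuffle_words [E1] u0"
        show "word_poly (x @ E0 # replicate m E1) \<in> h1 \<and> P (word_poly (x @ E0 # replicate m E1))"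
          using Suc.IH[of "x @ [E0]"] hdx[OF x] by (auto simp: h1_word_def intro!: h1_single)
      qed
      moreover have "shuffle (word_poly [E1]) (word_poly (u @ replicate m E1)) =
              scale (of_nat (Suc m)) (word_poly (u @ replicate (Suc m) E1)) + R"
      proof -
        have "image_mset (\<lambda>x. u0 @ E0 # x) (replicate_mset n w) = replicate_mset n (u0 @ E0 # w)" for n w
          by simp
        then show ?thesis
          unfolding u shuffle_word_poly append.assoc append.simps
            shuffle_words_letter_append shuffle_words_letter_replicate R_def
            image_mset_union sum_mset.union
          by (simp only: image_mset.compositionality comp_def add.commute sum_replicate_word)
      qed
      ultimately show ?thesis
        using h1u[of m] h1u[of "Suc m"] Suc.prems Suc.IH[of u] E1
        by - (rule step[where u = "[E1]" and v = "u @ replicate m E1" and c = "of_nat (Suc m)" and R = R],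
           simp_all add: h1_word_def del: of_nat_Suc replicate_Suc)
    qed
  qed
  have P_h1_word: "P (word_poly w)" if "h1_word w" for w
  proof -
    define m where "m = length (takeWhile (\<lambda>x. x = E1) (rev w))"
    define u where "u = rev (dropWhile (\<lambda>x. x = E1) (rev w))"
    have "takeWhile (\<lambda>x. x = E1) (rev w) = replicate m E1"
      unfolding m_def by (metis (full_types) replicate_length_same set_takeWhileD)
    then have w: "w = u @ replicate m E1"
      unfolding u_def by (metis rev_append rev_replicate rev_rev_ident takeWhile_dropWhile_id)
    have "last u = E0" if "u \<noteq> []"
    proof -
      from that have "dropWhile (\<lambda>x. x = E1) (rev w) \<noteq> []" by (simp add: u_def)
      from hd_dropWhile[OF this] have "last u \<noteq> E1" by (simp add: u_def last_rev)
      then show ?thesis by (cases "last u") auto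
    qed
    moreover have "hd u = E1" if "u \<noteq> []"
      using \<open>h1_word w\<close> w that by (auto simp: h1_word_def)
    ultimately show ?thesis
      using P_word[of u m] w by blast
  qed
  have "P (\<Sum>w\<in>Poly_Mapping.keys f. scale (Poly_Mapping.lookup f w) (word_poly w))"
    by (intro P_sum conjI scale h1_scale P_h1_word h1_single) (use f in \<open>auto simp: h1_iff\<close>)
  then show ?thesis
    by (simp flip: ncpoly_expand)
qed


section \<open>Multiple polylogarithms\<close>

text \<open>The effect on Taylor coefficients of integrating against \<open>dt/t\<close> and \<open>dt/(1-t)\<close>. The quotient by 0
  is 0, so the new constant term vanishes.\<close>
fun polylog_step :: "letter \<Rightarrow> (nat \<Rightarrow> real) \<Rightarrow> nat \<Rightarrow> real" where
  "polylog_step E0 c n = c n / real n"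
| "polylog_step E1 c n = (\<Sum>m<n. c m) / real n"

text \<open>The empty word has the constant polylogarithm 1; letters are integrated from left to right.\<close>
definition polylog_coeff :: "word \<Rightarrow> nat \<Rightarrow> real" where
  "polylog_coeff w = foldl (\<lambda>c a. polylog_step a c) (\<lambda>n. of_bool (n = 0)) w"

lemma polylog_coeff_Nil: "polylog_coeff [] n = of_bool (n = 0)"
  by (simp add: polylog_coeff_def)

lemma polylog_coeff_snoc: "polylog_coeff (w @ [a]) n = polylog_step a (polylog_coeff w) n"
  by (simp add: polylog_coeff_def)

lemma polylog_coeff_0: "polylog_coeff w 0 = of_bool (w = [])"
proof (cases w rule: rev_cases)
  case (snoc v a)
  then show ?thesis by (cases a) (simp_all add: polylog_coeff_snoc)
qed (simp add: polylog_coeff_Nil)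

lemma polylog_coeff_bounds: "0 \<le> polylog_coeff w n \<and> polylog_coeff w n \<le> 1"
proof (induction w arbitrary: n rule: rev_induct)
  case (snoc a w)
  show ?case
  proof (cases a)
    case E0
    have "polylog_coeff w n / real n \<le> 1"
      using snoc[of n] by (cases "n = 0") (auto simp: divide_simps)
    then show ?thesis using snoc[of n] by (simp add: E0 polylog_coeff_snoc)
  next
    case E1
    have "(\<Sum>m<n. polylog_coeff w m) \<le> (\<Sum>m<n. 1)"
      by (intro sum_mono) (use snoc in auto)
    moreover have "(\<Sum>m<n. polylog_coeff w m) \<ge> 0"
      by (intro sum_nonneg) (use snoc in auto)
    ultimately show ?thesis
      by (cases "n = 0") (auto simp: E1 polylog_coeff_snoc divide_simps)
  qed
qed (auto simp: polylog_coeff_Nil)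

lemma polylog_coeff_nonneg [simp]: "0 \<le> polylog_coeff w n"
  using polylog_coeff_bounds[of w n] by simp

definition polylog_fps :: "word \<Rightarrow> real fps" where
  "polylog_fps w = Abs_fps (polylog_coeff w)"

text \<open>The operator \<open>X d/dX\<close>. It is preferred to \<open>d/dX\<close> because it turns the form \<open>dX/X\<close> into the factor 1
  and so avoids Laurent series.\<close>
definition euler_deriv :: "real fps \<Rightarrow> real fps" where
  "euler_deriv f = fps_X * fps_deriv f"

text \<open>The series \<open>1\<close> and \<open>X / (1 - X)\<close>.\<close>
definition letter_fps :: "letter \<Rightarrow> real fps" where
  "letter_fps a = (case a of E0 \<Rightarrow> 1 | E1 \<Rightarrow> Abs_fps (\<lambda>n. of_bool (n \<noteq> 0)))"

lemma euler_deriv_nth: "fps_nth (euler_deriv f) n = real n * fps_nth f n"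
  by (cases n) (simp_all add: euler_deriv_def)

lemma euler_deriv_mult: "euler_deriv (f * g) = euler_deriv f * g + f * euler_deriv g"
  by (simp add: euler_deriv_def algebra_simps)

lemma euler_deriv_sum_mset: "euler_deriv (\<Sum>x\<in>#A. f x) = (\<Sum>x\<in>#A. euler_deriv (f x))"
  by (induction A) (simp_all add: euler_deriv_def algebra_simps)

lemma euler_deriv_eqD:
  assumes "euler_deriv f = euler_deriv g" "fps_nth f 0 = fps_nth g 0"
  shows "f = g"
proof (rule fps_ext)
  fix n
  have "real n * fps_nth f n = real n * fps_nth g n"
    using assms(1) by (metis euler_deriv_nth)
  then show "fps_nth f n = fps_nth g n"
    using assms(2) by (cases "n = 0") auto
qed

text \<open>The word must not start with \<open>E0\<close>: the integral of \<open>dt/t\<close> from 0 diverges on the constant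
  series 1, and the coefficients of the one-letter word \<open>E0\<close> are a default value.\<close>
lemma euler_deriv_polylog:
  assumes "h1_word (w @ [a])"
  shows "euler_deriv (polylog_fps (w @ [a])) = polylog_fps w * letter_fps a"
proof (rule fps_ext)
  fix n
  show "fps_nth (euler_deriv (polylog_fps (w @ [a]))) n = fps_nth (polylog_fps w * letter_fps a) n"
  proof (cases a)
    case E0
    with assms have "w \<noteq> []" by (auto simp: h1_word_def)
    then show ?thesis
      by (cases "n = 0") (simp_all add: E0 euler_deriv_nth polylog_fps_def polylog_coeff_snoc
          letter_fps_def polylog_coeff_0)
  next
    case E1
    have "fps_nth (polylog_fps w * letter_fps E1) n = (\<Sum>i=0..n. polylog_coeff w i * of_bool (n - i \<noteq> 0))"
      by (simp only: fps_mult_nth polylog_fps_def letter_fps_def letter.case fps_nth_Abs_fps)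
    also have "\<dots> = (\<Sum>i<n. polylog_coeff w i)"
      by (rule sum.mono_neutral_cong_right) auto
    finally show ?thesis
      by (cases "n = 0") (simp_all add: E1 euler_deriv_nth polylog_fps_def polylog_coeff_snoc)
  qed
qed

lemma polylog_fps_Nil [simp]: "polylog_fps [] = 1"
  by (rule fps_ext) (simp add: polylog_fps_def polylog_coeff_Nil)

lemma shuffle_words_length: "w \<in># shuffle_words u v \<Longrightarrow> length w = length u + length v"
  by (induction u v arbitrary: w rule: shuffle_words.induct) auto

text \<open>Both sides have the same constant term, and by induction the same image under \<open>X d/dX\<close>: on the left
  by the recursion of shuffles at the last letter, on the right by the product rule.\<close>
lemma polylog_fps_shuffle:
  assumes "h1_word u" "h1_word v"
  shows "(\<Sum>w\<in>#shuffle_words u v. polylog_fps w) = polylog_fps u * polylog_fps v"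
  using assms
proof (induction "length u + length v" arbitrary: u v rule: less_induct)
  case less
  show ?case
  proof (cases "u = [] \<or> v = []")
    case True
    then show ?thesis by auto
  next
    case False
    then obtain u' a v' b where uv: "u = u' @ [a]" "v = v' @ [b]"
      by (metis rev_exhaust)
    have h: "h1_word u'" "h1_word v'"
      using less.prems uv by (auto dest: h1_word_butlast)
    have a: "(\<Sum>w\<in>#shuffle_words u' v. polylog_fps w) = polylog_fps u' * polylog_fps v"
      by (rule less.hyps) (use uv h less.prems in auto)
    have b: "(\<Sum>w\<in>#shuffle_words u v'. polylog_fps w) = polylog_fps u * polylog_fps v'"
      by (rule less.hyps) (use uv h less.prems in auto)
    have D: "(\<Sum>w\<in>#M. euler_deriv (polylog_fps (w @ [c]))) = (\<Sum>w\<in>#M. polylog_fps w) * letter_fps c"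
      if "\<And>w. w \<in># M \<Longrightarrow> h1_word (w @ [c])" for M c
      using that by (induction M) (auto simp: euler_deriv_polylog algebra_simps)
    have h1_snoc: "h1_word (w @ [c])"
      if "w \<in># shuffle_words p q" "h1_word p" "h1_word q" "p \<noteq> [] \<or> q \<noteq> [] \<or> c = E1" for w p q c
      using h1_word_shuffle[OF that(1-3)] hd_shuffle_words[OF that(1)] that(4)
      by (auto simp: h1_word_def)
    show ?thesis
    proof (rule euler_deriv_eqD)
      have "euler_deriv (\<Sum>w\<in>#shuffle_words u v. polylog_fps w) =
        (\<Sum>w\<in>#shuffle_words u' v. euler_deriv (polylog_fps (w @ [a]))) +
        (\<Sum>w\<in>#shuffle_words u v'. euler_deriv (polylog_fps (w @ [b])))"
        unfolding euler_deriv_sum_mset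
        by (simp add: uv shuffle_words_snoc image_mset.compositionality comp_def)
      also have "\<dots> = polylog_fps u' * polylog_fps v * letter_fps a + polylog_fps u * polylog_fps v' * letter_fps b"
        using h1_snoc[of _ u' v a] h1_snoc[of _ u v' b] h less.prems False by (simp add: D a b)
      also have "\<dots> = euler_deriv (polylog_fps u * polylog_fps v)"
        using less.prems euler_deriv_polylog[of u' a] euler_deriv_polylog[of v' b]
        by (simp add: euler_deriv_mult uv algebra_simps)
      finally show "euler_deriv (\<Sum>w\<in>#shuffle_words u v. polylog_fps w) =
                    euler_deriv (polylog_fps u * polylog_fps v)" .
    next
      have "fps_nth (\<Sum>w\<in>#M. polylog_fps w) 0 = 0" if "\<And>w. w \<in># M \<Longrightarrow> w \<noteq> []" for M
        using that by (induction M) (auto simp: polylog_fps_def polylog_coeff_0)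
      moreover have "w \<noteq> []" if "w \<in># shuffle_words u v" for w
        using shuffle_words_length[OF that] False by auto
      ultimately show "fps_nth (\<Sum>w\<in>#shuffle_words u v. polylog_fps w) 0 = fps_nth (polylog_fps u * polylog_fps v) 0"
        using False by (simp add: polylog_fps_def polylog_coeff_0)
    qed
  qed
qed

definition polylog :: "word \<Rightarrow> real \<Rightarrow> real" where
  "polylog w z = suminf (\<lambda>n. polylog_coeff w n * z ^ n)"

lemma abs_summable_bounded_coeff:
  fixes c :: "nat \<Rightarrow> real"
  assumes "\<And>n. \<bar>c n\<bar> \<le> B" "0 \<le> z" "z < 1"
  shows "summable (\<lambda>n. \<bar>c n * z ^ n\<bar>)"
proof (rule summable_comparison_test')
  show "summable (\<lambda>n. B * z ^ n)"
    using assms by (intro summable_mult summable_geometric) auto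
  show "norm \<bar>c n * z ^ n\<bar> \<le> B * z ^ n" if "n \<ge> 0" for n
    using assms by (simp add: abs_mult mult_right_mono)
qed

lemma polylog_summable:
  assumes "0 \<le> z" "z < 1"
  shows "summable (\<lambda>n. \<bar>polylog_coeff w n * z ^ n\<bar>)" "summable (\<lambda>n. polylog_coeff w n * z ^ n)"
proof -
  show *: "summable (\<lambda>n. \<bar>polylog_coeff w n * z ^ n\<bar>)"
    by (rule abs_summable_bounded_coeff[where B = 1]) (use polylog_coeff_bounds[of w] assms in auto)
  show "summable (\<lambda>n. polylog_coeff w n * z ^ n)"
    using * by (rule summable_rabs_cancel)
qed

lemma polylog_Nil [simp]: "polylog [] z = 1"
proof -
  have "polylog [] z = suminf (\<lambda>n. if n = 0 then 1 else 0)"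
    unfolding polylog_def by (intro suminf_cong) (simp add: polylog_coeff_Nil)
  also have "\<dots> = 1"
    using sums_single[of 0 "\<lambda>_. 1 :: real"] by (simp add: sums_iff)
  finally show ?thesis .
qed

text \<open>Evaluation of absolutely convergent power series is multiplicative (Cauchy product).\<close>
lemma polylog_shuffle:
  assumes "h1_word u" "h1_word v" and z: "0 \<le> z" "z < 1"
  shows "(\<Sum>w\<in>#shuffle_words u v. polylog w z) = polylog u z * polylog v z"
proof -
  have sum_mset: "(\<lambda>n. (\<Sum>w\<in>#M. polylog_coeff w n) * z ^ n) sums (\<Sum>w\<in>#M. polylog w z)" for M
  proof (induction M)
    case (add w M)
    have "(\<lambda>n. polylog_coeff w n * z ^ n) sums polylog w z"
      unfolding polylog_def using polylog_summable(2)[OF z] by (rule summable_sums)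
    from sums_add[OF this add] show ?case by (simp add: algebra_simps)
  qed auto
  have nth: "(\<Sum>w\<in>#M. polylog_coeff w n) = fps_nth (\<Sum>w\<in>#M. polylog_fps w) n" for M n
    by (induction M) (auto simp: polylog_fps_def)
  have "(\<lambda>n. \<Sum>i\<le>n. (polylog_coeff u i * z ^ i) * (polylog_coeff v (n - i) * z ^ (n - i)))
          sums (polylog u z * polylog v z)"
    unfolding polylog_def using polylog_summable(1)[OF z] by (intro Cauchy_product_sums) auto
  also have "(\<lambda>n. \<Sum>i\<le>n. (polylog_coeff u i * z ^ i) * (polylog_coeff v (n - i) * z ^ (n - i))) =
             (\<lambda>n. (\<Sum>w\<in>#shuffle_words u v. polylog_coeff w n) * z ^ n)"
    unfolding nth polylog_fps_shuffle[OF assms(1,2)] fps_mult_nth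
    by (auto simp: polylog_fps_def sum_distrib_left atLeast0AtMost fun_eq_iff mult_ac
        simp flip: power_add intro!: sum.cong)
  finally show ?thesis
    using sum_mset sums_unique2 by blast
qed


section \<open>Logarithmic expansions at 1\<close>

definition log_pole :: "real \<Rightarrow> real" where
  "log_pole z = - ln (1 - z)"

lemma log_pole_at_top: "filterlim log_pole at_top (at_left 1)"
  unfolding log_pole_def by real_asymp

text \<open>The expansion \<open>f z = poly P (- ln (1 - z)) + error\<close> with an error that beats every power of the
  logarithm. An error that merely tends to 0 would not be stable under multiplication.\<close>
definition log_expansion :: "(real \<Rightarrow> real) \<Rightarrow> real poly \<Rightarrow> bool" where
  "log_expansion f P \<longleftrightarrow>
     (\<forall>n. ((\<lambda>z. (f z - poly P (log_pole z)) * log_pole z ^ n) \<longlongrightarrow> 0) (at_left 1))"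

lemma log_expansion_poly_mult:
  assumes "\<forall>n. ((\<lambda>z. g z * log_pole z ^ n) \<longlongrightarrow> 0) (at_left 1)"
  shows "((\<lambda>z. g z * poly Q (log_pole z) * log_pole z ^ n) \<longlongrightarrow> 0) (at_left 1)"
proof -
  have "((\<lambda>z. \<Sum>i\<le>degree Q. coeff Q i * (g z * log_pole z ^ (i + n))) \<longlongrightarrow> (\<Sum>i\<le>degree Q. coeff Q i * 0)) (at_left 1)"
    by (intro tendsto_sum tendsto_mult tendsto_const) (use assms in auto)
  moreover have "(\<Sum>i\<le>degree Q. coeff Q i * (g z * log_pole z ^ (i + n))) =
      g z * poly Q (log_pole z) * log_pole z ^ n" for z
    by (simp add: poly_altdef sum_distrib_left sum_distrib_right power_add mult_ac)
  ultimately show ?thesis by simp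
qed

lemma log_expansion_mult:
  assumes f: "log_expansion f P" and g: "log_expansion g Q"
  shows "log_expansion (\<lambda>z. f z * g z) (P * Q)"
  unfolding log_expansion_def
proof
  fix n
  let ?l = log_pole
  define F where "F = (\<lambda>z. f z - poly P (?l z))"
  define G where "G = (\<lambda>z. g z - poly Q (?l z))"
  have F: "\<forall>n. ((\<lambda>z. F z * ?l z ^ n) \<longlongrightarrow> 0) (at_left 1)"
   and G: "\<forall>n. ((\<lambda>z. G z * ?l z ^ n) \<longlongrightarrow> 0) (at_left 1)"
    using f g by (simp_all add: log_expansion_def F_def G_def)
  have "((\<lambda>z. F z * ?l z ^ n * (G z * ?l z ^ 0) + F z * poly Q (?l z) * ?l z ^ n +
              G z * poly P (?l z) * ?l z ^ n) \<longlongrightarrow> 0 * 0 + 0 + 0) (at_left 1)"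
    by (intro tendsto_add tendsto_mult log_expansion_poly_mult F G F[rule_format] G[rule_format])
  moreover have "F z * ?l z ^ n * (G z * ?l z ^ 0) + F z * poly Q (?l z) * ?l z ^ n +
              G z * poly P (?l z) * ?l z ^ n = (f z * g z - poly (P * Q) (?l z)) * ?l z ^ n" for z
    by (simp add: F_def G_def algebra_simps)
  ultimately show "((\<lambda>z. (f z * g z - poly (P * Q) (?l z)) * ?l z ^ n) \<longlongrightarrow> 0) (at_left 1)"
    by simp
qed

lemma log_expansion_add:
  assumes f: "log_expansion f P" and g: "log_expansion g Q"
  shows "log_expansion (\<lambda>z. f z + g z) (P + Q)"
  unfolding log_expansion_def
proof
  fix n
  have "((\<lambda>z. (f z - poly P (log_pole z)) * log_pole z ^ n +
              (g z - poly Q (log_pole z)) * log_pole z ^ n) \<longlongrightarrow> 0 + 0) (at_left 1)"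
    by (intro tendsto_add) (use f g in \<open>auto simp: log_expansion_def\<close>)
  then show "((\<lambda>z. (f z + g z - poly (P + Q) (log_pole z)) * log_pole z ^ n) \<longlongrightarrow> 0) (at_left 1)"
    by (simp add: algebra_simps)
qed

lemma log_expansion_const: "log_expansion (\<lambda>_. c) [:c:]"
  by (simp add: log_expansion_def)

lemma log_expansion_cmult: "log_expansion f P \<Longrightarrow> log_expansion (\<lambda>z. c * f z) (smult c P)"
  using log_expansion_mult[OF log_expansion_const, of f P c] by simp

lemma log_expansion_sum:
  "(\<And>x. x \<in> A \<Longrightarrow> log_expansion (f x) (P x)) \<Longrightarrow>
   log_expansion (\<lambda>z. \<Sum>x\<in>A. f x z) (\<Sum>x\<in>A. P x)"
  by (induction A rule: infinite_finite_induct)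
     (use log_expansion_const[of 0] in \<open>auto intro: log_expansion_add\<close>)

lemma at_left_1_eventually:
  "eventually (\<lambda>z::real. 0 \<le> z \<and> z < 1) (at_left 1)"
  using eventually_at_left_real[of 0 "1::real"] by (auto elim: eventually_mono)

lemma log_expansion_cong:
  assumes "log_expansion f P" "\<And>z. 0 \<le> z \<Longrightarrow> z < 1 \<Longrightarrow> f z = g z"
  shows "log_expansion g P"
  unfolding log_expansion_def
proof
  fix n
  have "((\<lambda>z. (f z - poly P (log_pole z)) * log_pole z ^ n) \<longlongrightarrow> 0) (at_left 1)"
    using assms(1) by (simp add: log_expansion_def)
  moreover have "\<forall>\<^sub>F z in at_left 1. (f z - poly P (log_pole z)) * log_pole z ^ n =
                               (g z - poly P (log_pole z)) * log_pole z ^ n"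
    using at_left_1_eventually by eventually_elim (simp add: assms(2))
  ultimately show "((\<lambda>z. (g z - poly P (log_pole z)) * log_pole z ^ n) \<longlongrightarrow> 0) (at_left 1)"
    by (rule Lim_transform_eventually)
qed

lemma poly_tendsto_0_imp_0:
  fixes P :: "real poly"
  assumes lim: "((\<lambda>z. poly P (g z)) \<longlongrightarrow> 0) F" and g: "filterlim g at_top F" and F: "F \<noteq> bot"
  shows "P = 0"
proof (rule ccontr)
  assume "P \<noteq> 0"
  have *: False if lc: "lead_coeff Q > 0" and lim: "((\<lambda>z. poly Q (g z)) \<longlongrightarrow> 0) F" for Q
  proof -
    obtain n where n: "\<And>x. x \<ge> n \<Longrightarrow> poly Q x \<ge> lead_coeff Q"
      using poly_pinfty_gt_lc[OF lc] by blast
    have "eventually (\<lambda>z. g z \<ge> n) F"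
      using g by (simp add: filterlim_at_top)
    then have "eventually (\<lambda>z. lead_coeff Q \<le> poly Q (g z)) F"
      by (rule eventually_mono) (rule n)
    from tendsto_lowerbound[OF lim this F] lc show False by simp
  qed
  show False
  proof (cases "lead_coeff P > 0")
    case True
    then show ?thesis using * lim by blast
  next
    case False
    then have "lead_coeff (- P) > 0"
      using \<open>P \<noteq> 0\<close> by (simp add: not_less order_le_less)
    then show ?thesis using *[of "-P"] tendsto_minus[OF lim] by simp
  qed
qed

text \<open>A polynomial that tends to 0 along an argument tending to infinity is zero.\<close>
lemma log_expansion_close_unique:
  assumes f: "log_expansion f P" and g: "log_expansion g Q"
    and fg: "((\<lambda>z. f z - g z) \<longlongrightarrow> 0) (at_left 1)"
  shows "P = Q"
proof -
  have "((\<lambda>z. f z - poly P (log_pole z)) \<longlongrightarrow> 0) (at_left 1)"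
       "((\<lambda>z. g z - poly Q (log_pole z)) \<longlongrightarrow> 0) (at_left 1)"
    using f[unfolded log_expansion_def, rule_format, of 0] g[unfolded log_expansion_def, rule_format, of 0]
    by simp_all
  from tendsto_diff[OF fg tendsto_diff[OF this]]
  have "((\<lambda>z. poly (P - Q) (log_pole z)) \<longlongrightarrow> 0) (at_left 1)"
    by (simp add: algebra_simps)
  from poly_tendsto_0_imp_0[OF this log_pole_at_top] show ?thesis
    by simp
qed

lemma log_expansion_unique: "log_expansion f P \<Longrightarrow> log_expansion f Q \<Longrightarrow> P = Q"
  by (rule log_expansion_close_unique) auto

text \<open>In terms of \<open>L = - ln (1 - z)\<close> the error bound is \<open>exp (- L / 4)\<close>, which decays faster than any
  power of \<open>L\<close>.\<close>
lemma log_expansion_limit: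
  assumes "\<And>z. 0 \<le> z \<Longrightarrow> z < 1 \<Longrightarrow> \<bar>f z - c\<bar> \<le> B * (1 - z) powr (1/4)"
  shows "log_expansion f [:c:]"
  unfolding log_expansion_def
proof
  fix n
  have "filterlim (\<lambda>z. log_pole z / 4) at_top (at_left 1)"
    unfolding log_pole_def by real_asymp
  from filterlim_compose[OF tendsto_power_div_exp_0[of n] this]
  have "((\<lambda>z. B * 4 ^ n * ((log_pole z / 4) ^ n / exp (log_pole z / 4))) \<longlongrightarrow> B * 4 ^ n * 0) (at_left 1)"
    by (intro tendsto_mult tendsto_const)
  then have lim: "((\<lambda>z. B * 4 ^ n * ((log_pole z / 4) ^ n / exp (log_pole z / 4))) \<longlongrightarrow> 0) (at_left 1)"
    by simp
  show "((\<lambda>z. (f z - poly [:c:] (log_pole z)) * log_pole z ^ n) \<longlongrightarrow> 0) (at_left 1)"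
  proof (rule Lim_null_comparison[OF _ lim])
    show "\<forall>\<^sub>F z in at_left 1. norm ((f z - poly [:c:] (log_pole z)) * log_pole z ^ n) \<le>
            B * 4 ^ n * ((log_pole z / 4) ^ n / exp (log_pole z / 4))"
      using at_left_1_eventually
    proof eventually_elim
      case (elim z)
      have pos: "log_pole z \<ge> 0"
        using elim by (auto simp: log_pole_def)
      have "(1 - z) powr (1/4) = 1 / exp (log_pole z / 4)"
        using elim by (simp add: powr_def log_pole_def exp_minus field_simps flip: exp_diff)
      then have "norm (f z - c) * log_pole z ^ n \<le> B * (1 / exp (log_pole z / 4)) * log_pole z ^ n"
        using assms[of z] elim pos by (intro mult_right_mono) auto
      then show ?case
        using pos by (simp add: abs_mult power_divide)
    qed
  qed
qed

lemma sum_inverse_sqrt_le: "(\<Sum>m\<le>n. 1 / sqrt (real m)) \<le> 2 * sqrt (real n)"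
proof (induction n)
  case (Suc n)
  define a b where "a = sqrt (real n)" and "b = sqrt (real (Suc n))"
  have ab: "b > 0" "a \<le> b" "a \<ge> 0" "b\<^sup>2 = a\<^sup>2 + 1"
    by (auto simp: a_def b_def)
  have "(b - a) * (b + a) = 1"
    using ab by (simp add: power2_eq_square algebra_simps)
  moreover have "(b - a) * (b + a) \<le> (b - a) * (2 * b)"
    using ab by (intro mult_left_mono) auto
  ultimately have "1 / b \<le> 2 * b - 2 * a"
    using ab by (simp add: divide_simps algebra_simps)
  then show ?case
    using Suc by (simp add: a_def b_def)
qed auto

text \<open>Any decay \<open>n powr - s\<close> with \<open>0 < s < 1\<close> survives both integration steps; logarithmic factors are
  absorbed by the choice \<open>s = 1/2\<close>.\<close>
lemma polylog_coeff_le_inverse_sqrt: "\<exists>C\<ge>0. \<forall>n>0. polylog_coeff w n \<le> C / sqrt (real n)"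
proof (induction w rule: rev_induct)
  case Nil
  show ?case by (rule exI[of _ 0]) (auto simp: polylog_coeff_Nil)
next
  case (snoc a w)
  then obtain C where C: "C \<ge> 0" "\<And>n. n > 0 \<Longrightarrow> polylog_coeff w n \<le> C / sqrt (real n)"
    by blast
  show ?case
  proof (cases a)
    case E0
    have "polylog_coeff w n / real n \<le> C / sqrt (real n)" if "n > 0" for n
    proof -
      have "polylog_coeff w n / real n \<le> polylog_coeff w n / 1"
        using that by (intro divide_left_mono) auto
      with C(2)[OF that] show ?thesis by simp
    qed
    with C(1) show ?thesis by (auto simp: E0 polylog_coeff_snoc)
  next
    case E1
    have "(\<Sum>m<n. polylog_coeff w m) / real n \<le> (1 + 2 * C) / sqrt (real n)" if "n > 0" for n
    proof -
      have "polylog_coeff w m \<le> of_bool (m = 0) + C * (1 / sqrt (real m))" for m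
        using C(2)[of m] polylog_coeff_bounds[of w 0] by (cases "m = 0") auto
      then have "(\<Sum>m<n. polylog_coeff w m) \<le> (\<Sum>m<n. of_bool (m = 0) + C * (1 / sqrt (real m)))"
        by (rule sum_mono)
      also have "\<dots> \<le> (\<Sum>m\<le>n. of_bool (m = 0) + C * (1 / sqrt (real m)))"
        using C(1) by (intro sum_mono2) auto
      also have "\<dots> = 1 + C * (\<Sum>m\<le>n. 1 / sqrt (real m))"
        by (simp add: sum.distrib sum_distrib_left)
      also have "\<dots> \<le> 1 + C * (2 * sqrt (real n))"
        using C(1) by (intro add_left_mono mult_left_mono sum_inverse_sqrt_le)
      also have "\<dots> \<le> (1 + 2 * C) * sqrt (real n)"
        using that by (simp add: algebra_simps)
      finally have "(\<Sum>m<n. polylog_coeff w m) / real n \<le> (1 + 2 * C) * sqrt (real n) / real n"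
        by (rule divide_right_mono) simp
      also have "\<dots> = (1 + 2 * C) / sqrt (real n)"
        using that by (simp add: field_simps)
      finally show ?thesis .
    qed
    with C(1) show ?thesis
      by (intro exI[of _ "1 + 2 * C"]) (auto simp: E1 polylog_coeff_snoc)
  qed
qed

text \<open>The last letter \<open>E0\<close> contributes a factor \<open>1/n\<close>, so the coefficients are \<open>O(n powr (-3/2))\<close>. Since
  \<open>1 - z ^ n\<close> is at most \<open>(n * (1 - z)) powr (1/4)\<close>, the difference of the value at 1 and at \<open>z\<close> is
  \<open>O((1 - z) powr (1/4))\<close>.\<close>
lemma log_expansion_convergent_word:
  assumes "last w = E0" "w \<noteq> []"
  shows "summable (polylog_coeff w)" "log_expansion (polylog w) [:suminf (polylog_coeff w):]"
proof -
  obtain v where w: "w = v @ [E0]"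
    using assms by (metis append_butlast_last_id)
  obtain C where C: "C \<ge> 0" "\<And>n. n > 0 \<Longrightarrow> polylog_coeff v n \<le> C / sqrt (real n)"
    using polylog_coeff_le_inverse_sqrt by blast
  have bound: "polylog_coeff w n \<le> C * real n powr (-3/2)" for n
  proof (cases "n = 0")
    case False
    have "polylog_coeff w n \<le> C / sqrt (real n) / real n"
      unfolding w polylog_coeff_snoc polylog_step.simps
      using C(2)[of n] False by (intro divide_right_mono) auto
    also have "\<dots> = C * (real n powr (-(1/2)) * real n powr (-1))"
    proof -
      have "real n powr (-(1/2)) = 1 / sqrt (real n)"
        by (simp only: powr_minus_divide powr_half_sqrt of_nat_0_le_iff)
      moreover have "real n powr (-1) = 1 / real n"
        using False by (simp add: powr_minus_divide)
      ultimately show ?thesis by simp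
    qed
    also have "real n powr (-(1/2)) * real n powr (-1) = real n powr (-3/2)"
      by (simp only: powr_add[symmetric]) simp
    finally show ?thesis .
  qed (simp add: polylog_coeff_0 assms)
  have sums: "summable (\<lambda>n. C * real n powr (-5/4))"
    by (intro summable_mult) (simp add: summable_real_powr_iff)
  have "summable (\<lambda>n. C * real n powr (-3/2))"
    by (intro summable_mult) (simp add: summable_real_powr_iff)
  then show summ: "summable (polylog_coeff w)"
    by (rule summable_comparison_test') (use bound in auto)
  show "log_expansion (polylog w) [:suminf (polylog_coeff w):]"
  proof (rule log_expansion_limit)
    fix z :: real assume z: "0 \<le> z" "z < 1"
    have le: "polylog_coeff w n * (1 - z ^ n) \<le> C * real n powr (-5/4) * (1 - z) powr (1/4)" for n
    proof (cases "n = 0")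
      case False
      have "1 - z ^ n \<le> real n * (1 - z)"
        using Bernoulli_inequality[of "z - 1" n] z by (simp add: algebra_simps)
      moreover have "1 - z ^ n \<le> 1" "0 \<le> 1 - z ^ n"
        using z by (auto intro: power_le_one)
      ultimately have "1 - z ^ n \<le> (real n * (1 - z)) powr (1/4)"
      proof (cases "real n * (1 - z) \<ge> 1")
        case True
        then have "(real n * (1 - z)) powr (1/4) \<ge> 1" by (rule ge_one_powr_ge_zero) simp
        with \<open>1 - z ^ n \<le> 1\<close> show ?thesis by linarith
      next
        case le1: False
        have "(real n * (1 - z)) powr 1 \<le> (real n * (1 - z)) powr (1/4)"
          using le1 z False by (intro powr_mono') auto
        then show ?thesis
          using \<open>1 - z ^ n \<le> real n * (1 - z)\<close> z by simp
      qed
      then have "polylog_coeff w n * (1 - z ^ n) \<le> C * real n powr (-3/2) * (real n * (1 - z)) powr (1/4)"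
        using bound[of n] \<open>0 \<le> 1 - z ^ n\<close> by (intro mult_mono) (auto intro: order_trans[OF polylog_coeff_nonneg])
      also have "\<dots> = C * (real n powr (-3/2) * real n powr (1/4)) * (1 - z) powr (1/4)"
        using z by (simp add: powr_mult)
      also have "real n powr (-3/2) * real n powr (1/4) = real n powr (-5/4)"
        by (simp only: powr_add[symmetric]) simp
      finally show ?thesis .
    qed (simp add: polylog_coeff_0 assms)
    have "(\<lambda>n. polylog_coeff w n - polylog_coeff w n * z ^ n) sums (suminf (polylog_coeff w) - polylog w z)"
      unfolding polylog_def
      by (intro sums_diff summable_sums summ polylog_summable(2) z)
    then have s: "(\<lambda>n. polylog_coeff w n * (1 - z ^ n)) sums (suminf (polylog_coeff w) - polylog w z)"
      by (simp add: algebra_simps)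
    have "suminf (polylog_coeff w) - polylog w z \<ge> 0"
      using s by (rule sums_le[OF _ sums_zero, rotated]) (use z in \<open>auto intro!: mult_nonneg_nonneg power_le_one\<close>)
    moreover have "suminf (polylog_coeff w) - polylog w z \<le>
        suminf (\<lambda>n. C * real n powr (-5/4)) * (1 - z) powr (1/4)"
      by (rule sums_le[OF le s]) (intro sums_mult2 summable_sums sums)
    ultimately show "\<bar>polylog w z - suminf (polylog_coeff w)\<bar> \<le>
        suminf (\<lambda>n. C * real n powr (-5/4)) * (1 - z) powr (1/4)"
      by linarith
  qed
qed

lemma log_expansion_E1: "log_expansion (polylog [E1]) [:0, 1:]"
proof -
  have "polylog [E1] z = log_pole z" if "0 \<le> z" "z < 1" for z
  proof -
    have "polylog_coeff [E1] n = 1 / real n" for n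
      using polylog_coeff_snoc[of "[]" E1 n]
      by (cases "n = 0") (auto simp: polylog_coeff_Nil)
    moreover have "(\<lambda>n. - ((- (- z)) ^ n) / of_nat n) sums ln (1 + (- z))"
      using that by (intro ln_series') auto
    from sums_minus[OF this] have "(\<lambda>n. z ^ n / real n) sums log_pole z"
      by (simp add: log_pole_def)
    ultimately show ?thesis
      unfolding polylog_def by (simp add: sums_iff)
  qed
  moreover have "log_expansion log_pole [:0, 1:]"
    by (simp add: log_expansion_def)
  ultimately show ?thesis
    by - (rule log_expansion_cong[of log_pole], simp_all)
qed


section \<open>Truncated multiple zeta values\<close>

text \<open>The multiple zeta value truncated to \<open>m_r \<le> N\<close>. It is a partial sum of Taylor coefficients, which
  relates it to polylogarithms by Abel summation.\<close>
definition trunc_mzv :: "nat list \<Rightarrow> nat \<Rightarrow> real" where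
  "trunc_mzv ks N = (\<Sum>n\<le>N. polylog_coeff (word_of_index ks) n)"

lemma word_of_index_Nil [simp]: "word_of_index [] = []"
  by (simp add: word_of_index_def)

lemma word_of_index_snoc: "word_of_index (ks @ [q]) = word_of_index ks @ E1 # replicate (q - 1) E0"
  by (simp add: word_of_index_def)

lemma word_of_index_Cons: "word_of_index (q # ks) = E1 # replicate (q - 1) E0 @ word_of_index ks"
  by (simp add: word_of_index_def)

lemma h1_word_word_of_index [simp]: "h1_word (word_of_index ks)"
  by (cases ks) (auto simp: word_of_index_Cons h1_word_def)

lemma polylog_coeff_append_E0:
  "polylog_coeff (w @ replicate j E0) n = polylog_coeff w n / real n ^ j"
proof (induction j)
  case (Suc j)
  have "w @ replicate (Suc j) E0 = (w @ replicate j E0) @ [E0]"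
    by (simp add: replicate_append_same)
  then show ?case
    by (simp only: polylog_coeff_snoc polylog_step.simps Suc) simp
qed simp

lemma polylog_coeff_index_snoc:
  assumes "q \<ge> 1"
  shows "polylog_coeff (word_of_index (ks @ [q])) n =
         (\<Sum>m<n. polylog_coeff (word_of_index ks) m) / real n ^ q"
proof -
  have "polylog_coeff (word_of_index (ks @ [q])) n =
        polylog_coeff ((word_of_index ks @ [E1]) @ replicate (q - 1) E0) n"
    by (simp add: word_of_index_snoc)
  also have "\<dots> = (\<Sum>m<n. polylog_coeff (word_of_index ks) m) / (real n * real n ^ (q - 1))"
    by (simp only: polylog_coeff_append_E0 polylog_coeff_snoc polylog_step.simps divide_divide_eq_left)
  finally show ?thesis
    using assms by (simp flip: power_Suc)
qed

lemma trunc_mzv_Nil [simp]: "trunc_mzv [] N = 1"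
  by (simp add: trunc_mzv_def polylog_coeff_Nil)

lemma trunc_mzv_snoc_0 [simp]: "trunc_mzv (ks @ [q]) 0 = 0"
  by (simp add: trunc_mzv_def polylog_coeff_0 word_of_index_snoc)

lemma trunc_mzv_Suc:
  assumes "q \<ge> 1"
  shows "trunc_mzv (ks @ [q]) (Suc N) = trunc_mzv (ks @ [q]) N + trunc_mzv ks N / real (Suc N) ^ q"
proof -
  have "trunc_mzv (ks @ [q]) (Suc N) =
        trunc_mzv (ks @ [q]) N + polylog_coeff (word_of_index (ks @ [q])) (Suc N)"
    by (simp add: trunc_mzv_def)
  then show ?thesis
    unfolding polylog_coeff_index_snoc[OF assms] by (simp add: trunc_mzv_def lessThan_Suc_atMost)
qed

lemma trunc_mzv_nonneg [simp]: "trunc_mzv ks N \<ge> 0"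
  by (simp add: trunc_mzv_def sum_nonneg)

definition index_tuples :: "nat list \<Rightarrow> nat \<Rightarrow> nat list set" where
  "index_tuples ks N = {m. length m = length ks \<and> sorted_wrt (<) m \<and> (\<forall>x\<in>set m. 0 < x \<and> x \<le> N)}"

definition mzv_term :: "nat list \<Rightarrow> nat list \<Rightarrow> real" where
  "mzv_term ks m = (\<Prod>i<length ks. 1 / real (m ! i) ^ (ks ! i))"

lemma finite_index_tuples: "finite (index_tuples ks N)"
  by (rule finite_subset[OF _ finite_lists_length_eq[of "{..N}" "length ks"]])
     (auto simp: index_tuples_def)

lemma index_tuples_Suc:
  "index_tuples (ks @ [q]) (Suc N) = index_tuples (ks @ [q]) N \<union> (\<lambda>m. m @ [Suc N]) ` index_tuples ks N"
proof (intro equalityI subsetI)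
  fix m assume m: "m \<in> index_tuples (ks @ [q]) (Suc N)"
  then obtain l x where lx: "m = l @ [x]"
    by (cases m rule: rev_cases) (auto simp: index_tuples_def)
  show "m \<in> index_tuples (ks @ [q]) N \<union> (\<lambda>m. m @ [Suc N]) ` index_tuples ks N"
  proof (cases "x = Suc N")
    case True
    have "l \<in> index_tuples ks N"
      using m by (auto simp: lx True index_tuples_def sorted_wrt_append less_Suc_eq_le)
    then show ?thesis by (simp add: lx True)
  next
    case False
    then have "m \<in> index_tuples (ks @ [q]) N"
      using m by (fastforce simp: lx index_tuples_def sorted_wrt_append)
    then show ?thesis by simp
  qed
qed (fastforce simp: index_tuples_def sorted_wrt_append)

lemma mzv_term_snoc:
  "length m = length ks \<Longrightarrow> mzv_term (ks @ [q]) (m @ [x]) = mzv_term ks m / real x ^ q"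
  by (simp add: mzv_term_def nth_append)

lemma trunc_mzv_eq_sum:
  assumes "is_index ks"
  shows "trunc_mzv ks N = (\<Sum>m\<in>index_tuples ks N. mzv_term ks m)"
  using assms
proof (induction ks arbitrary: N rule: rev_induct)
  case Nil
  have "index_tuples [] N = {[]}"
    by (auto simp: index_tuples_def)
  then show ?case by (simp add: mzv_term_def)
next
  case (snoc q ks)
  then have q: "q \<ge> 1" and ks: "is_index ks"
    by (auto simp: is_index_def)
  show ?case
  proof (induction N)
    case 0
    have "index_tuples (ks @ [q]) 0 = {}"
      by (force simp: index_tuples_def length_Suc_conv_rev)
    then show ?case by simp
  next
    case (Suc N)
    have "(\<Sum>m\<in>(\<lambda>m. m @ [Suc N]) ` index_tuples ks N. mzv_term (ks @ [q]) m) =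
          (\<Sum>m\<in>index_tuples ks N. mzv_term (ks @ [q]) (m @ [Suc N]))"
      by (subst sum.reindex) (auto simp: inj_on_def)
    also have "\<dots> = (\<Sum>m\<in>index_tuples ks N. mzv_term ks m / real (Suc N) ^ q)"
      by (intro sum.cong refl mzv_term_snoc) (auto simp: index_tuples_def)
    also have "\<dots> = trunc_mzv ks N / real (Suc N) ^ q"
      by (simp add: snoc.IH[OF ks] sum_divide_distrib)
    moreover have "index_tuples (ks @ [q]) N \<inter> (\<lambda>m. m @ [Suc N]) ` index_tuples ks N = {}"
      by (auto simp: index_tuples_def)
    ultimately show ?case
      unfolding index_tuples_Suc trunc_mzv_Suc[OF q] Suc
      by (subst sum.union_disjoint) (simp_all add: finite_index_tuples)
  qed
qed

text \<open>Every finite subset of \<open>A\<close> lies in some \<open>B n\<close>, so by nonnegativity all finite sums are at most \<open>L\<close>,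
  and those over supersets of \<open>B n\<close> are at least the sum over \<open>B n\<close>.\<close>
lemma has_sum_exhaustion:
  fixes f :: "'a \<Rightarrow> real"
  assumes fin: "\<And>n. finite (B n)" and mono: "incseq B" and A: "(\<Union>n. B n) = A"
    and nonneg: "\<And>x. x \<in> A \<Longrightarrow> f x \<ge> 0" and lim: "(\<lambda>n. sum f (B n)) \<longlonglongrightarrow> L"
  shows "(f has_sum L) A"
proof -
  have inc: "incseq (\<lambda>n. sum f (B n))"
  proof (intro monoI sum_mono2 fin)
    fix i j :: nat and x
    assume "i \<le> j"
    show "B i \<subseteq> B j" using incseqD[OF mono \<open>i \<le> j\<close>] .
    assume "x \<in> B j - B i"
    then show "0 \<le> f x" using A by (intro nonneg) auto
  qed
  then have le: "sum f (B n) \<le> L" for n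
    using lim by (rule incseq_le)
  have bound: "sum f Y \<le> L" if "finite Y" "Y \<subseteq> A" for Y
  proof -
    have "\<exists>M. Y \<subseteq> B M"
      using that
    proof (induction Y rule: finite_induct)
      case (insert y Y)
      then obtain M where "Y \<subseteq> B M" by auto
      moreover obtain M' where "y \<in> B M'" using insert A by auto
      ultimately have "insert y Y \<subseteq> B (max M M')"
        using incseqD[OF mono, of M "max M M'"] incseqD[OF mono, of M' "max M M'"] by auto
      then show ?case ..
    qed auto
    then obtain M where "Y \<subseteq> B M" ..
    then have "sum f Y \<le> sum f (B M)"
      by (intro sum_mono2 fin) (use \<open>Y \<subseteq> B M\<close> A nonneg in blast)+
    with le[of M] show ?thesis by linarith
  qed
  show ?thesis
    unfolding has_sum_def
  proof (rule tendstoI)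
    fix e :: real assume "e > 0"
    with lim obtain n where n: "dist (sum f (B n)) L < e"
      unfolding lim_sequentially by blast
    show "\<forall>\<^sub>F Y in finite_subsets_at_top A. dist (sum f Y) L < e"
      unfolding eventually_finite_subsets_at_top
    proof (intro exI[of _ "B n"] conjI allI impI)
      fix Y assume Y: "finite Y \<and> B n \<subseteq> Y \<and> Y \<subseteq> A"
      then have "sum f (B n) \<le> sum f Y"
        using nonneg by (intro sum_mono2) auto
      with bound[of Y] Y n show "dist (sum f Y) L < e"
        by (auto simp: dist_real_def)
    qed (use fin A in auto)
  qed
qed

lemma mzv_eq_limit:
  assumes "is_index ks" and lim: "trunc_mzv ks \<longlonglongrightarrow> L"
  shows "mzv ks = L"
proof -
  let ?A = "{m :: nat list. length m = length ks \<and> sorted_wrt (<) m \<and> (\<forall>x\<in>set m. 0 < x)}"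
  have "(\<Union>N. index_tuples ks N) = ?A"
  proof (intro equalityI subsetI)
    fix m assume "m \<in> ?A"
    then have "m \<in> index_tuples ks (Max (insert 0 (set m)))"
      by (auto simp: index_tuples_def)
    then show "m \<in> (\<Union>N. index_tuples ks N)" by blast
  qed (auto simp: index_tuples_def)
  moreover have "incseq (index_tuples ks)"
    by (auto simp: incseq_def index_tuples_def)
  ultimately have "(mzv_term ks has_sum L) ?A"
    using lim by (intro has_sum_exhaustion[where B = "index_tuples ks"])
      (auto simp: finite_index_tuples mzv_term_def prod_nonneg trunc_mzv_eq_sum[OF assms(1), abs_def])
  then show ?thesis
    unfolding mzv_def mzv_term_def by (rule infsumI)
qed

lemma trunc_mzv_tendsto:
  assumes "is_index ks" "ks = [] \<or> last ks > 1"
  shows "trunc_mzv ks \<longlonglongrightarrow> mzv ks"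
    and "suminf (polylog_coeff (word_of_index ks)) = mzv ks"
proof -
  have "summable (polylog_coeff (word_of_index ks))"
  proof (cases ks rule: rev_cases)
    case Nil
    then show ?thesis
      by (simp add: polylog_coeff_Nil[abs_def] of_bool_def summable_If_finite)
  next
    case (snoc l q)
    then have "last (word_of_index ks) = E0" "word_of_index ks \<noteq> []"
      using assms by (auto simp: word_of_index_snoc)
    then show ?thesis by (rule log_expansion_convergent_word)
  qed
  then have lim: "trunc_mzv ks \<longlonglongrightarrow> suminf (polylog_coeff (word_of_index ks))"
    unfolding trunc_mzv_def[abs_def] by (rule summable_LIMSEQ')
  from mzv_eq_limit[OF assms(1) lim] lim
  show "trunc_mzv ks \<longlonglongrightarrow> mzv ks" "suminf (polylog_coeff (word_of_index ks)) = mzv ks"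
    by simp_all
qed


section \<open>Existence of the shuffle regularization\<close>

text \<open>A letter \<open>E1\<close> opens a new entry 1, and a letter \<open>E0\<close> increases the last entry.\<close>
lemma word_of_index_surj:
  assumes "h1_word w"
  shows "\<exists>ks. is_index ks \<and> word_of_index ks = w"
  using assms
proof (induction w rule: rev_induct)
  case Nil
  show ?case by (rule exI[of _ "[]"]) (simp add: is_index_def)
next
  case (snoc a w)
  then obtain ks where ks: "is_index ks" "word_of_index ks = w"
    using h1_word_butlast by blast
  show ?case
  proof (cases a)
    case E1
    then show ?thesis
      using ks by (intro exI[of _ "ks @ [1]"]) (auto simp: is_index_def word_of_index_snoc)
  next
    case E0
    with snoc.prems have "w \<noteq> []" by (auto simp: h1_word_def)
    then obtain l q where l: "ks = l @ [q]"
      using ks by (cases ks rule: rev_cases) auto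
    then have "q \<ge> 1" using ks by (auto simp: is_index_def)
    then have "word_of_index (l @ [Suc q]) = w @ [a]"
      using ks(2) by (cases q) (auto simp: l E0 word_of_index_snoc replicate_append_same)
    then show ?thesis
      using ks(1) by (intro exI[of _ "l @ [Suc q]"]) (auto simp: is_index_def l)
  qed
qed

lemma inj_word_of_index: "inj_on word_of_index {ks. is_index ks}"
proof -
  have "ks = ls" if "is_index ks" "is_index ls" "word_of_index ks = word_of_index ls" for ks ls
    using that
  proof (induction ks arbitrary: ls)
    case Nil
    then show ?case by (cases ls) (auto simp: word_of_index_Cons)
  next
    case (Cons q ks)
    then obtain p ls' where ls: "ls = p # ls'"
      by (cases ls) (auto simp: word_of_index_Cons)
    have tw: "takeWhile (\<lambda>x. x = E0) (replicate j E0 @ word_of_index l) = replicate j E0" for j l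
      by (cases l) (simp_all add: word_of_index_Cons takeWhile_append)
    have eq: "replicate (q - 1) E0 @ word_of_index ks = replicate (p - 1) E0 @ word_of_index ls'"
      using Cons.prems(3) by (simp add: ls word_of_index_Cons)
    then have "replicate (q - 1) E0 = replicate (p - 1) E0"
      by (metis tw)
    then have "q - 1 = p - 1" by (metis length_replicate)
    moreover have "p \<ge> 1" "q \<ge> 1" using Cons.prems by (auto simp: ls is_index_def)
    ultimately have "p = q" by simp
    with eq have "word_of_index ks = word_of_index ls'" by simp
    with Cons show ?case by (auto simp: ls \<open>p = q\<close> is_index_def)
  qed
  then show ?thesis by (auto simp: inj_on_def)
qed

lemma log_expansion_admissible:
  assumes "w = [] \<or> hd w = E1 \<and> last w = E0"
  shows "log_expansion (polylog w) [:mzv (the_inv_into {k. is_index k} word_of_index w):]"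
proof -
  have "h1_word w" using assms by (auto simp: h1_word_def)
  then obtain ks where ks: "is_index ks" "word_of_index ks = w"
    using word_of_index_surj by blast
  then have inv: "the_inv_into {k. is_index k} word_of_index w = ks"
    using the_inv_into_f_f[OF inj_word_of_index, of ks] by simp
  show ?thesis
  proof (cases "w = []")
    case True
    then have "ks = []" using ks by (cases ks) (auto simp: word_of_index_Cons)
    moreover have "mzv [] = 1"
      by (rule mzv_eq_limit) (auto simp: is_index_def trunc_mzv_Nil[abs_def])
    moreover have "polylog [] = (\<lambda>_. 1)" by (auto simp: fun_eq_iff)
    ultimately show ?thesis
      unfolding inv using log_expansion_const[of 1] True by simp
  next
    case False
    then have w: "last w = E0" using assms by auto
    have "ks = [] \<or> last ks > 1"
    proof (cases ks rule: rev_cases)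
      case (snoc l q)
      then have "q - 1 \<noteq> 0" using ks w by (auto simp: word_of_index_snoc split: if_splits)
      then show ?thesis by (simp add: snoc)
    qed auto
    from trunc_mzv_tendsto(2)[OF ks(1) this] log_expansion_convergent_word(2)[OF w False]
    show ?thesis unfolding inv by (simp add: ks)
  qed
qed

definition polylog_ncpoly :: "ncpoly \<Rightarrow> real \<Rightarrow> real" where
  "polylog_ncpoly f z = linear_ext (\<lambda>w. polylog w z) f"

lemma log_expansion_h0:
  assumes "f \<in> h0"
  shows "log_expansion (polylog_ncpoly f) [:Z f:]"
proof -
  let ?i = "the_inv_into {k. is_index k} word_of_index"
  have "log_expansion (\<lambda>z. \<Sum>w\<in>Poly_Mapping.keys f. of_rat (Poly_Mapping.lookup f w) * polylog w z)
          (\<Sum>w\<in>Poly_Mapping.keys f. smult (of_rat (Poly_Mapping.lookup f w)) [:mzv (?i w):])"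
    using assms by (intro log_expansion_sum log_expansion_cmult log_expansion_admissible)
      (auto simp: h0_def)
  moreover have "(\<Sum>w\<in>A. smult (c w) [:d w:]) = [:\<Sum>w\<in>A. c w * d w:]" for A and c d :: "word \<Rightarrow> real"
    by (induction A rule: infinite_finite_induct) auto
  ultimately show ?thesis
    by (simp add: polylog_ncpoly_def[abs_def] linear_ext_def Z_def)
qed

lemma polylog_ncpoly_shuffle:
  assumes "f \<in> h1" "g \<in> h1" "0 \<le> z" "z < 1"
  shows "polylog_ncpoly (shuffle f g) z = polylog_ncpoly f z * polylog_ncpoly g z"
  unfolding polylog_ncpoly_def
  by (intro linear_ext_shuffle assms polylog_shuffle)

lemma log_expansion_polylog_add:
  "log_expansion (polylog_ncpoly f) P \<Longrightarrow> log_expansion (polylog_ncpoly g) Q \<Longrightarrow>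
   log_expansion (polylog_ncpoly (f + g)) (P + Q)"
  using log_expansion_add[of "polylog_ncpoly f" P "polylog_ncpoly g" Q]
  by (simp add: polylog_ncpoly_def[abs_def] linear_ext_add)

lemma log_expansion_polylog_scale:
  "log_expansion (polylog_ncpoly f) P \<Longrightarrow>
   log_expansion (polylog_ncpoly (scale c f)) (smult (of_rat c) P)"
  using log_expansion_cmult[of "polylog_ncpoly f" P "of_rat c"]
  by (simp add: polylog_ncpoly_def[abs_def] linear_ext_scale)

lemma log_expansion_polylog_shuffle:
  assumes "f \<in> h1" "g \<in> h1" "log_expansion (polylog_ncpoly f) P" "log_expansion (polylog_ncpoly g) Q"
  shows "log_expansion (polylog_ncpoly (shuffle f g)) (P * Q)"
  by (rule log_expansion_cong[OF log_expansion_mult[OF assms(3,4)]])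
     (simp add: polylog_ncpoly_shuffle assms)

lemma polylog_ncpoly_word: "polylog_ncpoly (word_poly w) = polylog w"
  by (simp add: polylog_ncpoly_def[abs_def] linear_ext_single)

lemma ex_log_expansion:
  assumes "f \<in> h1"
  shows "\<exists>P. log_expansion (polylog_ncpoly f) P"
  using assms
proof (induction rule: h1_generated)
  case (h0 f)
  then show ?case by (blast intro: log_expansion_h0)
next
  case E1
  show ?case unfolding polylog_ncpoly_word by (rule exI, rule log_expansion_E1)
qed (blast intro: log_expansion_polylog_add log_expansion_polylog_scale log_expansion_polylog_shuffle)+

definition reg :: "ncpoly \<Rightarrow> real poly" where
  "reg = restrict (\<lambda>f. THE P. log_expansion (polylog_ncpoly f) P) h1"

lemma log_expansion_reg:
  assumes "f \<in> h1"
  shows "log_expansion (polylog_ncpoly f) (reg f)"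
proof -
  obtain P where P: "log_expansion (polylog_ncpoly f) P"
    using ex_log_expansion[OF assms] ..
  then have "(THE P. log_expansion (polylog_ncpoly f) P) = P"
    by (rule the_equality) (rule log_expansion_unique[OF _ P])
  then show ?thesis using P assms by (simp add: reg_def)
qed

lemma reg_eqI: "f \<in> h1 \<Longrightarrow> log_expansion (polylog_ncpoly f) P \<Longrightarrow> reg f = P"
  by (rule log_expansion_unique[OF log_expansion_reg])

lemma reg_h0: "f \<in> h0 \<Longrightarrow> reg f = [:Z f:]"
  using h0_subset_h1 by (intro reg_eqI log_expansion_h0) auto

lemma reg_E1: "reg (word_poly [E1]) = [:0, 1:]"
  by (rule reg_eqI) (simp_all add: h1_single h1_word_def polylog_ncpoly_word log_expansion_E1)

lemma shuffle_hom_reg: "shuffle_hom reg"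
proof -
  have "reg (word_poly []) = 1"
    using log_expansion_const[of 1]
    by (intro reg_eqI h1_single) (simp_all add: polylog_ncpoly_word polylog_Nil[abs_def] one_pCons)
  then show ?thesis
    unfolding shuffle_hom_def
    by (auto intro!: reg_eqI h1_add h1_scale h1_shuffle log_expansion_reg
        log_expansion_polylog_add log_expansion_polylog_scale log_expansion_polylog_shuffle)
qed

text \<open>The polynomial of a logarithmic expansion has all the properties that characterize \<^const>\<open>Z_sh\<close>,
  and by \<open>h1_generated\<close> two maps with these properties agree on \<^const>\<open>h1\<close>.\<close>
lemma Z_sh_eq_reg: "Z_sh = reg"
  unfolding Z_sh_def
proof (rule the_equality)
  show "reg \<in> extensional h1 \<and> shuffle_hom reg \<and> (\<forall>f\<in>h0. reg f = [:Z f:]) \<and>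
        reg (word_poly [E1]) = [:0, 1:]"
    using shuffle_hom_reg reg_h0 reg_E1 by (simp add: reg_def)
next
  fix \<phi>
  assume \<phi>: "\<phi> \<in> extensional h1 \<and> shuffle_hom \<phi> \<and> (\<forall>f\<in>h0. \<phi> f = [:Z f:]) \<and>
        \<phi> (word_poly [E1]) = [:0, 1:]"
  have "\<phi> f = reg f" if "f \<in> h1" for f
    using that
  proof (induction rule: h1_generated)
    case (h0 f)
    then show ?case using \<phi> reg_h0 by simp
  next
    case E1
    show ?case using \<phi> reg_E1 by simp
  qed (use \<phi> shuffle_hom_reg in \<open>simp_all add: shuffle_hom_def\<close>)
  then show "\<phi> = reg"
    using \<phi> by (intro extensionalityI[of \<phi> h1]) (auto simp: reg_def)
qed

lemma log_expansion_Z_sh: "f \<in> h1 \<Longrightarrow> log_expansion (polylog_ncpoly f) (Z_sh f)"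
  by (simp add: Z_sh_eq_reg log_expansion_reg)

lemma shuffle_hom_Z_sh: "shuffle_hom Z_sh"
  by (simp add: Z_sh_eq_reg shuffle_hom_reg)

lemma Z_sh_add: "f \<in> h1 \<Longrightarrow> g \<in> h1 \<Longrightarrow> Z_sh (f + g) = Z_sh f + Z_sh g"
  using shuffle_hom_Z_sh by (simp add: shuffle_hom_def)

lemma Z_sh_shuffle: "f \<in> h1 \<Longrightarrow> g \<in> h1 \<Longrightarrow> Z_sh (shuffle f g) = Z_sh f * Z_sh g"
  using shuffle_hom_Z_sh by (simp add: shuffle_hom_def)

lemma Z_sh_scale: "f \<in> h1 \<Longrightarrow> Z_sh (scale c f) = smult (of_rat c) (Z_sh f)"
  using shuffle_hom_Z_sh by (simp add: shuffle_hom_def)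

lemma Z_sh_Nil: "Z_sh (word_poly []) = 1"
  using shuffle_hom_Z_sh by (simp add: shuffle_hom_def)


section \<open>Symmetric sums of multiple zeta values\<close>

text \<open>By \<open>trunc_mzv_eq_sum\<close> this is the sum of \<open>\<Prod>b\<in>B. 1 / m b ^ k b\<close> over all injections \<open>m\<close> of \<open>B\<close>
  into \<open>{1..N}\<close>: an ordering of \<open>B\<close> records the order of the values.\<close>
definition sym_trunc :: "('a \<Rightarrow> nat) \<Rightarrow> 'a set \<Rightarrow> nat \<Rightarrow> real" where
  "sym_trunc k B N = (\<Sum>l\<in>permutations_of_set B. trunc_mzv (map k l) N)"

definition sym_mzv :: "('a \<Rightarrow> nat) \<Rightarrow> 'a set \<Rightarrow> real poly" where
  "sym_mzv k B = (\<Sum>l\<in>permutations_of_set B. Z_sh (word_poly (word_of_index (map k l))))"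

definition sym_polylog :: "('a \<Rightarrow> nat) \<Rightarrow> 'a set \<Rightarrow> real \<Rightarrow> real" where
  "sym_polylog k B z = (\<Sum>l\<in>permutations_of_set B. polylog (word_of_index (map k l)) z)"

lemma sum_permutations_snoc:
  assumes "finite B" "B \<noteq> {}"
  shows "(\<Sum>l\<in>permutations_of_set B. g l) = (\<Sum>b\<in>B. \<Sum>l\<in>permutations_of_set (B - {b}). g (l @ [b]))"
proof -
  have "(\<Sum>b\<in>B. \<Sum>l\<in>permutations_of_set (B - {b}). g (l @ [b])) =
        (\<Sum>(b, l)\<in>Sigma B (\<lambda>b. permutations_of_set (B - {b})). g (l @ [b]))"
    using assms by (intro sum.Sigma) auto
  also have "\<dots> = (\<Sum>l\<in>permutations_of_set B. g l)"
  proof (rule sum.reindex_bij_witness[where j = "\<lambda>(b, l). l @ [b]" and i = "\<lambda>l. (last l, butlast l)"])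
    fix l assume l: "l \<in> permutations_of_set B"
    then have "l \<noteq> []" using assms by (auto dest: permutations_of_setD)
    then obtain l' b where l': "l = l' @ [b]" by (cases l rule: rev_cases) auto
    then have "b \<in> B" "set l' = B - {b}" "distinct l'"
      using permutations_of_setD[OF l] by auto
    with l' show "(\<lambda>(b, l). l @ [b]) (last l, butlast l) = l"
      "(last l, butlast l) \<in> Sigma B (\<lambda>b. permutations_of_set (B - {b}))"
      by (simp_all add: permutations_of_setI)
  next
    fix x assume "x \<in> Sigma B (\<lambda>b. permutations_of_set (B - {b}))"
    then obtain b l where x: "x = (b, l)" "b \<in> B" and l: "set l = B - {b}" "distinct l"
      by (auto dest: permutations_of_setD)
    have "set (l @ [b]) = B"
      unfolding set_append l using x by auto
    moreover have "distinct (l @ [b])"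
      unfolding distinct_append l using l(2) by simp
    ultimately show "(\<lambda>(b, l). l @ [b]) x \<in> permutations_of_set B"
      by (simp only: x prod.case permutations_of_setI)
    show "(last ((\<lambda>(b, l). l @ [b]) x), butlast ((\<lambda>(b, l). l @ [b]) x)) = x"
      by (simp add: x)
    show "g ((\<lambda>(b, l). l @ [b]) x) = (case x of (b, l) \<Rightarrow> g (l @ [b]))"
      by (simp add: x)
  qed
  finally show ?thesis ..
qed

lemma sym_trunc_empty [simp]: "sym_trunc k {} N = 1"
  by (simp add: sym_trunc_def)

lemma sym_trunc_0:
  assumes "finite B"
  shows "sym_trunc k B 0 = of_bool (B = {})"
proof (cases "B = {}")
  case False
  have "sym_trunc k B 0 =
        (\<Sum>b\<in>B. \<Sum>l\<in>permutations_of_set (B - {b}). trunc_mzv (map k (l @ [b])) 0)"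
    unfolding sym_trunc_def by (rule sum_permutations_snoc[OF assms False])
  also have "\<dots> = 0"
    by (intro sum.neutral ballI) (simp only: map_append list.map trunc_mzv_snoc_0)
  finally show ?thesis using False by simp
qed simp

text \<open>Either no value equals \<open>N + 1\<close>, or exactly one position \<open>b\<close> takes it.\<close>
lemma sym_trunc_Suc:
  assumes "finite B" "\<And>b. b \<in> B \<Longrightarrow> k b \<ge> 1"
  shows "sym_trunc k B (Suc N) = sym_trunc k B N + (\<Sum>b\<in>B. sym_trunc k (B - {b}) N * (1 / real (Suc N) ^ k b))"
proof (cases "B = {}")
  case False
  have "sym_trunc k B (Suc N) = (\<Sum>b\<in>B. \<Sum>l\<in>permutations_of_set (B - {b}).
          trunc_mzv (map k (l @ [b])) N + trunc_mzv (map k l) N * (1 / real (Suc N) ^ k b))"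
    unfolding sym_trunc_def sum_permutations_snoc[OF assms(1) False]
    by (intro sum.cong refl) (simp only: map_append list.map trunc_mzv_Suc[OF assms(2)] mult_1_right times_divide_eq_right)
  also have "\<dots> = sym_trunc k B N + (\<Sum>b\<in>B. sym_trunc k (B - {b}) N * (1 / real (Suc N) ^ k b))"
    unfolding sym_trunc_def sum.distrib sum_distrib_right sum_permutations_snoc[OF assms(1) False] ..
  finally show ?thesis .
qed simp

lemma sym_trunc_cong:
  assumes "\<And>b. b \<in> B \<Longrightarrow> k b = k' b"
  shows "sym_trunc k B N = sym_trunc k' B N"
  unfolding sym_trunc_def
proof (intro sum.cong refl)
  fix l assume "l \<in> permutations_of_set B"
  then have "map k l = map k' l"
    using assms by (auto dest: permutations_of_setD)
  then show "trunc_mzv (map k l) N = trunc_mzv (map k' l) N" by (simp only:)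
qed

text \<open>Choose the value at \<open>b\<close> freely and subtract the choices that coincide with the value at some \<open>c\<close>; in
  the latter case the exponents at \<open>b\<close> and \<open>c\<close> add up. The proof is by induction on \<open>N\<close>, which avoids
  explicit injections: expanding both sides with \<open>sym_trunc_Suc\<close> and using the hypothesis for all
  subsets \<open>A - {c}\<close>, the two double sums over \<open>c \<noteq> d\<close> agree after exchanging \<open>c\<close> and \<open>d\<close>.\<close>
lemma sym_trunc_insert:
  assumes "finite A" "b \<notin> A" "\<And>c. c \<in> insert b A \<Longrightarrow> k c \<ge> 1"
  shows "sym_trunc k (insert b A) N =
         trunc_mzv [k b] N * sym_trunc k A N - (\<Sum>c\<in>A. sym_trunc (k(c := k c + k b)) A N)"
  using assms
proof (induction N arbitrary: A)
  case 0
  have "trunc_mzv [k b] 0 = 0"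
    using trunc_mzv_snoc_0[of "[]"] by simp
  with 0 show ?case by (simp add: sym_trunc_0)
next
  case (Suc N)
  note fin = Suc.prems(1) and b = Suc.prems(2)
  define y where "y = (\<lambda>j. 1 / real (Suc N) ^ j)"
  define p where "p = trunc_mzv [k b] N"
  define K where "K = (\<lambda>c. k(c := k c + k b))"
  define D where "D = (\<lambda>A. sym_trunc k A N)"
  define E where "E = (\<lambda>c A. sym_trunc (K c) A N)"
  have y_add: "y (i + j) = y i * y j" for i j
    by (simp add: y_def power_add)
  have Suc_D: "sym_trunc k B (Suc N) = D B + (\<Sum>c\<in>B. D (B - {c}) * y (k c))"
    if "B \<subseteq> insert b A" for B
    unfolding D_def y_def
    by (rule sym_trunc_Suc) (use Suc.prems that in \<open>auto intro: finite_subset\<close>)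
  have Suc_E: "sym_trunc (K c) A (Suc N) =
      E c A + D (A - {c}) * y (k c) * y (k b) + (\<Sum>d\<in>A - {c}. E c (A - {d}) * y (k d))"
    if c: "c \<in> A" for c
  proof -
    have "sym_trunc (K c) A (Suc N) = E c A + (\<Sum>d\<in>A. E c (A - {d}) * y (K c d))"
      unfolding E_def y_def
      by (rule sym_trunc_Suc) (use Suc.prems in \<open>auto simp: K_def intro: add_increasing2\<close>)
    also have "(\<Sum>d\<in>A. E c (A - {d}) * y (K c d)) =
        E c (A - {c}) * y (K c c) + (\<Sum>d\<in>A - {c}. E c (A - {d}) * y (K c d))"
      using fin c by (rule sum.remove)
    also have "E c (A - {c}) = D (A - {c})"
      unfolding E_def D_def by (rule sym_trunc_cong) (auto simp: K_def)
    also have "(\<Sum>d\<in>A - {c}. E c (A - {d}) * y (K c d)) = (\<Sum>d\<in>A - {c}. E c (A - {d}) * y (k d))"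
      by (rule sum.cong) (auto simp: K_def)
    finally show ?thesis
      by (simp only: K_def fun_upd_same y_add mult.assoc)
  qed
  have IH: "D (insert b B) = p * D B - (\<Sum>c\<in>B. E c B)" if "B \<subseteq> A" for B
    unfolding D_def E_def K_def p_def
    by (rule Suc.IH) (use that Suc.prems in \<open>auto intro: finite_subset\<close>)
  have p_Suc: "trunc_mzv [k b] (Suc N) = p + y (k b)"
    using trunc_mzv_Suc[of "k b" "[]" N] Suc.prems(3)[of b] by (simp add: p_def y_def)
  have "(\<Sum>c\<in>insert b A. D (insert b A - {c}) * y (k c)) =
        D A * y (k b) + (\<Sum>c\<in>A. D (insert b (A - {c})) * y (k c))"
    using fin b by (auto simp: insert_Diff_if intro!: sum.cong)
  also have "(\<Sum>c\<in>A. D (insert b (A - {c})) * y (k c)) =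
        (\<Sum>c\<in>A. p * D (A - {c}) * y (k c)) - (\<Sum>c\<in>A. \<Sum>d\<in>A - {c}. E d (A - {c}) * y (k c))"
    by (simp add: IH algebra_simps sum_subtractf sum_distrib_left)
  also have "(\<Sum>c\<in>A. \<Sum>d\<in>A - {c}. E d (A - {c}) * y (k c)) =
        (\<Sum>d\<in>A. \<Sum>c\<in>A - {d}. E d (A - {c}) * y (k c))"
    using sum.swap_restrict[of A A "\<lambda>c d. E d (A - {c}) * y (k c)" "\<lambda>c d. c \<noteq> d"] fin
    by (simp add: set_diff_eq eq_commute conj_commute)
  finally have lhs: "(\<Sum>c\<in>insert b A. D (insert b A - {c}) * y (k c)) =
      D A * y (k b) + ((\<Sum>c\<in>A. p * D (A - {c}) * y (k c)) -
        (\<Sum>d\<in>A. \<Sum>c\<in>A - {d}. E d (A - {c}) * y (k c)))" .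
  have rhs: "(\<Sum>c\<in>A. sym_trunc (k(c := k c + k b)) A (Suc N)) =
      (\<Sum>c\<in>A. E c A) + (\<Sum>c\<in>A. D (A - {c}) * y (k c)) * y (k b) +
        (\<Sum>d\<in>A. \<Sum>c\<in>A - {d}. E d (A - {c}) * y (k c))"
    unfolding sum_distrib_right sum.distrib[symmetric]
    by (intro sum.cong refl) (simp only: Suc_E[unfolded K_def])
  show ?case
    unfolding Suc_D[OF order_refl] Suc_D[OF subset_insertI] p_Suc IH[OF order_refl] lhs rhs
    by (simp add: algebra_simps sum_distrib_left sum.distrib)
qed

text \<open>Multiplication by the geometric series turns coefficients into partial sums.\<close>
lemma trunc_mzv_sums:
  assumes "0 \<le> z" "z < 1"
  shows "(\<lambda>N. trunc_mzv ks N * z ^ N) sums (polylog (word_of_index ks) z / (1 - z))"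
proof -
  have "summable (\<lambda>n. norm (z ^ n))"
    using assms by (simp add: summable_geometric)
  from Cauchy_product_sums[OF polylog_summable(1)[OF assms, of "word_of_index ks", folded real_norm_def] this]
  have "(\<lambda>N. \<Sum>i\<le>N. polylog_coeff (word_of_index ks) i * z ^ i * z ^ (N - i)) sums
          (polylog (word_of_index ks) z * (1 / (1 - z)))"
    using assms by (simp add: polylog_def suminf_geometric)
  moreover have "(\<Sum>i\<le>N. polylog_coeff (word_of_index ks) i * z ^ i * z ^ (N - i)) = trunc_mzv ks N * z ^ N" for N
    unfolding trunc_mzv_def sum_distrib_right
    by (intro sum.cong refl) (simp add: mult.assoc flip: power_add)
  ultimately show ?thesis by simp
qed

lemma sym_trunc_sums:
  assumes "0 \<le> z" "z < 1"
  shows "(\<lambda>N. sym_trunc k B N * z ^ N) sums (sym_polylog k B z / (1 - z))"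
  unfolding sym_trunc_def sym_polylog_def sum_distrib_right sum_divide_distrib
  by (intro sums_sum trunc_mzv_sums assms)

text \<open>The function \<open>g\<close> is the Abel mean \<open>(1 - z) * (\<Sum>N. e N * z ^ N)\<close> of the null sequence \<open>e\<close>. Finitely many
  terms are killed by the factor \<open>1 - z\<close>, and the others form an average of small numbers.\<close>
lemma abelian_mean_tendsto_0:
  fixes e :: "nat \<Rightarrow> real"
  assumes e: "e \<longlonglongrightarrow> 0"
    and sums: "\<And>z. 0 \<le> z \<Longrightarrow> z < 1 \<Longrightarrow> (\<lambda>N. e N * z ^ N) sums (g z / (1 - z))"
  shows "(g \<longlongrightarrow> 0) (at_left 1)"
proof (rule tendstoI)
  fix r :: real assume r: "r > 0"
  obtain M where M: "\<And>N. N \<ge> M \<Longrightarrow> \<bar>e N\<bar> < r / 2"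
    using LIMSEQ_D[OF e, of "r/2"] r by auto
  define B where "B = (\<Sum>N<M. \<bar>e N\<bar>)"
  have bound: "\<bar>g z\<bar> \<le> (1 - z) * B + r / 2" if z: "0 \<le> z" "z < 1" for z
  proof -
    have le: "\<bar>e N * z ^ N\<bar> \<le> (if N < M then \<bar>e N\<bar> else 0) + r / 2 * z ^ N" for N
    proof -
      have z1: "0 \<le> z ^ N" "z ^ N \<le> 1" using z by (auto intro: power_le_one)
      have abs: "\<bar>e N * z ^ N\<bar> = \<bar>e N\<bar> * z ^ N"
        using z1 by (simp add: abs_mult)
      show ?thesis
      proof (cases "N < M")
        case True
        have "\<bar>e N\<bar> * z ^ N \<le> \<bar>e N\<bar> * 1" using z1 by (intro mult_left_mono) auto
        moreover have "0 \<le> r / 2 * z ^ N" using z1 r by simp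
        ultimately show ?thesis using True abs by simp
      next
        case False
        then have "\<bar>e N\<bar> * z ^ N \<le> r / 2 * z ^ N"
          using z1 M[of N] by (intro mult_right_mono) auto
        then show ?thesis using False abs by simp
      qed
    qed
    have "(\<lambda>N. (if N < M then \<bar>e N\<bar> else 0) + r / 2 * z ^ N) sums (B + r / 2 * (1 / (1 - z)))"
      unfolding B_def using sums_If_finite_set[of "{..<M}" "\<lambda>N. \<bar>e N\<bar>"] z
      by (intro sums_add sums_mult geometric_sums) auto
    note s = this
    have "summable (\<lambda>N. \<bar>e N * z ^ N\<bar>)"
      by (rule summable_comparison_test'[OF sums_summable[OF s]]) (use le in auto)
    then have "\<bar>g z / (1 - z)\<bar> \<le> suminf (\<lambda>N. \<bar>e N * z ^ N\<bar>)"
      using summable_rabs[of "\<lambda>N. e N * z ^ N"] sums[OF z] by (simp add: sums_iff)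
    also have "\<dots> \<le> B + r / 2 * (1 / (1 - z))"
      using suminf_le[OF le \<open>summable _\<close> sums_summable[OF s]] sums_unique[OF s] by simp
    finally have "\<bar>g z / (1 - z)\<bar> * (1 - z) \<le> (B + r / 2 * (1 / (1 - z))) * (1 - z)"
      using z by (intro mult_right_mono) auto
    moreover have "\<bar>g z / (1 - z)\<bar> * (1 - z) = \<bar>g z\<bar>"
      using z by (simp add: abs_divide)
    moreover have "(B + r / 2 * (1 / (1 - z))) * (1 - z) = (1 - z) * B + r / 2"
    proof -
      have "(1 / (1 - z)) * (1 - z) = 1" using z by simp
      then show ?thesis by (simp only: distrib_right mult.assoc) simp
    qed
    ultimately show ?thesis by simp
  qed
  have "((\<lambda>z. (1 - z) * B) \<longlongrightarrow> (1 - 1) * B) (at_left (1::real))"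
    by (intro tendsto_intros)
  then have "\<forall>\<^sub>F z in at_left 1. dist ((1 - z) * B) 0 < r / 2"
    using r by (intro tendstoD) auto
  then show "\<forall>\<^sub>F z in at_left 1. dist (g z) 0 < r"
    using at_left_1_eventually
  proof eventually_elim
    case (elim z)
    then show ?case using bound[of z] by auto
  qed
qed

text \<open>Divided by \<open>N + 1\<close>, the partial sums are coefficients of the word extended by \<open>E1\<close>.\<close>
lemma trunc_mzv_le_sqrt: "\<exists>C\<ge>0. \<forall>N. trunc_mzv ks N \<le> C * sqrt (real (Suc N))"
proof -
  obtain C where C: "C \<ge> 0" "\<And>n. n > 0 \<Longrightarrow> polylog_coeff (word_of_index ks @ [E1]) n \<le> C / sqrt (real n)"
    using polylog_coeff_le_inverse_sqrt by blast
  have "trunc_mzv ks N \<le> C * sqrt (real (Suc N))" for N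
  proof -
    have "trunc_mzv ks N / real (Suc N) \<le> C / sqrt (real (Suc N))"
      using C(2)[of "Suc N"]
      by (simp add: polylog_coeff_snoc trunc_mzv_def lessThan_Suc_atMost del: of_nat_Suc)
    then have "trunc_mzv ks N \<le> C / sqrt (real (Suc N)) * real (Suc N)"
      by (simp add: divide_simps del: of_nat_Suc)
    also have "\<dots> = C * sqrt (real (Suc N))"
      by (simp add: field_simps del: of_nat_Suc flip: power2_eq_square)
    finally show ?thesis .
  qed
  with C(1) show ?thesis by blast
qed

lemma sym_trunc_le_sqrt: "\<exists>C\<ge>0. \<forall>N. sym_trunc k B N \<le> C * sqrt (real (Suc N))"
proof -
  obtain C where C: "\<And>ks. C ks \<ge> 0" "\<And>ks N. trunc_mzv ks N \<le> C ks * sqrt (real (Suc N))"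
    using trunc_mzv_le_sqrt by metis
  show ?thesis
    unfolding sym_trunc_def
    by (intro exI[of _ "\<Sum>l\<in>permutations_of_set B. C (map k l)"] conjI allI sum_nonneg C)
       (auto simp: sum_distrib_right intro!: sum_mono C simp del: of_nat_Suc)
qed

text \<open>The sequence of partial sums increases, whereas partial sums plus \<open>1/N\<close> decrease.\<close>
lemma zeta_tail:
  assumes q: "q \<ge> 2" and "N \<ge> 1"
  shows "\<bar>trunc_mzv [q] N - mzv [q]\<bar> \<le> 1 / real N"
proof -
  have lim: "trunc_mzv [q] \<longlonglongrightarrow> mzv [q]"
    by (rule trunc_mzv_tendsto) (use q in \<open>auto simp: is_index_def\<close>)
  have step: "trunc_mzv [q] (Suc M) = trunc_mzv [q] M + 1 / real (Suc M) ^ q" for M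
    using trunc_mzv_Suc[of q "[]" M] q by simp
  have "incseq (trunc_mzv [q])"
    by (rule incseq_SucI) (simp add: step)
  then have 1: "trunc_mzv [q] N \<le> mzv [q]"
    using lim by (rule incseq_le)
  \<comment> \<open>This decreases because \<open>1 / (M + 1)\<^sup>2 \<le> 1 / M - 1 / (M + 1)\<close>; the index is shifted to avoid \<open>M = 0\<close>.\<close>
  define X where "X = (\<lambda>M. trunc_mzv [q] (Suc M) + 1 / real (Suc M))"
  have "decseq X"
  proof (rule decseq_SucI)
    fix M
    have "real (Suc (Suc M)) ^ q \<ge> real (Suc (Suc M)) ^ 2"
      using q by (intro power_increasing) auto
    then have "1 / real (Suc (Suc M)) ^ q \<le> 1 / real (Suc (Suc M)) ^ 2"
      by (intro divide_left_mono) auto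
    also have "\<dots> \<le> 1 / (real (Suc M) * real (Suc (Suc M)))"
      unfolding power2_eq_square by (intro divide_left_mono mult_right_mono) auto
    also have "\<dots> = 1 / real (Suc M) - 1 / real (Suc (Suc M))"
      using diff_frac_eq[of "real (Suc M)" "real (Suc (Suc M))" 1 1] by simp
    finally show "X (Suc M) \<le> X M"
      by (simp add: X_def step)
  qed
  moreover have "X \<longlonglongrightarrow> mzv [q] + 0"
    unfolding X_def
    by (intro tendsto_add LIMSEQ_Suc[OF lim] LIMSEQ_Suc[OF lim_1_over_n])
  ultimately have "mzv [q] \<le> X (N - 1)"
    using decseq_ge by fastforce
  with 1 \<open>N \<ge> 1\<close> show ?thesis by (simp add: X_def)
qed

lemma log_expansion_sym_mzv: "log_expansion (sym_polylog k B) (sym_mzv k B)"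
proof -
  have "log_expansion (\<lambda>z. \<Sum>l\<in>permutations_of_set B. polylog_ncpoly (word_poly (word_of_index (map k l))) z) (sym_mzv k B)"
    unfolding sym_mzv_def
    by (intro log_expansion_sum log_expansion_Z_sh h1_single h1_word_word_of_index)
  then show ?thesis
    by (simp add: polylog_ncpoly_word sym_polylog_def[abs_def])
qed

text \<open>The Abel mean of \<open>sym_trunc_insert\<close>. Replacing the truncated \<open>\<zeta>(k b)\<close> by its limit costs an error of
  order \<open>1/N\<close> times a factor of order \<open>sqrt N\<close>, hence a null sequence. For \<open>k b = 1\<close> there is no limit,
  and the analogous formula with \<open>T\<close> in place of \<open>\<zeta>(k b)\<close> is false.\<close>
lemma sym_mzv_insert:
  fixes k :: "'a \<Rightarrow> nat"
  assumes A: "finite A" "b \<notin> A" and k: "\<And>c. c \<in> insert b A \<Longrightarrow> k c \<ge> 1" and kb: "k b \<ge> 2"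
  shows "sym_mzv k (insert b A) =
         smult (mzv [k b]) (sym_mzv k A) - (\<Sum>c\<in>A. sym_mzv (k(c := k c + k b)) A)"
proof -
  let ?K = "\<lambda>c. k(c := k c + k b)"
  define e where "e = (\<lambda>N. (trunc_mzv [k b] N - mzv [k b]) * sym_trunc k A N)"
  define f where "f = (\<lambda>z. mzv [k b] * sym_polylog k A z + (-1) * (\<Sum>c\<in>A. sym_polylog (?K c) A z))"
  have f: "log_expansion f (smult (mzv [k b]) (sym_mzv k A) + smult (-1) (\<Sum>c\<in>A. sym_mzv (?K c) A))"
    unfolding f_def
    by (intro log_expansion_add log_expansion_cmult log_expansion_sum log_expansion_sym_mzv)
  have e: "e \<longlonglongrightarrow> 0"
  proof -
    obtain C where C: "C \<ge> 0" "\<And>N. sym_trunc k A N \<le> C * sqrt (real (Suc N))"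
      using sym_trunc_le_sqrt by blast
    have "(\<lambda>N. C * (1 / real N * sqrt (real (Suc N)))) \<longlonglongrightarrow> C * 0"
      by (intro tendsto_mult tendsto_const) real_asymp
    then have lim: "(\<lambda>N. C * (1 / real N * sqrt (real (Suc N)))) \<longlonglongrightarrow> 0"
      by simp
    show ?thesis
    proof (rule Lim_null_comparison[OF _ lim])
      show "\<forall>\<^sub>F N in sequentially. norm (e N) \<le> C * (1 / real N * sqrt (real (Suc N)))"
        using eventually_ge_at_top[of 1]
      proof eventually_elim
        case (elim N)
        have "sym_trunc k A N \<ge> 0" by (simp add: sym_trunc_def sum_nonneg)
        then have "norm (e N) \<le> (1 / real N) * (C * sqrt (real (Suc N)))"
          unfolding e_def real_norm_def abs_mult
          using zeta_tail[OF kb elim] C by (intro mult_mono) auto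
        then show ?case by (simp add: mult_ac)
      qed
    qed
  qed
  have "((\<lambda>z. sym_polylog k (insert b A) z - f z) \<longlongrightarrow> 0) (at_left 1)"
  proof (rule abelian_mean_tendsto_0[OF e])
    fix z :: real assume z: "0 \<le> z" "z < 1"
    have "(\<lambda>N. sym_trunc k (insert b A) N * z ^ N - (mzv [k b] * (sym_trunc k A N * z ^ N) +
             (-1) * (\<Sum>c\<in>A. sym_trunc (?K c) A N * z ^ N))) sums
          (sym_polylog k (insert b A) z / (1 - z) - (mzv [k b] * (sym_polylog k A z / (1 - z)) +
             (-1) * (\<Sum>c\<in>A. sym_polylog (?K c) A z / (1 - z))))"
      by (intro sums_diff sums_add sums_mult sums_sum sym_trunc_sums z)
    also have "(\<lambda>N. sym_trunc k (insert b A) N * z ^ N - (mzv [k b] * (sym_trunc k A N * z ^ N) +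
             (-1) * (\<Sum>c\<in>A. sym_trunc (?K c) A N * z ^ N))) = (\<lambda>N. e N * z ^ N)"
    proof
      fix N
      have "sym_trunc k (insert b A) N =
          trunc_mzv [k b] N * sym_trunc k A N - (\<Sum>c\<in>A. sym_trunc (?K c) A N)"
        by (rule sym_trunc_insert[OF A k])
      then show "sym_trunc k (insert b A) N * z ^ N - (mzv [k b] * (sym_trunc k A N * z ^ N) +
             (-1) * (\<Sum>c\<in>A. sym_trunc (?K c) A N * z ^ N)) = e N * z ^ N"
        unfolding e_def sum_distrib_right[symmetric] by (simp only:) (simp only: algebra_simps)
    qed
    also have "sym_polylog k (insert b A) z / (1 - z) - (mzv [k b] * (sym_polylog k A z / (1 - z)) +
             (-1) * (\<Sum>c\<in>A. sym_polylog (?K c) A z / (1 - z))) =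
          (sym_polylog k (insert b A) z - f z) / (1 - z)"
    proof -
      have "x / d - (m * (p / d) + (-1) * (s / d)) = (x - (m * p + (-1) * s)) / d" for x d m p s :: real
        by (simp add: diff_divide_distrib add_divide_distrib)
      then show ?thesis unfolding f_def sum_divide_distrib[symmetric] .
    qed
    finally show "(\<lambda>N. e N * z ^ N) sums ((sym_polylog k (insert b A) z - f z) / (1 - z))" .
  qed
  from log_expansion_close_unique[OF log_expansion_sym_mzv f this] show ?thesis
    by simp
qed

text \<open>The \<open>n\<close>-fold shuffle power of \<open>E1\<close> is \<open>n!\<close> times the word \<open>E1 ... E1\<close>.\<close>
lemma Z_sh_E1_power: "of_nat (fact n) * Z_sh (word_poly (replicate n E1)) = [:0, 1:] ^ n"
proof (induction n)
  case 0
  show ?case by (simp add: Z_sh_Nil)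
next
  case (Suc n)
  have h1: "word_poly (replicate m E1) \<in> h1" for m
    by (intro h1_single) (cases m; simp add: h1_word_def)
  have E1: "word_poly [E1] \<in> h1" "Z_sh (word_poly [E1]) = [:0, 1:]"
    by (simp_all add: h1_single h1_word_def Z_sh_eq_reg reg_E1)
  have "shuffle (word_poly [E1]) (word_poly (replicate n E1)) =
        scale (of_nat (Suc n)) (word_poly (replicate (Suc n) E1))"
    by (simp only: shuffle_word_poly shuffle_words_letter_replicate sum_replicate_word)
  then have "[:0, 1:] * Z_sh (word_poly (replicate n E1)) =
             smult (of_nat (Suc n)) (Z_sh (word_poly (replicate (Suc n) E1)))"
    using Z_sh_shuffle[OF E1(1) h1[of n]] Z_sh_scale[OF h1[of "Suc n"], of "of_nat (Suc n)"]
    by (simp only: E1 of_rat_of_nat_eq)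
  then have eq: "of_nat (Suc n) * Z_sh (word_poly (replicate (Suc n) E1)) =
                 [:0, 1:] * Z_sh (word_poly (replicate n E1))"
    by (simp add: of_nat_poly del: of_nat_Suc)
  have "of_nat (fact (Suc n)) * Z_sh (word_poly (replicate (Suc n) E1)) =
        of_nat (fact n) * (of_nat (Suc n) * Z_sh (word_poly (replicate (Suc n) E1)))"
    by (simp only: fact_Suc of_nat_mult of_nat_id mult_ac)
  also have "\<dots> = [:0, 1:] * (of_nat (fact n) * Z_sh (word_poly (replicate n E1)))"
    unfolding eq by (simp only: mult_ac)
  finally show ?case
    unfolding Suc power_Suc .
qed

lemma sym_mzv_all_1:
  assumes "finite A" "\<And>c. c \<in> A \<Longrightarrow> k c = 1"
  shows "sym_mzv k A = [:0, 1:] ^ card A"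
proof -
  have "word_of_index (map k l) = replicate (card A) E1" if "l \<in> permutations_of_set A" for l
  proof -
    have "map k l = replicate (card A) 1"
      using permutations_of_setD[OF that] assms(2)
      by (intro replicate_eqI) (auto simp: distinct_card[symmetric])
    moreover have "word_of_index (replicate n 1) = replicate n E1" for n
      by (induction n) (simp_all add: word_of_index_Cons)
    ultimately show ?thesis by simp
  qed
  then have "sym_mzv k A = of_nat (card (permutations_of_set A)) * Z_sh (word_poly (replicate (card A) E1))"
    by (simp add: sym_mzv_def)
  then show ?thesis
    using assms(1) by (simp only: card_permutations_of_set Z_sh_E1_power)
qed


section \<open>Sums over set partitions\<close>

definition partition_sum :: "('a set \<Rightarrow> 'b::comm_ring_1) \<Rightarrow> 'a set \<Rightarrow> 'b" where
  "partition_sum f A = (\<Sum>Q | partition_on A Q. \<Prod>P\<in>Q. f P)"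

lemma partition_sum_empty [simp]: "partition_sum f {} = 1"
  by (simp add: partition_sum_def partition_on_empty)

lemma partition_sum_cong:
  assumes "\<And>P. P \<subseteq> A \<Longrightarrow> f P = g P"
  shows "partition_sum f A = partition_sum g A"
  unfolding partition_sum_def
  by (intro sum.cong prod.cong refl assms) (auto dest: partition_onD1)

text \<open>Split a partition into the block of \<open>b\<close>, which is \<open>insert b C\<close>, and a partition of the rest.\<close>
lemma partition_sum_insert:
  assumes A: "finite A" and b: "b \<notin> A"
  shows "partition_sum f (insert b A) = (\<Sum>C\<in>Pow A. f (insert b C) * partition_sum f (A - C))"
proof -
  let ?S = "Sigma (Pow A) (\<lambda>C. {Q. partition_on (A - C) Q})"
  have "(\<Sum>C\<in>Pow A. f (insert b C) * partition_sum f (A - C)) =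
        (\<Sum>(C, Q)\<in>?S. f (insert b C) * (\<Prod>P\<in>Q. f P))"
    unfolding partition_sum_def sum_distrib_left
    using A by (intro sum.Sigma) (auto intro!: finitely_many_partition_on)
  also have "\<dots> = partition_sum f (insert b A)"
    unfolding partition_sum_def
  proof (rule sum.reindex_bij_witness[where
        i = "\<lambda>Q. (\<Union>{P\<in>Q. b \<in> P} - {b}, {P\<in>Q. b \<notin> P})" and
        j = "\<lambda>(C, Q). insert (insert b C) Q"])
    fix x assume x: "x \<in> ?S"
    then obtain C Q where xCQ: "x = (C, Q)" and C: "C \<subseteq> A" and Q: "partition_on (A - C) Q"
      by auto
    have bQ: "b \<notin> P" if "P \<in> Q" for P
      using partition_onD1[OF Q] that b by auto
    have "{P \<in> insert (insert b C) Q. b \<in> P} = {insert b C}" "{P \<in> insert (insert b C) Q. b \<notin> P} = Q"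
      using bQ by auto
    then show "(\<Union>{P\<in>(case x of (C, Q) \<Rightarrow> insert (insert b C) Q). b \<in> P} - {b},
           {P\<in>(case x of (C, Q) \<Rightarrow> insert (insert b C) Q). b \<notin> P}) = x"
      using b C by (auto simp: xCQ)
    have "disjnt (insert b C) (\<Union>Q)"
      using partition_onD1[OF Q] bQ C by (auto simp: disjnt_def)
    moreover have "insert b A - insert b C = A - C"
      using b by auto
    ultimately have "partition_on (insert b A) (insert (insert b C) Q)"
      using Q C by (subst partition_on_insert) auto
    then show "(case x of (C, Q) \<Rightarrow> insert (insert b C) Q) \<in> {Q. partition_on (insert b A) Q}"
      by (simp add: xCQ)
    have "finite Q" using Q A by (meson finite_Diff finite_elements)
    moreover have "insert b C \<notin> Q" using bQ by auto
    ultimately show "(\<Prod>P\<in>(case x of (C, Q) \<Rightarrow> insert (insert b C) Q). f P) =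
          (case x of (C, Q) \<Rightarrow> f (insert b C) * (\<Prod>P\<in>Q. f P))"
      by (simp add: xCQ)
  next
    fix Q assume "Q \<in> {Q. partition_on (insert b A) Q}"
    then have Q: "partition_on (insert b A) Q" by simp
    obtain P0 where P0: "P0 \<in> Q" "b \<in> P0"
      using partition_onD1[OF Q] by blast
    have uniq: "P = P0" if "P \<in> Q" "b \<in> P" for P
      using disjointD[OF partition_onD2[OF Q] that(1) P0(1)] P0(2) that(2) by blast
    have eq: "{P\<in>Q. b \<in> P} = {P0}" "{P\<in>Q. b \<notin> P} = Q - {P0}"
      using P0 uniq by blast+
    have sub: "P0 \<subseteq> insert b A" using P0 partition_onD1[OF Q] by auto
    show "(case (\<Union>{P\<in>Q. b \<in> P} - {b}, {P\<in>Q. b \<notin> P}) of (C, Q) \<Rightarrow> insert (insert b C) Q) = Q"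
      unfolding eq using P0 by (auto simp: insert_absorb)
    have "partition_on (A - (P0 - {b})) (Q - {P0})"
    proof (rule partition_onI)
      have "\<Union>(Q - {P0}) = \<Union>Q - P0"
        using uniq disjointD[OF partition_onD2[OF Q] _ P0(1)] by blast
      also have "\<dots> = A - (P0 - {b})"
        using partition_onD1[OF Q] P0 b by auto
      finally show "\<Union>(Q - {P0}) = A - (P0 - {b})" .
      show "{} \<notin> Q - {P0}" using partition_onD3[OF Q] by auto
      show "disjnt p p'" if "p \<in> Q - {P0}" "p' \<in> Q - {P0}" "p \<noteq> p'" for p p'
        using disjointD[OF partition_onD2[OF Q], of p p'] that by (simp add: disjnt_def)
    qed
    then show "(\<Union>{P\<in>Q. b \<in> P} - {b}, {P\<in>Q. b \<notin> P}) \<in> ?S"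
      unfolding eq using sub by auto
  qed
  finally show ?thesis ..
qed

text \<open>Colouring the blocks of a partition of \<open>A\<close> with two colours amounts to choosing a subset \<open>B\<close> with
  one partition of \<open>B\<close> and one of \<open>A - B\<close>.\<close>
lemma partition_sum_convolution:
  assumes A: "finite A"
  shows "(\<Sum>B\<in>Pow A. partition_sum f B * partition_sum g (A - B)) = partition_sum (\<lambda>P. f P + g P) A"
proof -
  let ?S = "Sigma (Pow A) (\<lambda>B. {Q. partition_on B Q} \<times> {Q. partition_on (A - B) Q})"
  let ?T = "Sigma {Q. partition_on A Q} Pow"
  have fin: "finite {Q. partition_on B Q}" if "B \<subseteq> A" for B
    using A that by (intro finitely_many_partition_on) (auto intro: finite_subset)
  have "(\<Sum>B\<in>Pow A. partition_sum f B * partition_sum g (A - B)) =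
        (\<Sum>(B, Q1, Q2)\<in>?S. (\<Prod>P\<in>Q1. f P) * (\<Prod>P\<in>Q2. g P))"
    unfolding partition_sum_def sum_product sum.cartesian_product
    using A fin by (subst sum.Sigma) (auto simp: split_def)
  also have "\<dots> = (\<Sum>(Q, R)\<in>?T. (\<Prod>P\<in>R. f P) * (\<Prod>P\<in>Q - R. g P))"
  proof (rule sum.reindex_bij_witness[where
        i = "\<lambda>(Q, R). (\<Union>R, R, Q - R)" and j = "\<lambda>(B, Q1, Q2). (Q1 \<union> Q2, Q1)"])
    fix x assume "x \<in> ?S"
    then obtain B Q1 Q2 where x: "x = (B, Q1, Q2)" and B: "B \<subseteq> A"
      and Q1: "partition_on B Q1" and Q2: "partition_on (A - B) Q2" by auto
    have disj: "Q1 \<inter> Q2 = {}"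
    proof (rule ccontr)
      assume "Q1 \<inter> Q2 \<noteq> {}"
      then obtain P where P: "P \<in> Q1" "P \<in> Q2" by blast
      then have "P \<subseteq> B" "P \<subseteq> A - B"
        using partition_onD1[OF Q1] partition_onD1[OF Q2] by auto
      then have "P = {}" by blast
      then show False using partition_onD3[OF Q1] P by simp
    qed
    show "(\<lambda>(Q, R). (\<Union>R, R, Q - R)) ((\<lambda>(B, Q1, Q2). (Q1 \<union> Q2, Q1)) x) = x"
      using partition_onD1[OF Q1] disj by (auto simp: x)
    have "partition_on A (Q1 \<union> Q2)"
    proof (rule partition_onI)
      show "\<Union>(Q1 \<union> Q2) = A"
        using partition_onD1[OF Q1] partition_onD1[OF Q2] B by auto
      show "{} \<notin> Q1 \<union> Q2"
        using partition_onD3[OF Q1] partition_onD3[OF Q2] by auto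
      fix p p' assume "p \<in> Q1 \<union> Q2" "p' \<in> Q1 \<union> Q2" "p \<noteq> p'"
      moreover have "P \<inter> P' = {}" if "P \<in> Q1" "P' \<in> Q2" for P P'
        using partition_onD1[OF Q1] partition_onD1[OF Q2] that by blast
      ultimately show "disjnt p p'"
        using disjointD[OF partition_onD2[OF Q1], of p p'] disjointD[OF partition_onD2[OF Q2], of p p']
        unfolding disjnt_def by blast
    qed
    then show "(\<lambda>(B, Q1, Q2). (Q1 \<union> Q2, Q1)) x \<in> ?T"
      by (simp add: x)
    have "Q1 \<union> Q2 - Q1 = Q2" using disj by auto
    then show "(case (\<lambda>(B, Q1, Q2). (Q1 \<union> Q2, Q1)) x of (Q, R) \<Rightarrow> (\<Prod>P\<in>R. f P) * (\<Prod>P\<in>Q - R. g P)) =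
        (case x of (B, Q1, Q2) \<Rightarrow> (\<Prod>P\<in>Q1. f P) * (\<Prod>P\<in>Q2. g P))"
      by (simp add: x)
  next
    fix y assume "y \<in> ?T"
    then obtain Q R where y: "y = (Q, R)" and Q: "partition_on A Q" and R: "R \<subseteq> Q" by auto
    show "(\<lambda>(B, Q1, Q2). (Q1 \<union> Q2, Q1)) ((\<lambda>(Q, R). (\<Union>R, R, Q - R)) y) = y"
      using R by (auto simp: y)
    have "P \<inter> P' = {}" if "P \<in> R" "P' \<in> Q - R" for P P'
      using disjointD[OF partition_onD2[OF Q], of P P'] R that by blast
    then have "\<Union>(Q - R) = \<Union>Q - \<Union>R"
      using R by blast
    then have "\<Union>(Q - R) = A - \<Union>R"
      using partition_onD1[OF Q] by simp
    moreover have "\<Union>R \<subseteq> A" using partition_onD1[OF Q] R by auto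
    moreover have "disjoint R" "disjoint (Q - R)"
      using partition_onD2[OF Q] R by (auto intro: pairwise_subset)
    ultimately show "(\<lambda>(Q, R). (\<Union>R, R, Q - R)) y \<in> ?S"
      using partition_onD3[OF Q] R by (auto simp: y partition_on_def)
  qed
  also have "\<dots> = (\<Sum>Q | partition_on A Q. \<Sum>R\<in>Pow Q. (\<Prod>P\<in>R. f P) * (\<Prod>P\<in>Q - R. g P))"
    using fin[OF order_refl] A by (intro sum.Sigma[symmetric]) (auto intro: finite_elements)
  also have "\<dots> = partition_sum (\<lambda>P. f P + g P) A"
    unfolding partition_sum_def
    by (intro sum.cong refl prod_add[symmetric]) (use A in \<open>auto intro: finite_elements\<close>)
  finally show ?thesis .
qed

lemma partition_sum_zero:
  assumes "finite A" "A \<noteq> {}"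
  shows "partition_sum (\<lambda>_. 0) A = 0"
  unfolding partition_sum_def
proof (intro sum.neutral ballI)
  fix Q assume "Q \<in> {Q. partition_on A Q}"
  then have "finite Q" "Q \<noteq> {}"
    using assms by (auto intro: finite_elements dest: partition_onD1)
  then show "(\<Prod>P\<in>Q. 0) = (0 :: 'b)" by (intro prod_zero) auto
qed

lemma partition_sum_sign:
  assumes "finite A"
  shows "(-1) ^ card A * partition_sum f A = partition_sum (\<lambda>P. (-1) ^ card P * f P) A"
  unfolding partition_sum_def sum_distrib_left
proof (intro sum.cong refl)
  fix Q assume "Q \<in> {Q. partition_on A Q}"
  then have Q: "partition_on A Q" by simp
  have "card A = (\<Sum>P\<in>Q. card P)"
    using Q assms partition_onD1[OF Q]
    by (metis card_Union_disjoint finite_subset Union_upper partition_onD2 disjoint_def pairwise_disjnt_iff)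
  then show "(-1) ^ card A * (\<Prod>P\<in>Q. f P) = (\<Prod>P\<in>Q. (-1) ^ card P * f P)"
    by (simp add: prod.distrib power_sum)
qed


section \<open>The partition formula for symmetric sums of multiple zeta values\<close>

definition block_weight :: "(nat \<Rightarrow> nat) \<Rightarrow> nat set \<Rightarrow> real poly" where
  "block_weight k P = of_nat (fact (card P - 1)) * (chi_sh k P * eta (\<Sum>p\<in>P. k p))"

text \<open>The weight of a block in the formula for non-star values.\<close>
definition signed_weight :: "(nat \<Rightarrow> nat) \<Rightarrow> nat set \<Rightarrow> real poly" where
  "signed_weight k P = (-1) ^ (card P - 1) * block_weight k P"

lemma signed_weight_cong:
  assumes "\<And>p. p \<in> P \<Longrightarrow> k p = k' p"
  shows "signed_weight k P = signed_weight k' P"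
proof -
  have "(\<Sum>p\<in>P. k p) = (\<Sum>p\<in>P. k' p)" by (rule sum.cong) (use assms in auto)
  moreover have "(\<forall>p\<in>P. k p = 1) = (\<forall>p\<in>P. k' p = 1)" using assms by auto
  ultimately show ?thesis by (simp add: signed_weight_def block_weight_def chi_sh_def)
qed

text \<open>The factor \<^const>\<open>chi_sh\<close> leaves only the partition into singletons.\<close>
lemma partition_sum_all_1:
  assumes "finite A" "\<And>c. c \<in> A \<Longrightarrow> k c = 1"
  shows "partition_sum (signed_weight k) A = [:0, 1:] ^ card A"
  using assms
proof (induction A rule: finite_induct)
  case (insert b A)
  have zero: "signed_weight k (insert b C) = 0" if "C \<in> Pow A - {{}}" for C
  proof -
    have "finite C" "C \<noteq> {}" "b \<notin> C" using that insert by (auto intro: finite_subset)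
    then have "card (insert b C) > 1" by (simp add: card_gt_0_iff)
    moreover have "\<forall>p\<in>insert b C. k p = 1" using that insert.prems by auto
    ultimately show ?thesis by (simp add: signed_weight_def block_weight_def chi_sh_def)
  qed
  have "partition_sum (signed_weight k) (insert b A) =
        (\<Sum>C\<in>Pow A. signed_weight k (insert b C) * partition_sum (signed_weight k) (A - C))"
    using insert by (intro partition_sum_insert)
  also have "\<dots> = (\<Sum>C\<in>{{}}. signed_weight k (insert b C) * partition_sum (signed_weight k) (A - C))"
    using insert zero by (intro sum.mono_neutral_right) auto
  also have "\<dots> = [:0, 1:] * [:0, 1:] ^ card A"
  proof -
    have "signed_weight k {b} = [:0, 1:]"
      using insert.prems[of b] by (simp add: signed_weight_def block_weight_def chi_sh_def eta_def)
    then show ?thesis using insert by simp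
  qed
  finally show ?case using insert by simp
qed simp

lemma sum_membership:
  fixes g :: "'a set \<Rightarrow> 'b::comm_ring_1"
  assumes "finite A"
  shows "(\<Sum>c\<in>A. \<Sum>C | C \<subseteq> A \<and> c \<in> C. g C) = (\<Sum>C\<in>Pow A. of_nat (card C) * g C)"
proof -
  have "(\<Sum>c\<in>A. \<Sum>C | C \<subseteq> A \<and> c \<in> C. g C) = (\<Sum>c\<in>A. \<Sum>C | C \<in> Pow A \<and> c \<in> C. g C)"
    by simp
  also have "\<dots> = (\<Sum>C\<in>Pow A. \<Sum>c | c \<in> A \<and> c \<in> C. g C)"
    by (rule sum.swap_restrict) (use assms in auto)
  also have "\<dots> = (\<Sum>C\<in>Pow A. of_nat (card C) * g C)"
  proof (intro sum.cong refl)
    fix C assume "C \<in> Pow A"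
    then have "{c. c \<in> A \<and> c \<in> C} = C" by auto
    then show "(\<Sum>c | c \<in> A \<and> c \<in> C. g C) = of_nat (card C) * g C" by simp
  qed
  finally show ?thesis .
qed

text \<open>The partition side of \<open>sym_mzv_insert\<close>. Let \<open>insert b C\<close> be the block of \<open>b\<close>. If \<open>C\<close> is empty, it
  contributes \<open>\<zeta>(k b)\<close>. Otherwise merging \<open>b\<close> into any of the \<open>card C\<close> elements of \<open>C\<close> gives the same
  block value \<open>G C\<close>, and the factorials satisfy \<open>card C * fact (card C - 1) = fact (card C)\<close>. All these
  blocks have \<^const>\<open>chi_sh\<close> equal to 1 because \<open>k b \<ge> 2\<close>.\<close>
lemma partition_sum_merge:
  assumes A: "finite A" "b \<notin> A" and k: "\<And>c. c \<in> A \<Longrightarrow> k c \<ge> 1" and kb: "k b \<ge> 2"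
  shows "partition_sum (signed_weight k) (insert b A) =
         smult (mzv [k b]) (partition_sum (signed_weight k) A) -
         (\<Sum>c\<in>A. partition_sum (signed_weight (k(c := k c + k b))) A)"
proof -
  \<comment> \<open>the weight of a block \<open>C\<close> into which \<open>b\<close> has been merged, wherever in \<open>C\<close> that happened\<close>
  define G where "G = (\<lambda>C. (-1) ^ (card C - 1) * of_nat (fact (card C - 1)) * [:mzv [(\<Sum>p\<in>C. k p) + k b]:])"
  define S where "S = (\<lambda>B. partition_sum (signed_weight k) B)"
  have merged: "signed_weight (k(c := k c + k b)) C = G C" if "c \<in> C" "C \<subseteq> A" for c C
  proof -
    have fin: "finite C" using that A by (auto intro: finite_subset)
    have "(\<Sum>p\<in>C. (k(c := k c + k b)) p) = (k c + k b) + (\<Sum>p\<in>C - {c}. (k(c := k c + k b)) p)"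
      using sum.remove[OF fin \<open>c \<in> C\<close>, of "k(c := k c + k b)"] by simp
    also have "(\<Sum>p\<in>C - {c}. (k(c := k c + k b)) p) = (\<Sum>p\<in>C - {c}. k p)"
      by (rule sum.cong) auto
    finally have sum: "(\<Sum>p\<in>C. (k(c := k c + k b)) p) = (\<Sum>p\<in>C. k p) + k b"
      using sum.remove[OF fin \<open>c \<in> C\<close>, of k] by simp
    have "chi_sh (k(c := k c + k b)) C = 1"
      using that kb by (auto simp: chi_sh_def)
    then show ?thesis
      unfolding signed_weight_def block_weight_def sum G_def using kb by (simp add: eta_def mult.assoc)
  qed
  have inner: "partition_sum (signed_weight (k(c := k c + k b))) A = (\<Sum>C | C \<subseteq> A \<and> c \<in> C. G C * S (A - C))"
    if c: "c \<in> A" for c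
  proof -
    have A': "A = insert c (A - {c})" using c by auto
    have "partition_sum (signed_weight (k(c := k c + k b))) (insert c (A - {c})) =
        (\<Sum>C\<in>Pow (A - {c}). signed_weight (k(c := k c + k b)) (insert c C) *
           partition_sum (signed_weight (k(c := k c + k b))) (A - {c} - C))"
      using A by (intro partition_sum_insert) auto
    also have "\<dots> = (\<Sum>C | C \<subseteq> A \<and> c \<in> C. G C * S (A - C))"
    proof (rule sum.reindex_bij_witness[where i = "\<lambda>C. C - {c}" and j = "insert c"])
      fix C assume C: "C \<in> Pow (A - {c})"
      show "insert c C - {c} = C" using C by auto
      show "insert c C \<in> {C. C \<subseteq> A \<and> c \<in> C}" using C c by auto
      have "partition_sum (signed_weight (k(c := k c + k b))) (A - {c} - C) = S (A - {c} - C)"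
        unfolding S_def by (intro partition_sum_cong signed_weight_cong) auto
      moreover have "A - {c} - C = A - insert c C" by auto
      ultimately show "G (insert c C) * S (A - insert c C) =
         signed_weight (k(c := k c + k b)) (insert c C) *
         partition_sum (signed_weight (k(c := k c + k b))) (A - {c} - C)"
        using C c by (subst merged) auto
    qed auto
    finally show ?thesis unfolding A'[symmetric] .
  qed
  have added: "signed_weight k (insert b C) = - of_nat (card C) * G C" if C: "C \<subseteq> A" "C \<noteq> {}" for C
  proof -
    have fin: "finite C" "b \<notin> C" using that A by (auto intro: finite_subset)
    define E where "E = [:mzv [(\<Sum>p\<in>C. k p) + k b]:]"
    have chi: "chi_sh k (insert b C) = 1" using kb by (auto simp: chi_sh_def)
    have sum: "(\<Sum>p\<in>insert b C. k p) = (\<Sum>p\<in>C. k p) + k b" and card: "card (insert b C) - 1 = card C"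
      using fin by simp_all
    have eta: "eta ((\<Sum>p\<in>C. k p) + k b) = E"
      using kb by (simp add: eta_def E_def)
    obtain n where "card C = Suc n"
      using fin C by (cases "card C") auto
    then have sign: "(-1) ^ card C * of_nat (fact (card C)) =
        - of_nat (card C) * ((-1) ^ (card C - 1) * (of_nat (fact (card C - 1)) :: real poly))"
      by (simp only: diff_Suc_1 power_Suc fact_Suc of_nat_mult of_nat_id mult_minus_left
            mult_minus_right mult_1_left mult_ac)
    have "signed_weight k (insert b C) = ((-1) ^ card C * of_nat (fact (card C))) * E"
      unfolding signed_weight_def block_weight_def sum card eta chi by (simp only: mult_1_left mult.assoc)
    also have "\<dots> = - of_nat (card C) * G C"
      unfolding sign G_def E_def by (simp only: mult.assoc)
    finally show ?thesis .
  qed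
  have single: "signed_weight k {b} = [:mzv [k b]:]"
    using kb by (simp add: signed_weight_def block_weight_def eta_def chi_sh_def)
  have "partition_sum (signed_weight k) (insert b A) = (\<Sum>C\<in>Pow A. signed_weight k (insert b C) * S (A - C))"
    unfolding S_def using A by (intro partition_sum_insert)
  also have "\<dots> = signed_weight k {b} * S A + (\<Sum>C\<in>Pow A - {{}}. signed_weight k (insert b C) * S (A - C))"
    using A by (subst sum.remove[of _ "{}"]) auto
  also have "(\<Sum>C\<in>Pow A - {{}}. signed_weight k (insert b C) * S (A - C)) =
             (\<Sum>C\<in>Pow A - {{}}. - (of_nat (card C) * (G C * S (A - C))))"
    by (intro sum.cong refl) (simp add: added)
  also have "\<dots> = - (\<Sum>C\<in>Pow A - {{}}. of_nat (card C) * (G C * S (A - C)))"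
    by (simp add: sum_negf)
  also have "(\<Sum>C\<in>Pow A - {{}}. of_nat (card C) * (G C * S (A - C))) =
             (\<Sum>C\<in>Pow A. of_nat (card C) * (G C * S (A - C)))"
    using A by (intro sum.mono_neutral_left) auto
  also have "\<dots> = (\<Sum>c\<in>A. \<Sum>C | C \<subseteq> A \<and> c \<in> C. G C * S (A - C))"
    by (rule sum_membership[OF A(1), symmetric])
  also have "\<dots> = (\<Sum>c\<in>A. partition_sum (signed_weight (k(c := k c + k b))) A)"
    by (intro sum.cong refl) (simp add: inner)
  finally show ?thesis by (simp add: single S_def)
qed

text \<open>Both sides satisfy the same recursion as long as some entry exceeds 1, and both are \<open>T ^ card B\<close> if
  all entries are 1.\<close>
lemma sym_mzv_eq_partition_sum:
  assumes "finite B" "\<And>b. b \<in> B \<Longrightarrow> k b \<ge> 1"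
  shows "sym_mzv k B = partition_sum (signed_weight k) B"
  using assms
proof (induction "card B" arbitrary: B k)
  case 0
  then show ?case using sym_mzv_all_1[of B k] by simp
next
  case (Suc n)
  show ?case
  proof (cases "\<forall>b\<in>B. k b = 1")
    case True
    then show ?thesis using Suc.prems by (simp add: sym_mzv_all_1 partition_sum_all_1)
  next
    case False
    then obtain b where b: "b \<in> B" "k b \<noteq> 1" by blast
    define A where "A = B - {b}"
    have A: "finite A" "b \<notin> A" "B = insert b A" "card A = n"
      using Suc.prems(1) Suc.hyps(2) b by (auto simp: A_def)
    have kb: "k b \<ge> 2" using b Suc.prems(2)[of b] by auto
    have IH: "sym_mzv k' A = partition_sum (signed_weight k') A" if "\<And>c. c \<in> A \<Longrightarrow> k' c \<ge> 1" for k'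
      using A that by (intro Suc.hyps(1)) auto
    have "sym_mzv k B = smult (mzv [k b]) (sym_mzv k A) - (\<Sum>c\<in>A. sym_mzv (k(c := k c + k b)) A)"
      unfolding A(3) using A Suc.prems(2) kb by (intro sym_mzv_insert) auto
    also have "\<dots> = smult (mzv [k b]) (partition_sum (signed_weight k) A) -
        (\<Sum>c\<in>A. partition_sum (signed_weight (k(c := k c + k b))) A)"
      using A Suc.prems(2) kb by (subst IH, force, intro arg_cong2[of _ _ _ _ minus] sum.cong refl IH) auto
    also have "\<dots> = partition_sum (signed_weight k) B"
      unfolding A(3) using A Suc.prems(2) kb by (intro partition_sum_merge[symmetric]) auto
    finally show ?thesis .
  qed
qed


section \<open>Linear extensions and the antipode relation\<close>

text \<open>For an irreflexive relation \<open>R\<close>, not necessarily transitive, these are the linear extensions of its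
  transitive closure; see \<open>linear_extension_trancl_iff\<close> and \<open>sorted_wrt_irrefl_iff\<close>. Working with generating
  relations makes it easy to add or remove a single comparison.\<close>
definition lin_exts :: "'a set \<Rightarrow> ('a \<times> 'a) set \<Rightarrow> 'a list set" where
  "lin_exts A R = {xs. distinct xs \<and> set xs = A \<and> sorted_wrt (\<lambda>x y. (y, x) \<notin> R) xs}"

definition label_sum :: "(nat \<times> nat) list set \<Rightarrow> ncpoly" where
  "label_sum S = (\<Sum>xs\<in>S. word_poly (map X_label xs))"

lemma finite_lin_exts [simp]: "finite (lin_exts A R)"
  by (rule finite_subset[OF _ finite_permutations_of_set[of A]]) (auto simp: lin_exts_def permutations_of_set_def)

text \<open>A list that respects the generating comparisons respects all of their consequences.\<close>
lemma linear_extension_trancl_iff: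
  assumes R: "R \<subseteq> set xs \<times> set xs"
  shows "(\<forall>a<length xs. \<forall>b<length xs. (xs ! a, xs ! b) \<in> R\<^sup>+ \<longrightarrow> a < b) \<longleftrightarrow>
         (\<forall>a<length xs. \<forall>b<length xs. (xs ! a, xs ! b) \<in> R \<longrightarrow> a < b)" (is "?P \<longleftrightarrow> ?Q")
proof
  assume Q: ?Q
  have "\<forall>a<length xs. \<forall>b<length xs. x = xs ! a \<longrightarrow> y = xs ! b \<longrightarrow> a < b" if "(x, y) \<in> R\<^sup>+" for x y
    using that
  proof (induction rule: trancl_induct)
    case (base y)
    then show ?case using Q by blast
  next
    case (step y z)
    from step(2) R have "y \<in> set xs" by auto
    then obtain c where "c < length xs" "y = xs ! c" by (auto simp: in_set_conv_nth)
    with step Q show ?case by (blast intro: less_trans)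
  qed
  then show ?P by blast
qed blast

lemma sorted_wrt_irrefl_iff:
  assumes "\<And>x. (x, x) \<notin> R"
  shows "(\<forall>a<length xs. \<forall>b<length xs. (xs ! a, xs ! b) \<in> R \<longrightarrow> a < b) \<longleftrightarrow>
         sorted_wrt (\<lambda>x y. (y, x) \<notin> R) xs"
proof
  assume *: "\<forall>a<length xs. \<forall>b<length xs. (xs ! a, xs ! b) \<in> R \<longrightarrow> a < b"
  show "sorted_wrt (\<lambda>x y. (y, x) \<notin> R) xs"
    unfolding sorted_wrt_iff_nth_less
  proof (intro allI impI notI)
    fix i j assume ij: "i < j" "j < length xs" "(xs ! j, xs ! i) \<in> R"
    with * have "j < i" using order_less_trans by blast
    with ij show False by simp
  qed
next
  assume *: "sorted_wrt (\<lambda>x y. (y, x) \<notin> R) xs"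
  show "\<forall>a<length xs. \<forall>b<length xs. (xs ! a, xs ! b) \<in> R \<longrightarrow> a < b"
  proof (intro allI impI)
    fix a b assume ab: "a < length xs" "b < length xs" "(xs ! a, xs ! b) \<in> R"
    have "a \<noteq> b" using ab assms by auto
    moreover have "\<not> b < a" using * ab unfolding sorted_wrt_iff_nth_less by blast
    ultimately show "a < b" by simp
  qed
qed

text \<open>In a list either \<open>p\<close> precedes \<open>q\<close> or \<open>q\<close> precedes \<open>p\<close>.\<close>
lemma lin_exts_split:
  assumes "p \<in> A" "q \<in> A" "p \<noteq> q"
  shows "lin_exts A R = lin_exts A (insert (p, q) R) \<union> lin_exts A (insert (q, p) R)"
    and "lin_exts A (insert (p, q) R) \<inter> lin_exts A (insert (q, p) R) = {}"
proof -
  have ins: "sorted_wrt (\<lambda>x y. (y, x) \<notin> insert (p, q) R) xs \<longleftrightarrow>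
        sorted_wrt (\<lambda>x y. (y, x) \<notin> R) xs \<and> a < b"
    if "distinct xs" "a < length xs" "b < length xs" "xs ! a = p" "xs ! b = q" "p \<noteq> q" for xs a b R p q
  proof -
    have "(xs ! j, xs ! i) = (p, q) \<longleftrightarrow> j = a \<and> i = b" if "i < length xs" "j < length xs" for i j
      using that \<open>distinct xs\<close> \<open>a < length xs\<close> \<open>b < length xs\<close> \<open>xs ! a = p\<close> \<open>xs ! b = q\<close>
      by (auto simp: nth_eq_iff_index_eq)
    then have "sorted_wrt (\<lambda>x y. (y, x) \<notin> insert (p, q) R) xs \<longleftrightarrow>
        (\<forall>i j. i < j \<longrightarrow> j < length xs \<longrightarrow> (xs ! j, xs ! i) \<notin> R \<and> \<not> (j = a \<and> i = b))"
      unfolding sorted_wrt_iff_nth_less by (metis insert_iff order_less_trans)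
    also have "\<dots> \<longleftrightarrow> sorted_wrt (\<lambda>x y. (y, x) \<notin> R) xs \<and> \<not> b < a"
      unfolding sorted_wrt_iff_nth_less using that by blast
    also have "\<not> b < a \<longleftrightarrow> a < b"
    proof -
      have "a \<noteq> b" using that by auto
      then show ?thesis by auto
    qed
    finally show ?thesis .
  qed
  have iff: "(xs \<in> lin_exts A R \<longleftrightarrow> xs \<in> lin_exts A (insert (p, q) R) \<or> xs \<in> lin_exts A (insert (q, p) R)) \<and>
      \<not> (xs \<in> lin_exts A (insert (p, q) R) \<and> xs \<in> lin_exts A (insert (q, p) R))" for xs
  proof (cases "distinct xs \<and> set xs = A")
    case True
    then obtain a b where ab: "a < length xs" "b < length xs" "xs ! a = p" "xs ! b = q"
      using assms by (metis in_set_conv_nth)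
    have "a \<noteq> b" using ab assms by auto
    then show ?thesis
      using True ins[of xs a b p q R] ins[of xs b a q p R] ab assms
      by (auto simp: lin_exts_def)
  qed (auto simp: lin_exts_def)
  then show "lin_exts A R = lin_exts A (insert (p, q) R) \<union> lin_exts A (insert (q, p) R)"
    and "lin_exts A (insert (p, q) R) \<inter> lin_exts A (insert (q, p) R) = {}" by blast+
qed

lemma label_sum_split:
  assumes "p \<in> A" "q \<in> A" "p \<noteq> q"
  shows "label_sum (lin_exts A R) =
         label_sum (lin_exts A (insert (p, q) R)) + label_sum (lin_exts A (insert (q, p) R))"
  unfolding label_sum_def
  by (subst lin_exts_split(1)[OF assms], rule sum.union_disjoint) (use lin_exts_split(2)[OF assms] in auto)

text \<open>If consecutive elements of \<open>xs\<close> are related, the order is total. The first element of another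
  extension would otherwise come before its own predecessor in \<open>xs\<close>.\<close>
lemma lin_exts_chain:
  assumes "distinct xs" "successively (\<lambda>x y. (x, y) \<in> R) xs" "sorted_wrt (\<lambda>x y. (y, x) \<notin> R) xs"
  shows "lin_exts (set xs) R = {xs}"
proof -
  have "ys = xs" if "distinct ys" "set ys = set xs" "sorted_wrt (\<lambda>x y. (y, x) \<notin> R) ys" for ys
    using that assms
  proof (induction xs arbitrary: ys)
    case (Cons x xs)
    then obtain y ys' where ys: "ys = y # ys'" by (cases ys) auto
    have "y = x"
    proof (rule ccontr)
      assume "y \<noteq> x"
      then have "y \<in> set xs" using Cons.prems(2) by (auto simp: ys)
      then obtain as bs where xs: "xs = as @ y # bs" by (meson split_list)
      \<comment> \<open>the predecessor of \<open>y\<close> in the chain\<close>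
      define p where "p = last (x # as)"
      have "(p, y) \<in> R"
        using Cons.prems(5) successively_append_iff[of "\<lambda>x y. (x, y) \<in> R" "x # as" "y # bs"]
        by (simp add: p_def xs)
      moreover have "p \<in> set (x # as)"
        unfolding p_def by (rule last_in_set) simp
      then have "p \<in> set (x # xs)" "p \<noteq> y"
        using Cons.prems(4) by (auto simp: xs)
      then have "p \<in> set ys'"
        using Cons.prems(2) by (auto simp: ys)
      ultimately show False
        using Cons.prems(3) by (auto simp: ys)
    qed
    moreover have "ys' = xs"
    proof (rule Cons.IH)
      show "successively (\<lambda>x y. (x, y) \<in> R) xs"
        using Cons.prems(5) by (cases xs) auto
      show "set ys' = set xs"
        using Cons.prems(1,2,4) \<open>y = x\<close> by (auto simp: ys)
    qed (use Cons.prems ys in auto)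
    ultimately show ?case by (simp add: ys)
  qed simp
  then show ?thesis using assms by (auto simp: lin_exts_def)
qed

text \<open>The entries of two disjoint lists can be told apart, so each shuffle arises in one way. After
  labelling, the multiplicities of \<^const>\<open>shuffle_words\<close> appear.\<close>
lemma sum_shuffles:
  fixes g :: "'b list \<Rightarrow> 'c::comm_monoid_add"
  assumes "set xs \<inter> set ys = {}"
  shows "(\<Sum>zs\<in>shuffles xs ys. g (map lab zs)) = (\<Sum>w\<in>#shuffle_words (map lab xs) (map lab ys). g w)"
  using assms
proof (induction xs ys arbitrary: g rule: shuffles.induct)
  case (3 x xs y ys)
  have "shuffles (x # xs) (y # ys) = (#) x ` shuffles xs (y # ys) \<union> (#) y ` shuffles (x # xs) ys"
    by simp
  moreover have "(#) x ` shuffles xs (y # ys) \<inter> (#) y ` shuffles (x # xs) ys = {}"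
    using 3 by auto
  ultimately have "(\<Sum>zs\<in>shuffles (x # xs) (y # ys). g (map lab zs)) =
      (\<Sum>zs\<in>(#) x ` shuffles xs (y # ys). g (map lab zs)) + (\<Sum>zs\<in>(#) y ` shuffles (x # xs) ys. g (map lab zs))"
    by (simp only:) (rule sum.union_disjoint, auto)
  also have "(\<Sum>zs\<in>(#) x ` shuffles xs (y # ys). g (map lab zs)) =
             (\<Sum>zs\<in>shuffles xs (y # ys). g (lab x # map lab zs))"
    by (subst sum.reindex) auto
  also have "(\<Sum>zs\<in>(#) y ` shuffles (x # xs) ys. g (map lab zs)) =
             (\<Sum>zs\<in>shuffles (x # xs) ys. g (lab y # map lab zs))"
    by (subst sum.reindex) auto
  finally show ?case
    using 3(1)[of "\<lambda>w. g (lab x # w)"] 3(2)[of "\<lambda>w. g (lab y # w)"] 3(3)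
    by (simp add: image_mset.compositionality comp_def)
qed simp_all

text \<open>Restricting a linear extension of a disjoint union to the two parts recovers the parts of the shuffle.\<close>
lemma lin_exts_disjoint_union:
  assumes disj: "A \<inter> B = {}" and R: "R \<subseteq> A \<times> A" and S: "S \<subseteq> B \<times> B"
  shows "lin_exts (A \<union> B) (R \<union> S) = (\<Union>xs\<in>lin_exts A R. \<Union>ys\<in>lin_exts B S. shuffles xs ys)"
proof (intro equalityI subsetI)
  fix zs assume zs: "zs \<in> lin_exts (A \<union> B) (R \<union> S)"
  have sorted: "sorted_wrt (\<lambda>x y. (y, x) \<notin> R) zs" "sorted_wrt (\<lambda>x y. (y, x) \<notin> S) zs"
    using zs by (auto simp: lin_exts_def intro: sorted_wrt_mono_rel[rotated])
  have "filter (\<lambda>x. x \<in> A) zs \<in> lin_exts A R" "filter (\<lambda>x. \<not> x \<in> A) zs \<in> lin_exts B S"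
    using zs disj sorted by (auto simp: lin_exts_def intro!: sorted_wrt_filter)
  moreover have "zs \<in> shuffles (filter (\<lambda>x. x \<in> A) zs) (filter (\<lambda>x. \<not> x \<in> A) zs)"
    by (rule partition_in_shuffles)
  ultimately show "zs \<in> (\<Union>xs\<in>lin_exts A R. \<Union>ys\<in>lin_exts B S. shuffles xs ys)"
    by blast
next
  fix zs assume "zs \<in> (\<Union>xs\<in>lin_exts A R. \<Union>ys\<in>lin_exts B S. shuffles xs ys)"
  then obtain xs ys where xs: "xs \<in> lin_exts A R" and ys: "ys \<in> lin_exts B S" and zs: "zs \<in> shuffles xs ys"
    by blast
  have sorted: "sorted_wrt (\<lambda>x y. (y, x) \<notin> R \<union> S) zs"
    if "zs \<in> shuffles xs ys" "set xs \<subseteq> A" "set ys \<subseteq> B"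
      "sorted_wrt (\<lambda>x y. (y, x) \<notin> R) xs" "sorted_wrt (\<lambda>x y. (y, x) \<notin> S) ys" for xs ys zs
    using that
  proof (induction xs ys arbitrary: zs rule: shuffles.induct)
    case (1 ys)
    have "(y, x) \<notin> R" if "x \<in> set ys" for x y
      using that 1 R disj by auto
    with 1 show ?case
      by (auto elim!: sorted_wrt_mono_rel[rotated])
  next
    case (2 xs)
    have "(z, y) \<notin> S" if "y \<in> set xs" for y z
      using that 2 S disj by auto
    with 2 show ?case
      by (auto elim!: sorted_wrt_mono_rel[rotated])
  next
    case (3 x xs y ys)
    from 3(3) consider zs' where "zs = x # zs'" "zs' \<in> shuffles xs (y # ys)"
      | zs' where "zs = y # zs'" "zs' \<in> shuffles (x # xs) ys" by auto
    then show ?case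
    proof cases
      case 1
      have "set zs' = set xs \<union> set (y # ys)" using set_shuffles[OF 1(2)] .
      then have "\<forall>z\<in>set zs'. (z, x) \<notin> R \<union> S"
        using 3(4,5,6) R S disj by auto
      moreover have "sorted_wrt (\<lambda>x y. (y, x) \<notin> R \<union> S) zs'"
        using 3 1 by auto
      ultimately show ?thesis by (simp add: 1)
    next
      case 2
      have "set zs' = set (x # xs) \<union> set ys" using set_shuffles[OF 2(2)] .
      then have "\<forall>z\<in>set zs'. (z, y) \<notin> R \<union> S"
        using 3(4,5,7) R S disj by auto
      moreover have "sorted_wrt (\<lambda>x y. (y, x) \<notin> R \<union> S) zs'"
        using 3 2 by auto
      ultimately show ?thesis by (simp add: 2)
    qed
  qed
  have "distinct zs"
    using distinct_disjoint_shuffles[OF _ _ _ zs] xs ys disj by (auto simp: lin_exts_def)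
  moreover have "set zs = A \<union> B"
    using set_shuffles[OF zs] xs ys by (auto simp: lin_exts_def)
  ultimately show "zs \<in> lin_exts (A \<union> B) (R \<union> S)"
    using sorted[OF zs] xs ys by (auto simp: lin_exts_def)
qed

lemma shuffle_word_poly_left:
  assumes "finite K" "Poly_Mapping.keys g \<subseteq> K"
  shows "shuffle (word_poly u) g =
         (\<Sum>v\<in>K. \<Sum>w\<in>#shuffle_words u v. Poly_Mapping.single w (Poly_Mapping.lookup g v))"
proof -
  have "shuffle (word_poly u) g =
        (\<Sum>v\<in>Poly_Mapping.keys g. \<Sum>w\<in>#shuffle_words u v. Poly_Mapping.single w (Poly_Mapping.lookup g v))"
    by (simp add: shuffle_def)
  also have "\<dots> = (\<Sum>v\<in>K. \<Sum>w\<in>#shuffle_words u v. Poly_Mapping.single w (Poly_Mapping.lookup g v))"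
    by (rule sum.mono_neutral_left) (use assms in \<open>auto simp: not_in_keys_iff_lookup_eq_zero\<close>)
  finally show ?thesis .
qed

lemma shuffle_word_poly_add:
  "shuffle (word_poly u) (g + h) = shuffle (word_poly u) g + shuffle (word_poly u) h"
proof -
  let ?K = "Poly_Mapping.keys g \<union> Poly_Mapping.keys h"
  have "Poly_Mapping.keys (g + h) \<subseteq> ?K" by (rule Poly_Mapping.keys_add)
  then show ?thesis
    by (simp add: shuffle_word_poly_left[of ?K] lookup_add single_add sum_mset.distrib sum.distrib)
qed

lemma shuffle_sum_word_poly:
  assumes "finite A"
  shows "shuffle (word_poly u) (\<Sum>x\<in>A. f x) = (\<Sum>x\<in>A. shuffle (word_poly u) (f x))"
  using assms
  by (induction A rule: finite_induct) (simp_all add: shuffle_word_poly_add, simp add: shuffle_def)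

lemma label_sum_disjoint_union:
  assumes disj: "A \<inter> B = {}" and R: "R \<subseteq> A \<times> A" and S: "S \<subseteq> B \<times> B" and xs: "lin_exts A R = {xs}"
  shows "label_sum (lin_exts (A \<union> B) (R \<union> S)) =
         shuffle (word_poly (map X_label xs)) (label_sum (lin_exts B S))"
proof -
  have setxs: "set xs = A" "distinct xs" using xs by (auto simp: lin_exts_def)
  have disjnt: "set xs \<inter> set ys = {}" if "ys \<in> lin_exts B S" for ys
    using that setxs disj by (auto simp: lin_exts_def)
  have inj: "shuffles xs ys \<inter> shuffles xs ys' = {}"
    if "ys \<in> lin_exts B S" "ys' \<in> lin_exts B S" "ys \<noteq> ys'" for ys ys'
  proof (rule ccontr)
    assume "shuffles xs ys \<inter> shuffles xs ys' \<noteq> {}"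
    then obtain zs where "zs \<in> shuffles xs ys" "zs \<in> shuffles xs ys'" by blast
    then have "filter (\<lambda>x. x \<notin> set xs) zs = ys" "filter (\<lambda>x. x \<notin> set xs) zs = ys'"
      using that disjnt by (auto intro!: filter_shuffles_disjoint1(2))
    with that show False by simp
  qed
  have "label_sum (lin_exts (A \<union> B) (R \<union> S)) = label_sum (\<Union>ys\<in>lin_exts B S. shuffles xs ys)"
    by (simp add: lin_exts_disjoint_union[OF disj R S] xs)
  also have "\<dots> = (\<Sum>ys\<in>lin_exts B S. \<Sum>zs\<in>shuffles xs ys. word_poly (map X_label zs))"
    unfolding label_sum_def by (rule sum.UNION_disjoint) (use inj in auto)
  also have "\<dots> = (\<Sum>ys\<in>lin_exts B S. shuffle (word_poly (map X_label xs)) (word_poly (map X_label ys)))"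
    by (intro sum.cong refl) (simp only: sum_shuffles[OF disjnt, where g = "\<lambda>w. word_poly w"] shuffle_word_poly)
  also have "\<dots> = shuffle (word_poly (map X_label xs)) (label_sum (lin_exts B S))"
    unfolding label_sum_def by (rule shuffle_sum_word_poly[symmetric]) simp
  finally show ?thesis .
qed

text \<open>The first \<open>i\<close> chains of the poset, each increasing, with later chains placed first.\<close>
primrec reversed_chains :: "nat list \<Rightarrow> nat \<Rightarrow> (nat \<times> nat) list" where
  "reversed_chains k 0 = []"
| "reversed_chains k (Suc i) = map (Pair i) [1..<Suc (k ! i)] @ reversed_chains k i"

definition chain_rel :: "nat list \<Rightarrow> nat set \<Rightarrow> ((nat \<times> nat) \<times> (nat \<times> nat)) set" where
  "chain_rel k I = {((i, j), (i, j + 1)) | i j. i \<in> I \<and> 1 \<le> j \<and> j < k ! i}"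

text \<open>The relations of the poset \<open>X\<close> between consecutive chains.\<close>
definition up_links :: "nat list \<Rightarrow> nat set \<Rightarrow> ((nat \<times> nat) \<times> (nat \<times> nat)) set" where
  "up_links k I = {((i, 1), (i + 1, k ! (i + 1))) | i. i \<in> I}"

text \<open>The opposite comparisons, which concatenate consecutive chains in reversed order.\<close>
definition down_links :: "nat list \<Rightarrow> nat set \<Rightarrow> ((nat \<times> nat) \<times> (nat \<times> nat)) set" where
  "down_links k I = {((i + 1, k ! (i + 1)), (i, 1)) | i. i \<in> I}"

definition chain_elems :: "nat list \<Rightarrow> nat set \<Rightarrow> (nat \<times> nat) set" where
  "chain_elems k I = {(i, j). i \<in> I \<and> 1 \<le> j \<and> j \<le> k ! i}"

lemma is_index_nth: "is_index k \<Longrightarrow> i < length k \<Longrightarrow> 1 \<le> k ! i"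
  by (simp add: is_index_def)

lemma set_reversed_chains: "set (reversed_chains k i) = chain_elems k {..<i}"
  by (induction i) (auto simp: chain_elems_def less_Suc_eq)

lemma distinct_reversed_chains: "distinct (reversed_chains k i)"
  by (induction i) (auto simp: set_reversed_chains chain_elems_def distinct_map inj_on_def)

lemma sorted_reversed_chains:
  "sorted_wrt (\<lambda>x y. fst y < fst x \<or> fst x = fst y \<and> snd x < snd y) (reversed_chains k i)"
proof (induction i)
  case (Suc i)
  have "sorted_wrt (\<lambda>x y. fst y < fst x \<or> fst x = fst y \<and> snd x < snd y) (map (Pair i) [1..<Suc (k ! i)])"
    by (simp add: sorted_wrt_map sorted_wrt_upt del: upt_Suc)
  with Suc show ?case
    by (auto simp: sorted_wrt_append set_reversed_chains chain_elems_def simp del: upt_Suc)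
qed simp

lemma successively_reversed_chains:
  assumes "\<And>i. i < n \<Longrightarrow> 1 \<le> k ! i" "m \<le> n"
  shows "successively (\<lambda>x y. (x, y) \<in> chain_rel k {..<n} \<union> down_links k {i. i + 1 < n}) (reversed_chains k m)"
  using assms(2)
proof (induction m)
  case (Suc m)
  let ?R = "chain_rel k {..<n} \<union> down_links k {i. i + 1 < n}"
  have chain: "successively (\<lambda>x y. (x, y) \<in> ?R) (map (Pair m) [1..<Suc l])" if "l \<le> k ! m" for l
    using that
  proof (induction l)
    case (Suc l)
    have "(last (map (Pair m) [1..<Suc l]), (m, Suc l)) \<in> ?R" if "l \<noteq> 0"
      using that Suc.prems \<open>Suc m \<le> n\<close> by (auto simp: last_map chain_rel_def)
    then show ?case
      using Suc by (cases "l = 0") (auto simp: successively_append_iff simp del: Un_iff)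
  qed simp
  have "(last (map (Pair m) [1..<Suc (k ! m)]), hd (reversed_chains k m)) \<in> ?R" if "m \<noteq> 0"
  proof -
    obtain m' where m': "m = Suc m'" using \<open>m \<noteq> 0\<close> by (cases m) auto
    have "last (map (Pair m) [1..<Suc (k ! m)]) = (m, k ! m)"
      using assms(1)[of m] Suc.prems by (simp add: last_map)
    moreover have "hd (reversed_chains k m) = (m', 1)"
      using assms(1)[of m'] Suc.prems by (simp add: m' upt_conv_Cons del: upt_Suc)
    ultimately show ?thesis
      using Suc.prems by (auto simp: m' down_links_def)
  qed
  moreover have "reversed_chains k m = []" if "m = 0" using that by simp
  ultimately show ?case
    using Suc chain[OF order_refl]
    by (cases "m = 0") (simp_all add: successively_append_iff del: Un_iff upt_Suc)
qed simp

lemma lin_exts_reversed_chains: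
  assumes "\<And>i. i < n \<Longrightarrow> 1 \<le> k ! i"
  shows "lin_exts (chain_elems k {..<n}) (chain_rel k {..<n} \<union> down_links k {i. i + 1 < n}) = {reversed_chains k n}"
  unfolding set_reversed_chains[symmetric]
proof (rule lin_exts_chain)
  show "sorted_wrt (\<lambda>x y. (y, x) \<notin> chain_rel k {..<n} \<union> down_links k {i. i + 1 < n}) (reversed_chains k n)"
    by (rule sorted_wrt_mono_rel[OF _ sorted_reversed_chains]) (auto simp: chain_rel_def down_links_def)
qed (use assms distinct_reversed_chains successively_reversed_chains in auto)

lemma map_X_label_reversed_chains:
  assumes "is_index k" "i \<le> length k"
  shows "map X_label (reversed_chains k i) = word_of_index (rev (take i k))"
  using assms(2)
proof (induction i)
  case (Suc i)
  have "1 \<le> k ! i" using assms Suc.prems by (intro is_index_nth) auto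
  then have "[1..<Suc (k ! i)] = 1 # [2..<Suc (k ! i)]"
    by (simp add: upt_conv_Cons numeral_2_eq_2 del: upt_Suc)
  moreover have "map (X_label \<circ> Pair i) [2..<Suc (k ! i)] = replicate (k ! i - 1) E0"
    by (intro replicate_eqI) auto
  ultimately have "map X_label (map (Pair i) [1..<Suc (k ! i)]) = E1 # replicate (k ! i - 1) E0"
    by (simp del: upt_Suc)
  then show ?case
    using Suc by (simp add: take_Suc_conv_app_nth word_of_index_Cons del: upt_Suc)
qed simp

lemma lin_exts_image:
  assumes "inj f"
  shows "lin_exts (f ` A) (map_prod f f ` R) = map f ` lin_exts A R"
proof (intro equalityI subsetI)
  have mem: "(f y, f x) \<in> map_prod f f ` R \<longleftrightarrow> (y, x) \<in> R" for x y
    using inj_image_mem_iff[OF prod.inj_map[OF assms assms], of "(y, x)" R] by simp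
  fix ys assume ys: "ys \<in> lin_exts (f ` A) (map_prod f f ` R)"
  then have "set ys \<subseteq> range f" by (auto simp: lin_exts_def)
  then obtain xs where xs: "ys = map f xs"
    by (metis ex_map_conv rangeE subsetD)
  have "xs \<in> lin_exts A R"
    using ys assms by (auto simp: lin_exts_def xs sorted_wrt_map mem distinct_map inj_image_eq_iff)
  then show "ys \<in> map f ` lin_exts A R" by (simp add: xs)
next
  have mem: "(f y, f x) \<in> map_prod f f ` R \<longleftrightarrow> (y, x) \<in> R" for x y
    using inj_image_mem_iff[OF prod.inj_map[OF assms assms], of "(y, x)" R] by simp
  fix ys assume "ys \<in> map f ` lin_exts A R"
  then show "ys \<in> lin_exts (f ` A) (map_prod f f ` R)"
    using assms by (auto simp: lin_exts_def sorted_wrt_map mem distinct_map intro: inj_on_subset[OF assms subset_UNIV])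
qed

lemma X_elems_eq: "X_elems k = chain_elems k {..<length k}"
  by (auto simp: X_elems_def chain_elems_def)

lemma linear_extensions_eq:
  assumes "is_index k"
  shows "linear_extensions k = lin_exts (chain_elems k {..<length k})
           (chain_rel k {..<length k} \<union> up_links k {i. i + 1 < length k})"
proof -
  let ?R = "chain_rel k {..<length k} \<union> up_links k {i. i + 1 < length k}"
  have X: "X_less k = ?R\<^sup>+"
    unfolding X_less_def chain_rel_def up_links_def by simp
  have sub: "?R \<subseteq> X_elems k \<times> X_elems k"
    using is_index_nth[OF assms] by (auto simp: X_elems_def chain_rel_def up_links_def)
  have irrefl: "(x, x) \<notin> ?R" for x
    by (auto simp: chain_rel_def up_links_def)
  show ?thesis
    unfolding linear_extensions_def lin_exts_def X X_elems_eq[symmetric]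
  proof (intro Collect_cong conj_cong refl)
    fix xs assume "set xs = X_elems k"
    then have "?R \<subseteq> set xs \<times> set xs" using sub by simp
    then show "(\<forall>a<length xs. \<forall>b<length xs. (xs ! a, xs ! b) \<in> ?R\<^sup>+ \<longrightarrow> a < b) =
               sorted_wrt (\<lambda>x y. (y, x) \<notin> ?R) xs"
      by (simp only: linear_extension_trancl_iff sorted_wrt_irrefl_iff[OF irrefl])
  qed
qed

text \<open>The chains from position \<open>i\<close> on form the poset of the remaining index, up to a shift of the first
  coordinate, which does not affect labels.\<close>
lemma label_sum_tail:
  assumes "is_index k" "i \<le> length k"
  shows "label_sum (lin_exts (chain_elems k {i..<length k})
           (chain_rel k {i..<length k} \<union> up_links k {j. i \<le> j \<and> j + 1 < length k})) = w_index (drop i k)"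
proof -
  define f where "f = (\<lambda>p :: nat \<times> nat. (fst p + i, snd p))"
  have f: "inj f" by (auto simp: inj_def f_def prod_eq_iff)
  let ?d = "drop i k" and ?n = "length k - i"
  have nth: "?d ! j = k ! (j + i)" if "j < ?n" for j
    using that assms by (simp add: add.commute)
  have elems: "chain_elems k {i..<length k} = f ` chain_elems ?d {..<?n}"
  proof (intro equalityI subsetI)
    fix x assume "x \<in> chain_elems k {i..<length k}"
    then obtain j l where "x = (j, l)" "i \<le> j" "j < length k" "1 \<le> l" "l \<le> k ! j"
      by (auto simp: chain_elems_def)
    then show "x \<in> f ` chain_elems ?d {..<?n}"
      by (intro image_eqI[of _ _ "(j - i, l)"]) (auto simp: f_def chain_elems_def)
  qed (auto simp: f_def chain_elems_def add.commute)
  have rel: "chain_rel k {i..<length k} \<union> up_links k {j. i \<le> j \<and> j + 1 < length k} =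
      map_prod f f ` (chain_rel ?d {..<?n} \<union> up_links ?d {j. j + 1 < ?n})"
  proof (intro equalityI subsetI)
    fix x assume "x \<in> chain_rel k {i..<length k} \<union> up_links k {j. i \<le> j \<and> j + 1 < length k}"
    then consider j l where "x = ((j, l), (j, l + 1))" "i \<le> j" "j < length k" "1 \<le> l" "l < k ! j"
      | j where "x = ((j, 1), (j + 1, k ! (j + 1)))" "i \<le> j" "j + 1 < length k"
      by (auto simp: chain_rel_def up_links_def)
    then show "x \<in> map_prod f f ` (chain_rel ?d {..<?n} \<union> up_links ?d {j. j + 1 < ?n})"
    proof cases
      case 1
      then show ?thesis
        by (intro image_eqI[of _ _ "((j - i, l), (j - i, l + 1))"]) (auto simp: f_def chain_rel_def)
    next
      case 2
      then show ?thesis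
        by (intro image_eqI[of _ _ "((j - i, 1), (j - i + 1, ?d ! (j - i + 1)))"])
           (auto simp: f_def up_links_def)
    qed
  next
    fix x assume "x \<in> map_prod f f ` (chain_rel ?d {..<?n} \<union> up_links ?d {j. j + 1 < ?n})"
    then consider j l where "x = ((j + i, l), (j + i, l + 1))" "j < ?n" "1 \<le> l" "l < ?d ! j"
      | j where "x = ((j + i, 1), (j + 1 + i, ?d ! (j + 1)))" "j + 1 < ?n"
      by (auto simp: chain_rel_def up_links_def f_def)
    then show "x \<in> chain_rel k {i..<length k} \<union> up_links k {j. i \<le> j \<and> j + 1 < length k}"
    proof cases
      case 1
      then show ?thesis by (auto simp: chain_rel_def nth add.commute)
    next
      case 2
      then show ?thesis by (auto simp: up_links_def nth add.commute)
    qed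
  qed
  have lab: "X_label (f p) = X_label p" for p
    by (cases p) (simp add: f_def)
  have "is_index ?d" using assms by (auto simp: is_index_def dest: in_set_dropD)
  from linear_extensions_eq[OF this]
  have eq: "lin_exts (chain_elems k {i..<length k})
           (chain_rel k {i..<length k} \<union> up_links k {j. i \<le> j \<and> j + 1 < length k}) =
        map f ` linear_extensions ?d"
    unfolding elems rel lin_exts_image[OF f] by simp
  have "label_sum (lin_exts (chain_elems k {i..<length k})
           (chain_rel k {i..<length k} \<union> up_links k {j. i \<le> j \<and> j + 1 < length k})) =
        (\<Sum>xs\<in>linear_extensions ?d. word_poly (map X_label (map f xs)))"
    unfolding label_sum_def eq
    by (subst sum.reindex) (auto intro: inj_on_subset[OF inj_mapI[OF f]])
  then show ?thesis
    by (simp add: w_index_def comp_def lab)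
qed

text \<open>Chains before the cut \<open>i\<close> are concatenated downwards, chains after it are linked as in \<open>X\<close>, and
  nothing is imposed between the chains \<open>i - 1\<close> and \<open>i\<close>.\<close>
definition half_linked :: "nat list \<Rightarrow> nat \<Rightarrow> ncpoly" where
  "half_linked k i = label_sum (lin_exts (chain_elems k {..<length k})
     (chain_rel k {..<length k} \<union> down_links k {j. j + 1 < i} \<union> up_links k {j. i \<le> j \<and> j + 1 < length k}))"

text \<open>As \<open>half_linked\<close>, but with a comparison between any two consecutive chains: downwards before
  chain \<open>i\<close>, upwards after it.\<close>
definition fully_linked :: "nat list \<Rightarrow> nat \<Rightarrow> ncpoly" where
  "fully_linked k i = label_sum (lin_exts (chain_elems k {..<length k})
     (chain_rel k {..<length k} \<union> down_links k {j. j < i} \<union> up_links k {j. i \<le> j \<and> j + 1 < length k}))"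

lemma half_linked_eq_shuffle:
  assumes "is_index k" "i \<le> length k"
  shows "half_linked k i = shuffle (word_poly (word_of_index (rev (take i k)))) (w_index (drop i k))"
proof -
  have pos: "1 \<le> k ! j" if "j < length k" for j
    using is_index_nth[OF assms(1) that] .
  let ?A = "chain_elems k {..<i}" and ?B = "chain_elems k {i..<length k}"
  let ?R = "chain_rel k {..<i} \<union> down_links k {j. j + 1 < i}"
  let ?S = "chain_rel k {i..<length k} \<union> up_links k {j. i \<le> j \<and> j + 1 < length k}"
  have AB: "chain_elems k {..<length k} = ?A \<union> ?B"
    using assms(2) by (auto simp: chain_elems_def)
  have RS: "chain_rel k {..<length k} \<union> down_links k {j. j + 1 < i} \<union> up_links k {j. i \<le> j \<and> j + 1 < length k} = ?R \<union> ?S"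
  proof -
    have "chain_rel k {..<length k} = chain_rel k {..<i} \<union> chain_rel k {i..<length k}"
      using assms(2) by (auto simp: chain_rel_def)
    then show ?thesis by blast
  qed
  have "half_linked k i = shuffle (word_poly (map X_label (reversed_chains k i))) (label_sum (lin_exts ?B ?S))"
    unfolding half_linked_def AB RS
  proof (rule label_sum_disjoint_union)
    show "lin_exts ?A ?R = {reversed_chains k i}"
      using pos assms(2) by (intro lin_exts_reversed_chains) auto
    show "?A \<inter> ?B = {}" by (auto simp: chain_elems_def)
    show "?R \<subseteq> ?A \<times> ?A" "?S \<subseteq> ?B \<times> ?B"
      using pos assms(2) by (auto simp: chain_elems_def chain_rel_def down_links_def up_links_def)
  qed
  then show ?thesis
    using assms label_sum_tail[OF assms] by (simp add: map_X_label_reversed_chains)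
qed

text \<open>Decide the missing comparison between the chains \<open>i\<close> and \<open>i + 1\<close>.\<close>
lemma half_linked_Suc:
  assumes "is_index k" "Suc i < length k"
  shows "half_linked k (Suc i) = fully_linked k i + fully_linked k (Suc i)"
proof -
  let ?p = "(i, 1)" and ?q = "(i + 1, k ! (i + 1))"
  let ?R = "chain_rel k {..<length k} \<union> down_links k {j. j + 1 < Suc i} \<union> up_links k {j. Suc i \<le> j \<and> j + 1 < length k}"
  have "{j. i \<le> j \<and> j + 1 < length k} = insert i {j. Suc i \<le> j \<and> j + 1 < length k}"
    using assms(2) by auto
  then have "up_links k {j. i \<le> j \<and> j + 1 < length k} = insert (?p, ?q) (up_links k {j. Suc i \<le> j \<and> j + 1 < length k})"
    by (auto simp: up_links_def)
  moreover have "down_links k {j. j < Suc i} = insert (?q, ?p) (down_links k {j. j < i})"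
    by (auto simp: down_links_def less_Suc_eq)
  ultimately have full: "fully_linked k i = label_sum (lin_exts (chain_elems k {..<length k}) (insert (?p, ?q) ?R))"
    "fully_linked k (Suc i) = label_sum (lin_exts (chain_elems k {..<length k}) (insert (?q, ?p) ?R))"
    by (simp_all add: fully_linked_def)
  have "?p \<in> chain_elems k {..<length k}" "?q \<in> chain_elems k {..<length k}"
    using assms is_index_nth[OF assms(1)] by (auto simp: chain_elems_def)
  then show ?thesis
    unfolding half_linked_def full by (intro label_sum_split) auto
qed

lemma half_linked_0: "half_linked k 0 = fully_linked k 0"
  by (simp add: half_linked_def fully_linked_def down_links_def)

lemma half_linked_length:
  assumes "length k = Suc n"
  shows "half_linked k (Suc n) = fully_linked k n"
proof -
  have "up_links k {j. Suc n \<le> j \<and> j + 1 < length k} = up_links k {j. n \<le> j \<and> j + 1 < length k}"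
    using assms by (auto simp: up_links_def)
  then show ?thesis by (simp add: half_linked_def fully_linked_def)
qed

lemma h1_lin_exts:
  assumes "is_index k" "\<And>i. i \<in> I \<Longrightarrow> i < length k" "chain_rel k I \<subseteq> R"
  shows "label_sum (lin_exts (chain_elems k I) R) \<in> h1"
  unfolding label_sum_def
proof (intro h1_sum h1_single)
  fix xs assume xs: "xs \<in> lin_exts (chain_elems k I) R"
  show "h1_word (map X_label xs)"
  proof (cases xs)
    case (Cons x ys)
    obtain i j where x: "x = (i, j)" by (cases x)
    have ij: "i \<in> I" "1 \<le> j" "j \<le> k ! i"
      using xs by (auto simp: lin_exts_def chain_elems_def Cons x)
    have "j = 1"
    proof (rule ccontr)
      assume "j \<noteq> 1"
      then have "((i, j - 1), (i, j)) \<in> R"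
        using ij assms(3) by (auto simp: chain_rel_def intro!: subsetD[OF assms(3)])
      moreover have "(i, j - 1) \<in> chain_elems k I"
        using ij \<open>j \<noteq> 1\<close> by (auto simp: chain_elems_def)
      moreover have "chain_elems k I = insert (i, j) (set ys)"
        using xs by (auto simp: lin_exts_def Cons x)
      moreover have "(i, j - 1) \<noteq> (i, j)" using ij by simp
      ultimately have "(i, j - 1) \<in> set ys" "((i, j - 1), (i, j)) \<in> R"
        by blast+
      then show False
        using xs by (auto simp: lin_exts_def Cons x)
    qed
    then show ?thesis by (simp add: Cons x h1_word_def)
  qed simp
qed

lemma fully_linked_h1: "is_index k \<Longrightarrow> fully_linked k i \<in> h1"
  unfolding fully_linked_def by (rule h1_lin_exts) auto

lemma w_index_h1:
  assumes "is_index k"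
  shows "w_index k \<in> h1"
proof -
  have "w_index k = label_sum (linear_extensions k)"
    by (simp add: w_index_def label_sum_def)
  then show ?thesis
    unfolding linear_extensions_eq[OF assms] using h1_lin_exts[OF assms, of "{..<length k}"] by auto
qed

text \<open>By \<open>half_linked_eq_shuffle\<close> the terms are the regularized values of \<open>half_linked k i\<close>. Each is the
  sum of two neighbouring values for \<open>fully_linked\<close>, except for a single one at either end, so the
  alternating sum telescopes.\<close>
lemma zeta_star_antipode:
  assumes k: "is_index k" and "k \<noteq> []"
  shows "(\<Sum>i\<le>length k. (-1) ^ i * (Z_sh (word_poly (word_of_index (rev (take i k)))) * zeta_star_sh (drop i k))) = 0"
proof -
  obtain n where n: "length k = Suc n" using \<open>k \<noteq> []\<close> by (cases k) auto
  have half: "Z_sh (word_poly (word_of_index (rev (take i k)))) * zeta_star_sh (drop i k) = Z_sh (half_linked k i)"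
    if "i \<le> length k" for i
  proof -
    have "is_index (drop i k)" using k by (auto simp: is_index_def dest: in_set_dropD)
    then show ?thesis
      unfolding half_linked_eq_shuffle[OF k that] zeta_star_sh_def
      by (intro Z_sh_shuffle[symmetric] w_index_h1 h1_single h1_word_word_of_index)
  qed
  have partial: "(\<Sum>i\<le>m. (-1) ^ i * Z_sh (half_linked k i)) = (-1) ^ m * Z_sh (fully_linked k m)" if "m \<le> n" for m
    using that
  proof (induction m)
    case (Suc m)
    then have "Z_sh (half_linked k (Suc m)) = Z_sh (fully_linked k m) + Z_sh (fully_linked k (Suc m))"
      using k n by (subst half_linked_Suc) (auto intro!: Z_sh_add fully_linked_h1)
    with Suc show ?case by (simp add: algebra_simps)
  qed (simp add: half_linked_0)
  have "(\<Sum>i\<le>length k. (-1) ^ i * Z_sh (half_linked k i)) = 0"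
    unfolding n using partial[of n] half_linked_length[OF n] by simp
  then show ?thesis
    by (simp add: half)
qed


section \<open>The symmetric sum formula\<close>

definition sym_zeta_star :: "(nat \<Rightarrow> nat) \<Rightarrow> nat set \<Rightarrow> real poly" where
  "sym_zeta_star k A = (\<Sum>l\<in>permutations_of_set A. zeta_star_sh (map k l))"

text \<open>Cutting an ordering of \<open>A\<close> in two is the same as choosing a subset and ordering it and its complement.\<close>
lemma sum_permutations_split:
  fixes g :: "'a list \<Rightarrow> 'a list \<Rightarrow> 'b::comm_monoid_add"
  assumes A: "finite A"
  shows "(\<Sum>l\<in>permutations_of_set A. \<Sum>i\<le>length l. g (take i l) (drop i l)) =
         (\<Sum>B\<in>Pow A. \<Sum>l1\<in>permutations_of_set B. \<Sum>l2\<in>permutations_of_set (A - B). g l1 l2)"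
proof -
  let ?S = "Sigma (permutations_of_set A) (\<lambda>l. {..length l})"
  let ?T = "Sigma (Pow A) (\<lambda>B. permutations_of_set B \<times> permutations_of_set (A - B))"
  have "(\<Sum>l\<in>permutations_of_set A. \<Sum>i\<le>length l. g (take i l) (drop i l)) =
        (\<Sum>(l, i)\<in>?S. g (take i l) (drop i l))"
    by (intro sum.Sigma) auto
  also have "\<dots> = (\<Sum>(B, l1, l2)\<in>?T. g l1 l2)"
  proof (rule sum.reindex_bij_witness[where
        i = "\<lambda>(B, l1, l2). (l1 @ l2, length l1)" and j = "\<lambda>(l, i). (set (take i l), take i l, drop i l)"])
    fix x assume "x \<in> ?S"
    then obtain l i where x: "x = (l, i)" and l: "set l = A" "distinct l" and i: "i \<le> length l"
      by (auto dest: permutations_of_setD)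
    show "(\<lambda>(B, l1, l2). (l1 @ l2, length l1)) ((\<lambda>(l, i). (set (take i l), take i l, drop i l)) x) = x"
      using i by (simp add: x)
    have "set (take i l) \<union> set (drop i l) = A"
      using l by (simp flip: set_append)
    moreover have "set (take i l) \<inter> set (drop i l) = {}"
      using l(2) by (rule set_take_disj_set_drop_if_distinct) simp
    ultimately have "set (take i l) \<subseteq> A" "set (drop i l) = A - set (take i l)" by blast+
    then show "(\<lambda>(l, i). (set (take i l), take i l, drop i l)) x \<in> ?T"
      using l(2) by (simp add: x permutations_of_setI)
    show "(case (\<lambda>(l, i). (set (take i l), take i l, drop i l)) x of (B, l1, l2) \<Rightarrow> g l1 l2) =
          (case x of (l, i) \<Rightarrow> g (take i l) (drop i l))"
      by (simp add: x)
  next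
    fix y assume "y \<in> ?T"
    then obtain B l1 l2 where y: "y = (B, l1, l2)" and B: "B \<subseteq> A"
      and perms: "l1 \<in> permutations_of_set B" "l2 \<in> permutations_of_set (A - B)"
      by auto
    note l1 = permutations_of_setD[OF perms(1)] and l2 = permutations_of_setD[OF perms(2)]
    show "(\<lambda>(l, i). (set (take i l), take i l, drop i l)) ((\<lambda>(B, l1, l2). (l1 @ l2, length l1)) y) = y"
      using l1 by (simp add: y)
    have "set (l1 @ l2) = A" unfolding set_append l1 l2 using B by blast
    moreover have "distinct (l1 @ l2)" unfolding distinct_append l1 l2 using l1 l2 by blast
    ultimately show "(\<lambda>(B, l1, l2). (l1 @ l2, length l1)) y \<in> ?S"
      by (auto simp: y intro!: permutations_of_setI)
  qed
  also have "\<dots> = (\<Sum>B\<in>Pow A. \<Sum>(l1, l2)\<in>permutations_of_set B \<times> permutations_of_set (A - B). g l1 l2)"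
    using A by (subst sum.Sigma) auto
  also have "\<dots> = (\<Sum>B\<in>Pow A. \<Sum>l1\<in>permutations_of_set B. \<Sum>l2\<in>permutations_of_set (A - B). g l1 l2)"
    by (simp add: sum.cartesian_product)
  finally show ?thesis .
qed

lemma sym_antipode:
  assumes A: "finite A" "A \<noteq> {}" and k: "\<And>a. a \<in> A \<Longrightarrow> k a \<ge> 1"
  shows "(\<Sum>B\<in>Pow A. (-1) ^ card B * sym_mzv k B * sym_zeta_star k (A - B)) = 0"
proof -
  define g where "g = (\<lambda>l1 l2. (-1) ^ length l1 *
    (Z_sh (word_poly (word_of_index (map k (rev l1)))) * zeta_star_sh (map k l2)))"
  have "(\<Sum>i\<le>length l. g (take i l) (drop i l)) = 0" if l: "l \<in> permutations_of_set A" for l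
  proof -
    have "is_index (map k l)" "map k l \<noteq> []"
      using permutations_of_setD[OF l] A k by (auto simp: is_index_def)
    note zeta_star_antipode[OF this]
    moreover have "(\<Sum>i\<le>length l. g (take i l) (drop i l)) =
        (\<Sum>i\<le>length (map k l). (-1) ^ i * (Z_sh (word_poly (word_of_index (rev (take i (map k l))))) *
           zeta_star_sh (drop i (map k l))))"
      by (intro sum.cong) (auto simp: g_def take_map drop_map rev_map)
    ultimately show ?thesis by simp
  qed
  then have "0 = (\<Sum>l\<in>permutations_of_set A. \<Sum>i\<le>length l. g (take i l) (drop i l))"
    by simp
  also have "\<dots> = (\<Sum>B\<in>Pow A. \<Sum>l1\<in>permutations_of_set B. \<Sum>l2\<in>permutations_of_set (A - B). g l1 l2)"
    by (rule sum_permutations_split[OF A(1)])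
  also have "\<dots> = (\<Sum>B\<in>Pow A. (-1) ^ card B * sym_mzv k B * sym_zeta_star k (A - B))"
  proof (intro sum.cong refl)
    fix B assume "B \<in> Pow A"
    have len: "length l = card B" if "l \<in> permutations_of_set B" for l
      using permutations_of_setD[OF that] by (auto simp: distinct_card[symmetric])
    have "sym_mzv k B = (\<Sum>l\<in>rev ` permutations_of_set B. Z_sh (word_poly (word_of_index (map k l))))"
      by (simp add: sym_mzv_def)
    also have "\<dots> = (\<Sum>l\<in>permutations_of_set B. Z_sh (word_poly (word_of_index (map k (rev l)))))"
      by (subst sum.reindex) (auto simp: inj_on_def)
    finally have sym: "sym_mzv k B = \<dots>" .
    have "(\<Sum>l1\<in>permutations_of_set B. \<Sum>l2\<in>permutations_of_set (A - B). g l1 l2) =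
          (\<Sum>l1\<in>permutations_of_set B. \<Sum>l2\<in>permutations_of_set (A - B). (-1) ^ card B *
    (Z_sh (word_poly (word_of_index (map k (rev l1)))) * zeta_star_sh (map k l2)))"
      unfolding g_def by (intro sum.cong refl) (simp only: len)
    also have "\<dots> = (-1) ^ card B * (sym_mzv k B * sym_zeta_star k (A - B))"
      unfolding sym sym_zeta_star_def sum_product by (simp only: sum_distrib_left)
    finally show "(\<Sum>l1\<in>permutations_of_set B. \<Sum>l2\<in>permutations_of_set (A - B). g l1 l2) =
          (-1) ^ card B * sym_mzv k B * sym_zeta_star k (A - B)" by (simp only: mult.assoc)
  qed
  finally show ?thesis ..
qed

text \<open>The sign \<open>(-1) ^ card B\<close> distributes over the blocks, and \<open>(-1) ^ card P * (-1) ^ (card P - 1) = - 1\<close>.\<close>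
lemma signed_sym_mzv:
  assumes "finite B" "\<And>b. b \<in> B \<Longrightarrow> k b \<ge> 1"
  shows "(-1) ^ card B * sym_mzv k B = partition_sum (\<lambda>P. - block_weight k P) B"
proof -
  have "(-1) ^ card B * sym_mzv k B = partition_sum (\<lambda>P. (-1) ^ card P * signed_weight k P) B"
    using assms by (simp add: sym_mzv_eq_partition_sum partition_sum_sign)
  also have "\<dots> = partition_sum (\<lambda>P. - block_weight k P) B"
    unfolding partition_sum_def
  proof (intro sum.cong prod.cong refl)
    fix Q P assume Q: "Q \<in> {Q. partition_on B Q}" and P: "P \<in> Q"
    then have "P \<subseteq> B" "P \<noteq> {}" by (auto dest: partition_onD1 partition_onD3)
    then have "card P > 0" using assms(1) by (auto simp: card_gt_0_iff intro: finite_subset)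
    then obtain n where n: "card P = Suc n" using gr0_conv_Suc by auto
    have "(-1) ^ Suc n * (-1) ^ n = (-1 :: real poly)"
      by (simp flip: power_mult_distrib)
    then show "(-1) ^ card P * signed_weight k P = - block_weight k P"
      unfolding signed_weight_def n by (simp flip: mult.assoc)
  qed
  finally show ?thesis .
qed

text \<open>Star sums and partition sums are convolution inverses of the same family, which takes the value 1 at
  the empty set. The inverse is determined recursively by its values on smaller sets.\<close>
lemma sym_zeta_star_eq_partition_sum:
  assumes "finite A" "\<And>a. a \<in> A \<Longrightarrow> k a \<ge> 1"
  shows "sym_zeta_star k A = partition_sum (block_weight k) A"
  using assms
proof (induction "card A" arbitrary: A rule: less_induct)
  case less
  note k = less.prems(2)
  show ?case
  proof (cases "A = {}")
    case True
    have "linear_extensions [] = {[]}"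
      by (auto simp: linear_extensions_def X_elems_def)
    then have "zeta_star_sh [] = 1"
      by (simp add: zeta_star_sh_def w_index_def Z_sh_Nil)
    then show ?thesis by (simp add: True sym_zeta_star_def)
  next
    case False
    define s where "s = (\<lambda>B. partition_sum (\<lambda>P. - block_weight k P) B)"
    have s: "(-1) ^ card B * sym_mzv k B = s B" if "B \<subseteq> A" for B
      unfolding s_def by (rule signed_sym_mzv) (use that less.prems in \<open>auto intro: finite_subset\<close>)
    have zero: "(\<Sum>B\<in>Pow A. s B * sym_zeta_star k (A - B)) = 0"
      using sym_antipode[of A k, OF less.prems(1) False k] by (simp add: s cong: sum.cong_simp)
    have zero': "(\<Sum>B\<in>Pow A. s B * partition_sum (block_weight k) (A - B)) = 0"
      unfolding s_def partition_sum_convolution[OF less.prems(1)]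
      by (simp add: partition_sum_zero less.prems(1) False)
    have split: "(\<Sum>B\<in>Pow A. s B * h (A - B)) = h A + (\<Sum>B\<in>Pow A - {{}}. s B * h (A - B))" for h
      using less.prems(1) by (subst sum.remove[of _ "{}"]) (auto simp: s_def)
    have "(\<Sum>B\<in>Pow A - {{}}. s B * sym_zeta_star k (A - B)) =
          (\<Sum>B\<in>Pow A - {{}}. s B * partition_sum (block_weight k) (A - B))"
    proof (intro sum.cong refl arg_cong2[where f = "(*)"] less.hyps)
      fix B assume "B \<in> Pow A - {{}}"
      then show "card (A - B) < card A"
        using less.prems(1) by (intro psubset_card_mono) auto
    qed (use less.prems in auto)
    then show ?thesis
      using zero zero' unfolding split by (metis add_right_cancel)
  qed
qed

text \<open>A permutation is identified with the list of its values; lists count from 0, the permuted set from 1.\<close>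
lemma sum_permutes_eq_sum_lists:
  "(\<Sum>\<sigma> | \<sigma> permutes {1..r}. g (map \<sigma> [1..<r + 1])) = (\<Sum>l\<in>permutations_of_set {1..r}. g l)"
proof (rule sum.reindex_bij_witness[where j = "\<lambda>\<sigma>. map \<sigma> [1..<r + 1]" and
      i = "\<lambda>l x. if x \<in> {1..r} then l ! (x - 1) else x"])
  fix \<sigma> assume "\<sigma> \<in> {\<sigma>. \<sigma> permutes {1..r}}"
  then have \<sigma>: "\<sigma> permutes {1..r}" by simp
  show "(\<lambda>x. if x \<in> {1..r} then map \<sigma> [1..<r + 1] ! (x - 1) else x) = \<sigma>"
    using permutes_not_in[OF \<sigma>] by (auto simp: fun_eq_iff simp del: upt_Suc)
  have "{1..<r + 1} = {1..r}" by auto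
  then show "map \<sigma> [1..<r + 1] \<in> permutations_of_set {1..r}"
    using permutes_image[OF \<sigma>] permutes_inj_on[OF \<sigma>]
    by (intro permutations_of_setI) (simp_all add: distinct_map del: upt_Suc)
next
  fix l assume l: "l \<in> permutations_of_set {1..r}"
  then have set: "set l = {1..r}" and dist: "distinct l" by (auto dest: permutations_of_setD)
  have len: "length l = r" using distinct_card[OF dist] set by simp
  show "map (\<lambda>x. if x \<in> {1..r} then l ! (x - 1) else x) [1..<r + 1] = l"
    by (rule nth_equalityI) (auto simp: len simp del: upt_Suc)
  have "bij_betw (\<lambda>x. if x \<in> {1..r} then l ! (x - 1) else x) {1..r} {1..r}"
  proof (rule bij_betwI')
    fix x y assume "x \<in> {1..r}" "y \<in> {1..r}"
    then show "((if x \<in> {1..r} then l ! (x - 1) else x) = (if y \<in> {1..r} then l ! (y - 1) else y)) = (x = y)"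
      using dist by (auto simp: nth_eq_iff_index_eq len)
  next
    fix x assume x: "x \<in> {1..r}"
    then have "l ! (x - 1) \<in> set l" by (intro nth_mem) (auto simp: len)
    then show "(if x \<in> {1..r} then l ! (x - 1) else x) \<in> {1..r}" using set x by auto
  next
    fix y assume "y \<in> {1..r}"
    then obtain i where "i < r" "l ! i = y" using set len by (metis in_set_conv_nth)
    then show "\<exists>x\<in>{1..r}. y = (if x \<in> {1..r} then l ! (x - 1) else x)"
      by (intro bexI[of _ "Suc i"]) auto
  qed
  then show "(\<lambda>x. if x \<in> {1..r} then l ! (x - 1) else x) \<in> {\<sigma>. \<sigma> permutes {1..r}}"
    by (auto intro: bij_imp_permutes)
qed simp

theorem theorem1p1:
  fixes r :: nat and k :: "nat \<Rightarrow> nat"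
  assumes "r \<ge> 1" and "\<And>i. i \<in> {1..r} \<Longrightarrow> k i \<ge> 1"
  shows "(\<Sum>\<sigma> | \<sigma> permutes {1..r}. zeta_star_sh (map (\<lambda>i. k (\<sigma> i)) [1..<r + 1])) =
         (\<Sum>Q | partition_on {1..r} Q. of_nat (c_star Q) * H_sh k Q)"
proof -
  have "(\<Sum>\<sigma> | \<sigma> permutes {1..r}. zeta_star_sh (map (\<lambda>i. k (\<sigma> i)) [1..<r + 1])) =
        (\<Sum>\<sigma> | \<sigma> permutes {1..r}. zeta_star_sh (map k (map \<sigma> [1..<r + 1])))"
    by (simp add: comp_def)
  also have "\<dots> = sym_zeta_star k {1..r}"
    unfolding sym_zeta_star_def by (rule sum_permutes_eq_sum_lists)
  also have "\<dots> = partition_sum (block_weight k) {1..r}"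
    by (rule sym_zeta_star_eq_partition_sum) (use assms(2) in auto)
  also have "\<dots> = (\<Sum>Q | partition_on {1..r} Q. of_nat (c_star Q) * H_sh k Q)"
    unfolding partition_sum_def block_weight_def c_star_def H_sh_def
    by (simp add: prod.distrib)
  finally show ?thesis .
qed

end
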